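(* Let $\boldsymbol\alpha\in\mathbb{Q}^2$. There exists a distribution function $\widehat P_{\boldsymbol\alpha}(s)$ on $\mathbb{R}_{\ge0}$, continuous on all of $\mathbb{R}_{\ge0}$, such that for every $s\ge0$, $$\lim_{M\to\infty}M^{-1}\#\bigl\{1\le j\le M: M(\hat\xi_{M,j}-\hat\xi_{M,j-1})\ge s\bigr\}=\widehat P_{\boldsymbol\alpha}(s).$$
   Context: Let $q$ be the minimal positive integer with $q\boldsymbol\alpha\in\mathbb{Z}^2$ and let $\widehat{\mathbb{Z}}^2_{\boldsymbol\alpha}=\{\boldsymbol x\in(\mathbb{Z}^2+\boldsymbol\alpha)\setminus\{\boldsymbol0\}:\gcd(q\boldsymbol x)\le q\}$ be the set of points of $\mathbb{Z}^2+\boldsymbol\alpha$ visible from the origin. For $T>0$ consider the set of numbers $\{\frac1{2\pi}\arg(x_1+\mathrm{i}x_2):(x_1,x_2)\in\widehat{\mathbb{Z}}^2_{\boldsymbol\alpha},\ x_1^2+x_2^2<T^2\}\subset(-\frac12,\frac12]$. Let $M=M(T)$ be its cardinality and label its elements in order $-\frac12<\hat\xi_{M,1}<\hat\xi_{M,2}<\cdots<\hat\xi_{M,M}\le\frac12$; put $\hat\xi_{M,0}=\hat\xi_{M,M}-1$. The limit $M\to\infty$ is along $M=M(T)$, $T\to\infty$. "Distribution function" is meant in the tail sense: non-increasing, with value $1$ at $s=0$ and limit $0$ as $s\to\infty$. *)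

theory Defs
  imports "HOL-Analysis.Analysis"
begin

(* Only meaningful if both coordinates are rational. *)
definition common_denom :: "real \<times> real \<Rightarrow> nat" where
  "common_denom \<alpha> = (LEAST q. 0 < q \<and> real q * fst \<alpha> \<in> \<int> \<and> real q * snd \<alpha> \<in> \<int>)"

definition shifted_lattice :: "real \<times> real \<Rightarrow> (real \<times> real) set" where
  "shifted_lattice \<alpha> = {(of_int m + fst \<alpha>, of_int n + snd \<alpha>) | m n :: int. True}"

(* For x in the shifted lattice the vector q x is integral; a and b are its
   (unique) integer coordinates, so gcd a b is gcd(q x). *)
definition visible_points :: "real \<times> real \<Rightarrow> (real \<times> real) set" where
  "visible_points \<alpha> =
     {x \<in> shifted_lattice \<alpha> - {(0, 0)}.
        \<exists>a b :: int. real (common_denom \<alpha>) * fst x = of_int a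
                  \<and> real (common_denom \<alpha>) * snd x = of_int b
                  \<and> gcd a b \<le> int (common_denom \<alpha>)}"

(* A set of numbers, so equal directions are counted once. Arg takes values in (-pi, pi]. *)
definition directions :: "real \<times> real \<Rightarrow> real \<Rightarrow> real set" where
  "directions \<alpha> T =
     {Arg (Complex x1 x2) / (2 * pi) | x1 x2. (x1, x2) \<in> visible_points \<alpha> \<and> x1\<^sup>2 + x2\<^sup>2 < T\<^sup>2}"

definition num_directions :: "real \<times> real \<Rightarrow> real \<Rightarrow> nat" where
  "num_directions \<alpha> T = card (directions \<alpha> T)"

(* The j-th smallest direction, 1 <= j <= M, where M = num_directions \<alpha> T;
   index 0 is the last direction shifted by one full turn. The set of directions is
   finite, being the image of a bounded part of a lattice translate. *)
definition dir_xi :: "real \<times> real \<Rightarrow> real \<Rightarrow> nat \<Rightarrow> real" where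
  "dir_xi \<alpha> T j =
     (if j = 0 then sorted_list_of_set (directions \<alpha> T) ! (num_directions \<alpha> T - 1) - 1
      else sorted_list_of_set (directions \<alpha> T) ! (j - 1))"

(* "Distribution function" in the tail sense, on the half-line s >= 0;
   values at negative arguments are irrelevant. *)
definition tail_distribution_function :: "(real \<Rightarrow> real) \<Rightarrow> bool" where
  "tail_distribution_function P \<longleftrightarrow>
     antimono_on {0..} P \<and> P 0 = 1 \<and> (P \<longlongrightarrow> 0) at_top"

end

theory Submission imports Defs begin

text \<open>
  Put \<open>q = common_denom \<alpha>\<close>. Scaling by \<open>q\<close> identifies the directions with the primitive integer
  vectors \<open>v\<close> satisfying \<open>k v \<equiv> q \<alpha>\<close> modulo \<open>q\<close> and \<open>k |v| < q T\<close> for some \<open>1 \<le> k \<le> q\<close>. Complete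
  such a \<open>v\<close> to a unimodular basis by the unique \<open>w\<close> in a prescribed residue class modulo \<open>q\<close>
  for which \<open>\<rho> = w \<cdot> v / |v|\<^sup>2\<close> lies in \<open>[0, q)\<close>. Whether the gap before \<open>v\<close> is at least
  \<open>s / M\<close> is then decided, in the limit, by the membership of \<open>(|v|\<^sup>2 / (q T)\<^sup>2, \<rho>)\<close> in a planar
  set which depends only on the class of \<open>v\<close> and has a null boundary. So everything reduces to the
  equidistribution of these pairs.

  For a Farey interval \<open>m / n \<le> \<rho> < M / N\<close> with \<open>M n - m N = 1\<close> the bases \<open>(v, w)\<close> correspond to the
  bases \<open>(u, u')\<close> with \<open>v = N u + n u'\<close> and \<open>w = M u + m u'\<close>. Fixing \<open>u\<close>, the vector \<open>u'\<close> runs through an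
  arithmetic progression, and counting the possible \<open>u\<close> shows that at least the fraction
  \<open>N / (N + n q)\<close> of the expected number of bases occurs. This is almost sharp if \<open>N / n\<close> is
  large, and every Farey interval can be cut into intervals of this kind up to an arbitrarily
  small remainder. As the total number of bases is known, the lower bounds are asymptotic equalities.
\<close>

section \<open>Asymptotic lower bounds\<close>

text \<open>The obstacle is that the geometry yields only one-sided estimates: the substitution
  captures just the bases with \<open>dotp u u' >= 0\<close>, and every window of the progression is
  estimated by its worst point. So everything is phrased through \<open>lbd f L\<close>, that is,
  liminf f(Y)/Y >= L. Such bounds add over disjoint pieces and pass to suprema of L without
  uniformity in Y, so no rates are needed; an upper bound appears only when lower bounds of
  complementary pieces add up to a known total. This is used for the two parts of [0, q), and again
  for the bases with and without a close neighbour, where both kinds must contain open sets of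
  complementary area. That is what the null boundary is for. The fraction N / (N + n q) arises thus:
  u with its partner in the l-th window gives |v| < (N + n q l) |u| up to a bounded error in |v|^2,
  so the bases have density at least kap times the sum over l >= 1 of (N + n q l)^-2, which is at
  least kap / (n q (N + n q)); expected is kap / (q n N). The total is the density kap of primitive
  vectors in a residue class, found by a contraction argument in place of Moebius inversion.\<close>

definition lbd :: "(real \<Rightarrow> real) \<Rightarrow> real \<Rightarrow> bool" where
  "lbd f L \<longleftrightarrow> (\<forall>\<epsilon>>0. \<forall>\<^sub>F Y in at_top. (L - \<epsilon>) * Y \<le> f Y)"

lemma lbdD: "lbd f L \<Longrightarrow> \<epsilon> > 0 \<Longrightarrow> \<forall>\<^sub>F Y in at_top. (L - \<epsilon>) * Y \<le> f Y"
  by (simp add: lbd_def)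

lemma lbd_mono:
  assumes "lbd f L" "L' \<le> L" "\<forall>\<^sub>F Y in at_top. f Y \<le> g Y"
  shows "lbd g L'"
  unfolding lbd_def
proof (intro allI impI)
  fix \<epsilon> :: real assume "\<epsilon> > 0"
  show "\<forall>\<^sub>F Y in at_top. (L' - \<epsilon>) * Y \<le> g Y"
    using lbdD[OF assms(1) \<open>\<epsilon> > 0\<close>] assms(3) eventually_ge_at_top[of 0]
  proof eventually_elim
    case (elim Y)
    have "(L' - \<epsilon>) * Y \<le> (L - \<epsilon>) * Y" using elim assms(2) by (intro mult_right_mono) auto
    then show ?case using elim by linarith
  qed
qed

lemma lbd_nonneg: "(\<And>Y. f Y \<ge> 0) \<Longrightarrow> L \<le> 0 \<Longrightarrow> lbd f L"
  unfolding lbd_def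
proof (intro allI impI)
  fix \<epsilon> :: real assume a: "\<epsilon> > 0" "\<And>Y. f Y \<ge> 0" "L \<le> 0"
  show "\<forall>\<^sub>F Y in at_top. (L - \<epsilon>) * Y \<le> f Y"
    using eventually_ge_at_top[of 0]
  proof eventually_elim
    case (elim Y)
    have "(L - \<epsilon>) * Y \<le> 0" using a elim by (intro mult_nonpos_nonneg) auto
    then show ?case using a(2)[of Y] by linarith
  qed
qed

lemma lbd_add:
  assumes "lbd f L" "lbd g K" shows "lbd (\<lambda>Y. f Y + g Y) (L + K)"
  unfolding lbd_def
proof (intro allI impI)
  fix \<epsilon> :: real assume "\<epsilon> > 0"
  then have e: "\<epsilon>/2 > 0" by simp
  show "\<forall>\<^sub>F Y in at_top. (L + K - \<epsilon>) * Y \<le> f Y + g Y"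
    using lbdD[OF assms(1) e] lbdD[OF assms(2) e]
    by eventually_elim (simp add: algebra_simps)
qed

lemma lbd_zero: "lbd (\<lambda>_. 0) 0"
  by (rule lbd_nonneg) auto

lemma lbd_sum:
  "finite I \<Longrightarrow> (\<And>i. i \<in> I \<Longrightarrow> lbd (f i) (L i)) \<Longrightarrow> lbd (\<lambda>Y. \<Sum>i\<in>I. f i Y) (\<Sum>i\<in>I. L i)"
  by (induction rule: finite_induct) (simp_all add: lbd_zero lbd_add)

lemma lbd_cmult:
  assumes "lbd f L" "c > 0" shows "lbd (\<lambda>Y. f (c * Y)) (c * L)"
  unfolding lbd_def
proof (intro allI impI)
  fix \<epsilon> :: real assume "\<epsilon> > 0"
  then have e: "\<epsilon>/c > 0" using assms by simp
  have "filterlim (\<lambda>Y. c * Y) at_top at_top"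
    by (rule filterlim_tendsto_pos_mult_at_top[OF tendsto_const assms(2) filterlim_ident])
  note eventually_compose_filterlim[OF lbdD[OF assms(1) e] this]
  moreover have "(L - \<epsilon>/c) * (c * Y) = (c * L - \<epsilon>) * Y" for Y
    using assms(2) by (simp add: algebra_simps)
  ultimately show "\<forall>\<^sub>F Y in at_top. (c * L - \<epsilon>) * Y \<le> f (c * Y)"
    by simp
qed

text \<open>Absorbs the additive \<open>n^2\<close> in the norm estimate for
  \<open>comb N u n u'\<close>.\<close>

lemma lbd_shift:
  assumes "lbd f L" shows "lbd (\<lambda>Y. f (Y - a)) L"
  unfolding lbd_def
proof (intro allI impI)
  fix \<epsilon> :: real assume "\<epsilon> > 0"
  then have e: "\<epsilon>/2 > 0" by simp
  have "filterlim (\<lambda>Y. -a + Y) at_top at_top"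
    by (rule filterlim_tendsto_add_at_top[OF tendsto_const filterlim_ident])
  then have "filterlim (\<lambda>Y. Y - a) at_top at_top" by simp
  from eventually_compose_filterlim[OF lbdD[OF assms(1) e] this]
  show "\<forall>\<^sub>F Y in at_top. (L - \<epsilon>) * Y \<le> f (Y - a)"
    \<comment> \<open>Beyond this threshold the loss \<open>(L - \<epsilon>/2) * a\<close> is at
      most \<open>\<epsilon>/2 * Y\<close>.\<close>
    using eventually_ge_at_top[of "2 * (L - \<epsilon>/2) * a / \<epsilon>"]
  proof eventually_elim
    case (elim Y)
    have "2 * (L - \<epsilon>/2) * a \<le> Y * \<epsilon>" using elim(2) \<open>\<epsilon> > 0\<close> by (simp add: field_simps)
    then have "(L - \<epsilon>/2) * a \<le> (\<epsilon>/2) * Y" by (simp add: algebra_simps)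
    moreover have "(L - \<epsilon>/2) * (Y - a) = (L - \<epsilon>) * Y + (\<epsilon>/2) * Y - (L - \<epsilon>/2) * a"
      by (simp add: field_simps)
    ultimately have "(L - \<epsilon>) * Y \<le> (L - \<epsilon>/2) * (Y - a)" by linarith
    then show ?case using elim(1) by linarith
  qed
qed

text \<open>For a given \<epsilon> a single index with \<open>L n\<close> near \<open>L0\<close>
  suffices, so the bounds may set in at different Y for different n. This is how auxiliary
  parameters are sent to infinity after Y.\<close>

lemma lbd_limit:
  assumes "\<And>n::nat. lbd f (L n)" "L \<longlonglongrightarrow> L0" shows "lbd f L0"
  unfolding lbd_def
proof (intro allI impI)
  fix \<epsilon> :: real assume "\<epsilon> > 0"
  then have e: "\<epsilon>/2 > 0" by simp
  from order_tendstoD(1)[OF assms(2), of "L0 - \<epsilon>/2"] e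
  obtain n where n: "L n > L0 - \<epsilon>/2" by (auto simp: eventually_sequentially)
  show "\<forall>\<^sub>F Y in at_top. (L0 - \<epsilon>) * Y \<le> f Y"
    using lbdD[OF assms(1)[of n] e] eventually_ge_at_top[of 0]
  proof eventually_elim
    case (elim Y)
    have "(L0 - \<epsilon>) * Y \<le> (L n - \<epsilon>/2) * Y" using elim n by (intro mult_right_mono) auto
    then show ?case using elim by linarith
  qed
qed

lemma lbd_tendsto:
  assumes "((\<lambda>Y. f Y / Y) \<longlongrightarrow> L) at_top" shows "lbd f L"
  unfolding lbd_def
proof (intro allI impI)
  fix \<epsilon> :: real assume "\<epsilon> > 0"
  then have "L - \<epsilon> < L" by simp
  from order_tendstoD(1)[OF assms this] eventually_gt_at_top[of 0]
  show "\<forall>\<^sub>F Y in at_top. (L - \<epsilon>) * Y \<le> f Y"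
    by eventually_elim (simp add: pos_less_divide_eq)
qed

lemma tendsto_lbd_uminus:
  assumes "((\<lambda>Y. f Y / Y) \<longlongrightarrow> L) at_top" shows "lbd (\<lambda>Y. - f Y) (- L)"
  using assms by (intro lbd_tendsto) (simp add: tendsto_minus_cancel_left)

lemma lbd_imp_tendsto:
  assumes "lbd f L" "lbd (\<lambda>Y. - f Y) (- L)" shows "((\<lambda>Y. f Y / Y) \<longlongrightarrow> L) at_top"
proof (rule order_tendstoI)
  fix a assume "a < L"
  then have e: "(L - a)/2 > 0" by simp
  show "\<forall>\<^sub>F Y in at_top. a < f Y / Y"
    using lbdD[OF assms(1) e] eventually_gt_at_top[of 0]
  proof eventually_elim
    case (elim Y)
    have "a < L - (L - a)/2" using \<open>a < L\<close> by (simp add: field_simps)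
    then have "a * Y < (L - (L - a)/2) * Y" using elim by (intro mult_strict_right_mono) auto
    then have "a * Y < f Y" using elim by linarith
    then show ?case using elim by (simp add: pos_less_divide_eq)
  qed
next
  fix a assume "L < a"
  then have e: "(a - L)/2 > 0" by simp
  show "\<forall>\<^sub>F Y in at_top. f Y / Y < a"
    using lbdD[OF assms(2) e] eventually_gt_at_top[of 0]
  proof eventually_elim
    case (elim Y)
    have "- a < - L - (a - L)/2" using \<open>L < a\<close> by (simp add: field_simps)
    then have "- a * Y < (- L - (a - L)/2) * Y" using elim by (intro mult_strict_right_mono) auto
    then have "- a * Y < - f Y" using elim by linarith
    then show ?case using elim by (simp add: pos_divide_less_eq)
  qed
qed

text \<open>Subtracting the lower bound of \<open>g\<close> from the known total gives the upper
  bound of \<open>f\<close>.\<close>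

lemma lbd_squeeze:
  assumes "lbd f A" "lbd g B" "((\<lambda>Y. (f Y + g Y) / Y) \<longlongrightarrow> A + B) at_top"
  shows "((\<lambda>Y. f Y / Y) \<longlongrightarrow> A) at_top"
proof (rule lbd_imp_tendsto[OF assms(1)])
  have "lbd (\<lambda>Y. - (f Y + g Y) + g Y) (- (A + B) + B)"
    by (intro lbd_add tendsto_lbd_uminus assms)
  then show "lbd (\<lambda>Y. - f Y) (- A)" by simp
qed

section \<open>Integer vectors in the plane\<close>

definition crs :: "int \<times> int \<Rightarrow> int \<times> int \<Rightarrow> int" where
  "crs u v = fst u * snd v - snd u * fst v"

definition dotp :: "int \<times> int \<Rightarrow> int \<times> int \<Rightarrow> int" where
  "dotp u v = fst u * fst v + snd u * snd v"

abbreviation nsq :: "int \<times> int \<Rightarrow> int" where "nsq u \<equiv> dotp u u"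

abbreviation rsq :: "int \<times> int \<Rightarrow> real" where "rsq u \<equiv> real_of_int (nsq u)"

definition comb :: "int \<Rightarrow> int \<times> int \<Rightarrow> int \<Rightarrow> int \<times> int \<Rightarrow> int \<times> int" where
  "comb a u b v = (a * fst u + b * fst v, a * snd u + b * snd v)"

definition prim :: "int \<times> int \<Rightarrow> bool" where
  "prim u \<longleftrightarrow> coprime (fst u) (snd u)"

definition vcong :: "int \<Rightarrow> int \<times> int \<Rightarrow> int \<times> int \<Rightarrow> bool" where
  "vcong q u v \<longleftrightarrow> q dvd fst u - fst v \<and> q dvd snd u - snd v"

lemmas vec_defs = crs_def dotp_def comb_def prim_def vcong_def

lemma vcong_sym: "vcong q u v \<Longrightarrow> vcong q v u"
  by (metis dvd_diff_commute vcong_def)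

lemma vcong_trans: "vcong q u v \<Longrightarrow> vcong q v w \<Longrightarrow> vcong q u w"
  unfolding vcong_def using dvd_add[of q "fst u - fst v" "fst v - fst w"] dvd_add[of q "snd u - snd v" "snd v - snd w"]
  by simp

lemma vcong_comb:
  assumes "vcong q u u'" "vcong q v v'" shows "vcong q (comb a u b v) (comb a u' b v')"
proof -
  obtain r s t w where "fst u - fst u' = q * r" "snd u - snd u' = q * s" "fst v - fst v' = q * t" "snd v - snd v' = q * w"
    using assms unfolding vcong_def dvd_def by blast
  then have e: "fst u = fst u' + q * r" "snd u = snd u' + q * s" "fst v = fst v' + q * t" "snd v = snd v' + q * w"
    by auto
  show ?thesis unfolding vcong_def comb_def
    unfolding fst_conv snd_conv e
    by (metis (no_types, opaque_lifting) add_diff_add add_diff_cancel_left' dvd_add dvd_mult dvd_triv_left mult.left_commute right_diff_distrib')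
qed

lemma nsq_nonneg: "nsq u \<ge> 0" by (simp add: dotp_def)

lemma nsq_eq_0: "nsq u = 0 \<longleftrightarrow> u = (0, 0)"
  by (cases u) (auto simp: dotp_def sum_squares_eq_zero_iff)

lemma nsq_pos: "u \<noteq> (0, 0) \<Longrightarrow> nsq u \<ge> 1"
  using nsq_eq_0[of u] nsq_nonneg[of u] by linarith

lemma lagrange: "nsq u * nsq v = (dotp u v)\<^sup>2 + (crs u v)\<^sup>2"
  by (simp add: dotp_def crs_def power2_eq_square algebra_simps)

lemma crs_1_prim: "crs u v = 1 \<Longrightarrow> prim u" "crs u v = 1 \<Longrightarrow> prim v"
proof -
  assume "crs u v = 1"
  then have 1: "fst u * snd v - snd u * fst v = 1" by (simp add: crs_def)
  show "prim u" unfolding prim_def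
    by (rule coprimeI) (metis 1 dvd_diff dvd_mult2)
  show "prim v" unfolding prim_def
    by (rule coprimeI) (metis 1 dvd_diff dvd_mult)
qed

lemma crs_1_nz: "crs u v = 1 \<Longrightarrow> u \<noteq> (0, 0)" "crs u v = 1 \<Longrightarrow> v \<noteq> (0, 0)"
  by (auto simp: crs_def)

lemma prim_nz: "prim u \<Longrightarrow> u \<noteq> (0, 0)"
  by (auto simp: prim_def)

lemma prim_bezout:
  assumes "prim u" obtains v where "crs u v = 1"
proof -
  obtain a b where "a * fst u + b * snd u = 1"
    using assms bezout_int[of "fst u" "snd u"] unfolding prim_def by auto
  then have "crs u (-b, a) = 1" by (simp add: crs_def algebra_simps)
  then show ?thesis using that by blast
qed

lemma nsq_less_box: "nsq u < int n \<Longrightarrow> \<bar>fst u\<bar> < int n \<and> \<bar>snd u\<bar> < int n"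
proof -
  assume a: "nsq u < int n"
  have *: "\<bar>x\<bar> \<le> x * x" for x :: int
  proof (cases "x = 0")
    case False
    then have "\<bar>x\<bar> * 1 \<le> \<bar>x\<bar> * \<bar>x\<bar>" by (intro mult_left_mono) auto
    then show ?thesis by simp
  qed simp
  show ?thesis using a *[of "fst u"] *[of "snd u"] unfolding dotp_def
    by (smt (verit) zero_le_square)
qed

lemma finite_nsq_less: "finite {u. rsq u < Y}"
proof (rule finite_subset)
  define n where "n = nat \<lceil>\<bar>Y\<bar>\<rceil>"
  show "{u. rsq u < Y} \<subseteq> {- int n..int n} \<times> {- int n..int n}"
  proof
    fix u assume "u \<in> {u. rsq u < Y}"
    then have "rsq u < Y" by simp
    also have "Y \<le> real n" unfolding n_def by (simp add: of_nat_nat le_of_int_ceiling) linarith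
    finally have "nsq u < int n" by linarith
    then show "u \<in> {- int n..int n} \<times> {- int n..int n}"
      using nsq_less_box[of u n] by (cases u) auto
  qed
qed auto

text \<open>The bound has to hold for every positive Y, because it is summed over the radii
  \<open>Y / d^2\<close> for many d at once. Leaving out the origin makes the count vanish for
  \<open>Y <= 1\<close>.\<close>

lemma card_nsq_less_le:
  assumes "Y > 0"
  shows "real (card {u. u \<noteq> (0, 0) \<and> rsq u < Y}) \<le> 9 * Y"
proof (cases "Y \<le> 1")
  case True
  have "{u. u \<noteq> (0, 0) \<and> rsq u < Y} = {}"
  proof -
    have "\<not> rsq u < Y" if "u \<noteq> (0, 0)" for u
      using nsq_pos[OF that] True by linarith
    then show ?thesis by blast
  qed
  then show ?thesis using assms by (simp only: card.empty)
next
  case False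
  define n where "n = nat \<lfloor>sqrt Y\<rfloor>"
  have n: "real n \<le> sqrt Y" "int n = \<lfloor>sqrt Y\<rfloor>" using False by (auto simp: n_def)
  have *: "\<bar>x\<bar> \<le> int n" if "real_of_int (x * x) < Y" for x :: int
  proof -
    have "(real_of_int \<bar>x\<bar>)\<^sup>2 < Y" using that by (simp add: power2_eq_square)
    then have "real_of_int \<bar>x\<bar> < sqrt Y" using real_less_rsqrt by blast
    then show ?thesis unfolding n(2) by linarith
  qed
  have "{u. u \<noteq> (0, 0) \<and> rsq u < Y} \<subseteq> {- int n..int n} \<times> {- int n..int n}"
  proof
    fix u assume "u \<in> {u. u \<noteq> (0, 0) \<and> rsq u < Y}"
    then have "real_of_int (fst u * fst u) + real_of_int (snd u * snd u) < Y" by (simp add: dotp_def)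
    then have "real_of_int (fst u * fst u) < Y" "real_of_int (snd u * snd u) < Y"
      by (smt (verit) of_int_0_le_iff zero_le_square)+
    from *[OF this(1)] *[OF this(2)]
    show "u \<in> {- int n..int n} \<times> {- int n..int n}" by (cases u) auto
  qed
  then have "card {u. u \<noteq> (0, 0) \<and> rsq u < Y} \<le> card ({- int n..int n} \<times> {- int n..int n})"
    by (intro card_mono) auto
  also have "\<dots> = (2 * n + 1)\<^sup>2" by (simp add: card_cartesian_product power2_eq_square nat_add_distrib nat_mult_distrib)
  finally have "real (card {u. u \<noteq> (0, 0) \<and> rsq u < Y}) \<le> real ((2 * n + 1)\<^sup>2)"
    by (simp only: of_nat_le_iff)
  also have "\<dots> = (2 * real n + 1)\<^sup>2" by simp
  also have "\<dots> \<le> (3 * sqrt Y)\<^sup>2"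
  proof (intro power_mono)
    have "1 \<le> sqrt Y" using False by simp
    then show "2 * real n + 1 \<le> 3 * sqrt Y" using n by linarith
  qed auto
  also have "\<dots> = 9 * Y" using False by (simp add: power_mult_distrib)
  finally show ?thesis .
qed


section \<open>Primitive vectors in a residue class\<close>

text \<open>The half-open squares of side q at the points of one residue class tile the plane, so
  counting these points becomes computing areas.\<close>

definition cell :: "int \<Rightarrow> int \<times> int \<Rightarrow> (real \<times> real) set" where
  "cell q u = {real_of_int (fst u)..<real_of_int (fst u + q)} \<times> {real_of_int (snd u)..<real_of_int (snd u + q)}"

lemma emeasure_lborel_half_open_Times:
  fixes a b c d :: real
  assumes "a \<le> b" "c \<le> d"
  shows "emeasure lborel ({a..<b} \<times> {c..<d}) = ennreal ((b - a) * (d - c))"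
proof -
  have "emeasure lborel ({a..<b} \<times> {c..<d}) = emeasure (lborel \<Otimes>\<^sub>M lborel) ({a..<b} \<times> {c..<d})"
    by (simp add: lborel_prod)
  also have "\<dots> = emeasure lborel {a..<b} * emeasure lborel {c..<d}"
    by (intro lborel.emeasure_pair_measure_Times) auto
  also have "\<dots> = ennreal ((b - a) * (d - c))"
    using assms by (simp add: ennreal_mult)
  finally show ?thesis .
qed

lemma half_open_Times_sets: "{a..<b} \<times> {c..<d} \<in> sets (borel :: (real \<times> real) measure)" for a b c d :: real
  unfolding borel_prod[symmetric] by (intro pair_measureI) auto

lemma cell_disjoint:
  assumes "q > 0" "vcong q u c" "vcong q v c" "x \<in> cell q u" "x \<in> cell q v" shows "u = v"
proof -
  have *: "a = b" if "q dvd a - c" "q dvd b - c" "real_of_int a \<le> y" "y < real_of_int (a + q)"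
    "real_of_int b \<le> y" "y < real_of_int (b + q)" for a b c :: int and y
  proof -
    have "q dvd a - b" using dvd_diff[OF that(1,2)] by simp
    moreover have "real_of_int a < real_of_int (b + q)" "real_of_int b < real_of_int (a + q)"
      using that by linarith+
    then have "\<bar>a - b\<bar> < q" by linarith
    ultimately show ?thesis using dvd_imp_le_int[of "a - b" q] assms(1) by force
  qed
  have "fst u = fst v" using assms by (intro *[of _ "fst c" _ "fst x"]) (auto simp: cell_def vcong_def)
  moreover have "snd u = snd v" using assms by (intro *[of _ "snd c" _ "snd x"]) (auto simp: cell_def vcong_def)
  ultimately show ?thesis by (simp add: prod_eq_iff)
qed

lemma cell_cover:
  assumes "q > 0" obtains u where "vcong q u c" "x \<in> cell q u"
proof -
  define f where "f a y = a + q * \<lfloor>(y - real_of_int a) / q\<rfloor>" for a :: int and y :: real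
  have f: "real_of_int (f a y) \<le> y \<and> y < real_of_int (f a y + q) \<and> q dvd f a y - a" for a y
  proof -
    have "of_int \<lfloor>(y - real_of_int a) / q\<rfloor> \<le> (y - real_of_int a) / q"
      "(y - real_of_int a) / q < of_int \<lfloor>(y - real_of_int a) / q\<rfloor> + 1" by linarith+
    then have "real_of_int \<lfloor>(y - real_of_int a) / q\<rfloor> * real_of_int q \<le> y - a"
      "y - a < (real_of_int \<lfloor>(y - real_of_int a) / q\<rfloor> + 1) * real_of_int q"
      using assms by (simp_all only: pos_le_divide_eq pos_divide_less_eq of_int_0_less_iff)
    then show ?thesis by (simp add: f_def algebra_simps)
  qed
  show ?thesis
    by (rule that[of "(f (fst c) (fst x), f (snd c) (snd x))"])
      (use f in \<open>auto simp: vcong_def cell_def mem_Times_iff\<close>)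
qed

lemma cell_dist:
  assumes "q > 0" "x \<in> cell q u" shows "norm (x - (real_of_int (fst u), real_of_int (snd u))) \<le> 2 * q"
proof -
  have "norm (x - (real_of_int (fst u), real_of_int (snd u))) \<le> \<bar>fst x - fst u\<bar> + \<bar>snd x - snd u\<bar>"
    using sqrt_sum_squares_le_sum_abs[of "fst x - fst u" "snd x - snd u"] by (simp add: norm_prod_def)
  also have "\<dots> \<le> 2 * q" using assms by (auto simp: cell_def)
  finally show ?thesis .
qed

lemma norm_int_vec: "norm (real_of_int (fst u), real_of_int (snd u)) = sqrt (nsq u)"
  by (simp add: norm_prod_def dotp_def power2_eq_square)

text \<open>The squares of the counted points lie in the disc of radius \<open>sqrt Y + 2q\<close>
  and cover the disc of radius \<open>sqrt Y - 2q\<close>. Both discs have area \<open>pi Y\<close>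
  to leading order, and each square has area \<open>q^2\<close>.\<close>

lemma lattice_count:
  assumes q: "q > 0"
  shows "((\<lambda>Y. real (card {u. vcong q u c \<and> rsq u < Y}) / Y) \<longlongrightarrow> pi / (real_of_int q)\<^sup>2) at_top"
proof -
  define A where "A Y = {u. vcong q u c \<and> rsq u < Y}" for Y :: real
  have finA: "finite (A Y)" for Y
    by (rule finite_subset[OF _ finite_nsq_less[of Y]]) (auto simp: A_def)
  have meas: "emeasure lborel (\<Union>u\<in>A Y. cell q u) = ennreal (q\<^sup>2 * card (A Y))" for Y
  proof -
    have "emeasure lborel (\<Union>u\<in>A Y. cell q u) = (\<Sum>u\<in>A Y. emeasure lborel (cell q u))"
    proof (intro sum_emeasure[symmetric] finA)
      show "cell q ` A Y \<subseteq> sets lborel" by (auto simp: cell_def simp del: of_int_add intro!: half_open_Times_sets)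
      show "disjoint_family_on (cell q) (A Y)"
        unfolding disjoint_family_on_def A_def using cell_disjoint[OF q] by blast
    qed
    also have "\<dots> = (\<Sum>u\<in>A Y. ennreal (q\<^sup>2))"
      using q by (intro sum.cong refl) (simp add: cell_def emeasure_lborel_half_open_Times power2_eq_square)
    also have "\<dots> = ennreal (q\<^sup>2 * card (A Y))"
      by (simp add: ennreal_mult' ennreal_of_nat_eq_real_of_nat mult.commute)
    finally show ?thesis .
  qed
  have ballm: "emeasure lborel (ball (0 :: real \<times> real) r) = ennreal (pi * r\<^sup>2)" if "r \<ge> 0" for r
    using emeasure_ball[OF that, of "0 :: real \<times> real"] by (simp add: unit_ball_vol_2 power2_eq_square)
  have up: "real_of_int (q\<^sup>2) * card (A Y) \<le> pi * (sqrt Y + 2 * q)\<^sup>2" if "Y > 0" for Y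
  proof -
    have "(\<Union>u\<in>A Y. cell q u) \<subseteq> ball 0 (sqrt Y + 2 * q)"
    proof safe
      fix x y u assume u: "u \<in> A Y" "(x, y) \<in> cell q u"
      have "norm (real_of_int (fst u), real_of_int (snd u)) < sqrt Y"
        using u by (simp add: norm_int_vec A_def)
      moreover have "norm (x, y) \<le> norm ((x, y) - (real_of_int (fst u), real_of_int (snd u))) + norm (real_of_int (fst u), real_of_int (snd u))"
        by (metis norm_triangle_sub add.commute)
      ultimately show "(x, y) \<in> ball 0 (sqrt Y + 2 * q)" using cell_dist[OF q u(2)] by simp
    qed
    then have "emeasure lborel (\<Union>u\<in>A Y. cell q u) \<le> emeasure lborel (ball (0 :: real \<times> real) (sqrt Y + 2 * q))"
      by (intro emeasure_mono) auto
    then show ?thesis using that q by (subst (asm) meas, subst (asm) ballm) auto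
  qed
  have lo: "real_of_int (q\<^sup>2) * card (A Y) \<ge> pi * (sqrt Y - 2 * q)\<^sup>2" if "Y > 0" "sqrt Y \<ge> 2 * q" for Y
  proof -
    have "ball 0 (sqrt Y - 2 * q) \<subseteq> (\<Union>u\<in>A Y. cell q u)"
    proof
      fix x :: "real \<times> real" assume x: "x \<in> ball 0 (sqrt Y - 2 * q)"
      obtain u where u: "vcong q u c" "x \<in> cell q u" using cell_cover[OF q] by blast
      have "norm (real_of_int (fst u), real_of_int (snd u)) \<le> norm (x - (real_of_int (fst u), real_of_int (snd u))) + norm x"
        by (metis norm_triangle_sub add.commute norm_minus_commute)
      moreover have "norm x < sqrt Y - 2 * q" using x by simp
      ultimately have "sqrt (nsq u) < sqrt Y" using cell_dist[OF q u(2)] unfolding norm_int_vec by linarith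
      then show "x \<in> (\<Union>u\<in>A Y. cell q u)" using u unfolding A_def by (intro UN_I[of u]) simp_all
    qed
    then have "emeasure lborel (ball (0 :: real \<times> real) (sqrt Y - 2 * q)) \<le> emeasure lborel (\<Union>u\<in>A Y. cell q u)"
    proof (intro emeasure_mono)
      show "(\<Union>u\<in>A Y. cell q u) \<in> sets lborel"
        using finA by (intro sets.finite_UN) (auto simp: cell_def simp del: of_int_add intro!: half_open_Times_sets)
    qed
    then show ?thesis using that q by (subst (asm) meas, subst (asm) ballm) auto
  qed
  have lim: "((\<lambda>Y. pi * (1 + d / sqrt Y)\<^sup>2 / q\<^sup>2) \<longlongrightarrow> pi * (1 + 0)\<^sup>2 / q\<^sup>2) at_top" for d :: real
    using q by (intro tendsto_intros real_tendsto_divide_at_top[OF tendsto_const] sqrt_at_top) auto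
  have sq: "pi * (sqrt Y + d)\<^sup>2 / q\<^sup>2 / Y = pi * (1 + d / sqrt Y)\<^sup>2 / q\<^sup>2" if "Y > 0" for Y d :: real
  proof -
    have "(1 + d / sqrt Y)\<^sup>2 = ((sqrt Y + d) / sqrt Y)\<^sup>2" using that by (simp add: add_divide_distrib)
    also have "\<dots> = (sqrt Y + d)\<^sup>2 / Y" using that by (simp add: power_divide)
    finally show ?thesis by simp
  qed
  have "((\<lambda>Y. real (card (A Y)) / Y) \<longlongrightarrow> pi * (1 + 0)\<^sup>2 / q\<^sup>2) at_top"
  proof (rule tendsto_sandwich[OF _ _ lim[of "- (2 * q)"] lim[of "2 * q"]])
    have "\<forall>\<^sub>F Y in at_top. sqrt Y \<ge> 2 * q"
      using sqrt_at_top by (auto simp: filterlim_at_top)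
    then show "\<forall>\<^sub>F Y in at_top. pi * (1 + real_of_int (- (2 * q)) / sqrt Y)\<^sup>2 / real_of_int (q\<^sup>2) \<le> real (card (A Y)) / Y"
      using eventually_gt_at_top[of 0]
    proof eventually_elim
      case (elim Y)
      have "pi * (sqrt Y - 2 * q)\<^sup>2 / q\<^sup>2 \<le> card (A Y)"
        using lo[of Y] elim q by (simp add: divide_le_eq mult.commute)
      then have "pi * (sqrt Y + - (2 * q))\<^sup>2 / q\<^sup>2 / Y \<le> card (A Y) / Y"
        using elim by (intro divide_right_mono) auto
      then show ?case using sq[of Y "- (2 * q)"] elim by simp
    qed
    show "\<forall>\<^sub>F Y in at_top. real (card (A Y)) / Y \<le> pi * (1 + real_of_int (2 * q) / sqrt Y)\<^sup>2 / real_of_int (q\<^sup>2)"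
      using eventually_gt_at_top[of 0]
    proof eventually_elim
      case (elim Y)
      have "card (A Y) \<le> pi * (sqrt Y + 2 * q)\<^sup>2 / q\<^sup>2"
        using up[of Y] elim q by (simp add: le_divide_eq mult.commute)
      then have "card (A Y) / Y \<le> pi * (sqrt Y + 2 * q)\<^sup>2 / q\<^sup>2 / Y"
        using elim by (intro divide_right_mono) auto
      then show ?case using sq[of Y "2 * q"] elim by simp
    qed
  qed
  then show ?thesis by (simp add: A_def)
qed


section \<open>Sorting lattice vectors by their gcd\<close>

definition scal :: "int \<Rightarrow> int \<times> int \<Rightarrow> int \<times> int" where
  "scal a u = (a * fst u, a * snd u)"

definition vgcd :: "int \<times> int \<Rightarrow> int" where
  "vgcd u = gcd (fst u) (snd u)"

lemma nsq_scal: "nsq (scal a u) = a\<^sup>2 * nsq u"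
  by (simp add: dotp_def scal_def power2_eq_square algebra_simps)

lemma vgcd_scal: "vgcd (scal a u) = \<bar>a\<bar> * vgcd u"
  by (simp add: vgcd_def scal_def gcd_mult_left abs_mult)

lemma prim_vgcd: "prim u \<longleftrightarrow> vgcd u = 1"
  by (simp add: prim_def vgcd_def coprime_iff_gcd_eq_1)

lemma vgcd_pos: "u \<noteq> (0, 0) \<Longrightarrow> vgcd u > 0"
  unfolding vgcd_def by (metis gcd_eq_0_iff gcd_ge_0_int order_le_less prod.collapse)

lemma vgcd_split:
  assumes "u \<noteq> (0, 0)" obtains v where "prim v" "u = scal (vgcd u) v"
proof
  let ?v = "(fst u div vgcd u, snd u div vgcd u)"
  show "u = scal (vgcd u) ?v"
    by (cases u) (simp add: scal_def vgcd_def)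
  show "prim ?v"
    using assms unfolding prim_def vgcd_def by (cases u) (auto intro!: div_gcd_coprime)
qed

lemma vgcd_le_nsq: "u \<noteq> (0, 0) \<Longrightarrow> vgcd u \<le> nsq u"
proof -
  assume a: "u \<noteq> (0, 0)"
  obtain v where v: "prim v" "u = scal (vgcd u) v" using vgcd_split[OF a] .
  have "vgcd u \<ge> 1" using vgcd_pos[OF a] by simp
  moreover have "nsq u = (vgcd u)\<^sup>2 * nsq v" by (metis v(2) nsq_scal)
  moreover have "nsq v \<ge> 1" using v(1) by (intro nsq_pos prim_nz)
  moreover have "vgcd u * 1 \<le> (vgcd u)\<^sup>2 * nsq v"
    using calculation(1,3) unfolding power2_eq_square mult.assoc
    by (intro mult_left_mono) (auto intro: order_trans mult_mono[of 1 _ 1, simplified])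
  ultimately show ?thesis by simp
qed

lemma scal_inj: "a \<noteq> 0 \<Longrightarrow> inj_on (scal a) A"
  by (auto simp: inj_on_def scal_def)

lemma inverse_squares_le: "D \<ge> 1 \<Longrightarrow> (\<Sum>d=D+1..E. 1 / (real d)\<^sup>2) \<le> 1 / real D"
proof -
  assume D: "D \<ge> 1"
  \<comment> \<open>The subtracted \<open>1 / E\<close> strengthens the claim for the induction:
    \<open>1 / (E + 1)^2 <= 1 / E - 1 / (E + 1)\<close>.\<close>
  have "(\<Sum>d=D+1..E. 1 / (real d)\<^sup>2) \<le> 1 / real D - (if E \<ge> D then 1 / real E else 0)"
  proof (induction E)
    case (Suc E)
    show ?case
    proof (cases "Suc E \<le> D")
      case True
      then show ?thesis using D by auto
    next
      case False
      then have "(\<Sum>d=D+1..Suc E. 1 / (real d)\<^sup>2) = (\<Sum>d=D+1..E. 1 / (real d)\<^sup>2) + 1 / (real (Suc E))\<^sup>2" by simp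
      moreover have "1 / (real (Suc E))\<^sup>2 \<le> 1 / (real E * real (Suc E))"
        using False D by (intro divide_left_mono) (auto simp: power2_eq_square intro: mult_right_mono)
      moreover have "1 / (real E * real (Suc E)) = 1 / real E - 1 / real (Suc E)"
        using False D by (simp add: field_simps)
      ultimately show ?thesis using Suc False by auto
    qed
  qed (use D in auto)
  also have "\<dots> \<le> 1 / real D" by auto
  finally show ?thesis .
qed

text \<open>A vector of gcd d is d times a vector with norm square below \<open>Y / d^2\<close>. The
  estimate is uniform in Y, so gcds above D can be discarded at relative cost \<open>9 / D\<close>
  before Y tends to infinity.\<close>

lemma card_big_vgcd_le:
  assumes "D \<ge> 1" "Y > 0"
  shows "real (card {u. u \<noteq> (0, 0) \<and> vgcd u > int D \<and> rsq u < Y}) \<le> 9 * Y / real D"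
proof -
  define S where "S Z = {u. u \<noteq> (0, 0) \<and> rsq u < Z}" for Z :: real
  have finS: "finite (S Z)" for Z
    by (rule finite_subset[OF _ finite_nsq_less[of Z]]) (auto simp: S_def)
  \<comment> \<open>The gcd of a nonzero vector is at most its norm square, so only d up to Y
    occur.\<close>
  define E where "E = nat \<lceil>Y\<rceil>"
  have "{u. u \<noteq> (0, 0) \<and> vgcd u > int D \<and> rsq u < Y} \<subseteq> (\<Union>d\<in>{D+1..E}. scal (int d) ` S (Y / (real d)\<^sup>2))"
  proof
    fix u assume "u \<in> {u. u \<noteq> (0, 0) \<and> vgcd u > int D \<and> rsq u < Y}"
    then have u: "u \<noteq> (0, 0)" "vgcd u > int D" "rsq u < Y" by auto
    obtain v where v: "prim v" "u = scal (vgcd u) v" using vgcd_split[OF u(1)] .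
    define d where "d = nat (vgcd u)"
    have d: "vgcd u = int d" using u by (simp add: d_def)
    have "real d \<le> Y" using vgcd_le_nsq[OF u(1)] u(3) d by linarith
    then have "d \<in> {D+1..E}" using u(2) d unfolding E_def by simp linarith
    moreover have "nsq u = (int d)\<^sup>2 * nsq v" using v d by (metis nsq_scal)
    then have "(real d)\<^sup>2 * rsq v < Y" using u(3) by simp
    then have "v \<in> S (Y / (real d)\<^sup>2)" using prim_nz[OF v(1)] u(2) d
      by (simp add: S_def pos_less_divide_eq mult.commute)
    ultimately show "u \<in> (\<Union>d\<in>{D+1..E}. scal (int d) ` S (Y / (real d)\<^sup>2))" using v d by auto
  qed
  then have "card {u. u \<noteq> (0, 0) \<and> vgcd u > int D \<and> rsq u < Y} \<le> card (\<Union>d\<in>{D+1..E}. scal (int d) ` S (Y / (real d)\<^sup>2))"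
    by (intro card_mono) (auto simp: finS)
  also have "\<dots> \<le> (\<Sum>d=D+1..E. card (scal (int d) ` S (Y / (real d)\<^sup>2)))"
    by (intro card_UN_le) auto
  also have "\<dots> \<le> (\<Sum>d=D+1..E. card (S (Y / (real d)\<^sup>2)))"
    by (intro sum_mono card_image_le finS)
  finally have "real (card {u. u \<noteq> (0, 0) \<and> vgcd u > int D \<and> rsq u < Y}) \<le> (\<Sum>d=D+1..E. real (card (S (Y / (real d)\<^sup>2))))"
    unfolding of_nat_sum[symmetric] of_nat_le_iff .
  also have "\<dots> \<le> (\<Sum>d=D+1..E. 9 * Y * (1 / (real d)\<^sup>2))"
  proof (intro sum_mono)
    fix d assume "d \<in> {D+1..E}"
    then have "Y / (real d)\<^sup>2 > 0" using assms by simp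
    from card_nsq_less_le[OF this] show "real (card (S (Y / (real d)\<^sup>2))) \<le> 9 * Y * (1 / (real d)\<^sup>2)"
      by (simp add: S_def)
  qed
  also have "\<dots> = 9 * Y * (\<Sum>d=D+1..E. 1 / (real d)\<^sup>2)" by (simp add: sum_distrib_left)
  also have "\<dots> \<le> 9 * Y * (1 / real D)"
    using assms by (intro mult_left_mono inverse_squares_le) auto
  finally show ?thesis by simp
qed

section \<open>Contraction to the density of primitive vectors\<close>

locale level = fixes q :: int assumes q_pos: "q > 0"
begin

text \<open>These are exactly the classes modulo q that contain primitive vectors: such a vector has
  gcd 1, and conversely \<open>prim_count\<close> gives a positive density.\<close>

definition unit_class :: "int \<times> int \<Rightarrow> bool" where
  "unit_class c \<longleftrightarrow> coprime (vgcd c) q"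

definition primset :: "int \<times> int \<Rightarrow> real \<Rightarrow> (int \<times> int) set" where
  "primset c Y = {u. prim u \<and> vcong q u c \<and> rsq u < Y}"

abbreviation latset :: "int \<times> int \<Rightarrow> real \<Rightarrow> (int \<times> int) set" where
  "latset c Y \<equiv> {u. u \<noteq> (0,0) \<and> vcong q u c \<and> rsq u < Y}"

text \<open>Lattice points of gcd d are \<open>1 / d^2\<close> times as frequent as primitive ones,
  and none occur unless d is coprime to q. The value d = 1 is left out because it is the term to be
  solved for.\<close>

definition wt :: "nat \<Rightarrow> real" where
  "wt d = (if 2 \<le> d \<and> coprime (int d) q then 1 / (real d)\<^sup>2 else 0)"

definition sig :: real where "sig = (\<Sum>d. wt d)"

text \<open>\<open>1 + sig\<close> is the sum of \<open>1 / d^2\<close> over all d coprime to q,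
  that is, zeta(2) times the product of \<open>1 - 1 / l^2\<close> over the primes l dividing
  q.\<close>

definition kap :: real where "kap = pi / (real_of_int q)\<^sup>2 / (1 + sig)"

lemma finite_primset: "finite (primset c Y)"
  by (rule finite_subset[OF _ finite_nsq_less[of Y]]) (auto simp: primset_def)

lemma wt_nonneg: "wt d \<ge> 0" by (simp add: wt_def)

text \<open>Any bound below 1 makes the error contract. Splitting off d = 2 gives
  \<open>1/4 + 1/2\<close>.\<close>

lemma sum_wt_le: "(\<Sum>d<n. wt d) \<le> 3/4"
proof -
  have "(\<Sum>d<n. wt d) \<le> (\<Sum>d\<in>{..<n} \<inter> {2..}. 1 / (real d)\<^sup>2)"
    by (intro order.trans[OF sum.mono_neutral_right[THEN eq_refl] sum_mono]) (auto simp: wt_def)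
  also have "\<dots> \<le> (\<Sum>d\<in>insert 2 {2+1..n}. 1 / (real d)\<^sup>2)"
    by (intro sum_mono2) auto
  also have "\<dots> = 1/4 + (\<Sum>d=2+1..n. 1 / (real d)\<^sup>2)" by simp
  also have "\<dots> \<le> 1/4 + 1/2" using inverse_squares_le[of 2 n] by simp
  finally show ?thesis by simp
qed

lemma summable_wt: "summable wt"
  by (rule summableI_nonneg_bounded[OF wt_nonneg sum_wt_le])

lemma wt_lim: "(\<lambda>D. \<Sum>d=2..D. wt d) \<longlonglongrightarrow> sig"
proof -
  have "(\<lambda>D. \<Sum>d<Suc D. wt d) \<longlonglongrightarrow> sig"
    unfolding sig_def using summable_LIMSEQ[OF summable_wt] by (rule LIMSEQ_Suc)
  moreover have "(\<Sum>d<Suc D. wt d) = (\<Sum>d=2..D. wt d)" for D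
    by (rule sum.mono_neutral_right) (auto simp: wt_def)
  ultimately show ?thesis by simp
qed

lemma sig_bounds: "0 \<le> sig" "sig < 1"
proof -
  show "0 \<le> sig" unfolding sig_def by (intro suminf_nonneg summable_wt wt_nonneg)
  have "sig \<le> 3/4" unfolding sig_def using sum_wt_le by (intro suminf_le_const summable_wt)
  then show "sig < 1" by simp
qed

lemma kap_pos: "kap > 0"
  using sig_bounds q_pos by (simp add: kap_def)

lemma kap_eq: "pi / (real_of_int q)\<^sup>2 = kap * (1 + sig)"
  using sig_bounds by (simp add: kap_def)

lemma unit_class_vcong: "vcong q c c' \<Longrightarrow> unit_class c \<Longrightarrow> unit_class c'"
  unfolding unit_class_def
proof (rule coprimeI)
  fix d assume a: "vcong q c c'" "coprime (vgcd c) q" "d dvd vgcd c'" "d dvd q"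
  have "d dvd fst c'" "d dvd snd c'" using a(3) by (auto simp: vgcd_def)
  moreover have "d dvd fst c - fst c'" "d dvd snd c - snd c'"
    using a(1,4) dvd_trans unfolding vcong_def by blast+
  ultimately have "d dvd fst c" "d dvd snd c" by (metis dvd_add diff_add_cancel)+
  then have "d dvd vgcd c" by (simp add: vgcd_def)
  then show "is_unit d" using a coprime_common_divisor by blast
qed

text \<open>With e inverse to d modulo q, \<open>d v\<close> lies in the class c exactly if v lies
  in the class \<open>e c\<close>. If d shares a factor with q, no vector of a unit class has gcd
  d.\<close>

lemma card_fixed_vgcd:
  assumes c: "unit_class c" and d: "d \<ge> 1"
  obtains c' where "unit_class c'" "\<And>Y. card {u. u \<noteq> (0,0) \<and> vcong q u c \<and> rsq u < Y \<and> vgcd u = int d}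
      = (if coprime (int d) q then card (primset c' (1 / (real d)\<^sup>2 * Y)) else 0)"
proof (cases "coprime (int d) q")
  case False
  have "{u. u \<noteq> (0,0) \<and> vcong q u c \<and> rsq u < Y \<and> vgcd u = int d} = {}" for Y
  proof -
    have False if "vcong q u c" "vgcd u = int d" for u
      using unit_class_vcong[OF vcong_sym[OF that(1)] c] that(2) False by (simp add: unit_class_def)
    then show ?thesis by blast
  qed
  then show ?thesis using False c by (intro that[of c]) (simp_all only: card.empty if_False)
next
  case True
  obtain e f where ef: "e * int d + f * q = 1" using True bezout_int[of "int d" q] by auto
  have "coprime e q"
  proof (rule coprimeI)
    fix r assume "r dvd e" "r dvd q"
    then have "r dvd e * int d + f * q" by simp
    then show "is_unit r" using ef by simp
  qed
  have key: "vcong q (scal (int d) v) c \<longleftrightarrow> vcong q v (scal e c)" for v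
  proof -
    have 1: "q dvd int d * a - b \<longleftrightarrow> q dvd a - e * b" for a b
    proof
      assume "q dvd int d * a - b"
      then have "q dvd e * (int d * a - b) + f * a * q" by simp
      also have "e * (int d * a - b) + f * a * q = (e * int d + f * q) * a - e * b" by (simp add: algebra_simps)
      finally show "q dvd a - e * b" by (simp add: ef)
    next
      assume "q dvd a - e * b"
      then have "q dvd int d * (a - e * b) - f * b * q" by simp
      also have "int d * (a - e * b) - f * b * q = int d * a - (e * int d + f * q) * b" by (simp add: algebra_simps)
      finally show "q dvd int d * a - b" by (simp add: ef)
    qed
    show ?thesis by (simp add: vcong_def scal_def 1)
  qed
  have uc: "unit_class (scal e c)"
    using c \<open>coprime e q\<close> by (simp add: unit_class_def vgcd_scal)
  have "card {u. u \<noteq> (0,0) \<and> vcong q u c \<and> rsq u < Y \<and> vgcd u = int d}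
      = card (primset (scal e c) (1 / (real d)\<^sup>2 * Y))" for Y
  proof -
    have "{u. u \<noteq> (0,0) \<and> vcong q u c \<and> rsq u < Y \<and> vgcd u = int d}
      = scal (int d) ` primset (scal e c) (1 / (real d)\<^sup>2 * Y)" (is "?L = ?R")
    proof (intro set_eqI iffI)
      fix u assume "u \<in> ?L"
      then have u: "u \<noteq> (0,0)" "vcong q u c" "rsq u < Y" "vgcd u = int d" by auto
      obtain v where v: "prim v" "u = scal (vgcd u) v" using vgcd_split[OF u(1)] .
      then have u': "u = scal (int d) v" using u by simp
      have "(real d)\<^sup>2 * rsq v < Y" using u(3) unfolding u' by (simp add: nsq_scal)
      then have "v \<in> primset (scal e c) (1 / (real d)\<^sup>2 * Y)"
        using v(1) u(2) key d unfolding u' by (simp add: primset_def pos_less_divide_eq mult.commute)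
      then show "u \<in> ?R" using u' by blast
    next
      fix u assume "u \<in> ?R"
      then obtain v where v: "v \<in> primset (scal e c) (1 / (real d)\<^sup>2 * Y)" "u = scal (int d) v" by blast
      then have "prim v" by (simp add: primset_def)
      moreover have "u \<noteq> (0,0)" using prim_nz[OF \<open>prim v\<close>] v d by (cases v) (auto simp: scal_def)
      ultimately show "u \<in> ?L"
        using v d by (auto simp: primset_def key nsq_scal vgcd_scal prim_vgcd pos_less_divide_eq mult.commute)
    qed
    then show ?thesis using d by (simp add: card_image scal_inj)
  qed
  then show ?thesis using True uc by (intro that[of "scal e c"]) simp_all
qed

text \<open>The remainder consists of the vectors with gcd above D. The class \<open>C d\<close>
  varies with d, so the counts for all unit classes have to be estimated simultaneously.\<close>

lemma prim_count_decomp: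
  assumes c: "unit_class c"
  shows "\<exists>C. (\<forall>d. unit_class (C d)) \<and> (\<forall>D Y. D \<ge> 1 \<longrightarrow> Y > 0 \<longrightarrow>
       real (card (latset c Y))
        - (\<Sum>d=2..D. if coprime (int d) q then real (card (primset (C d) (1 / (real d)\<^sup>2 * Y))) else 0)
        - real (card (primset c Y)) \<in> {0..9 * Y / D})"
proof -
  let ?B = "\<lambda>d Y. {u. u \<noteq> (0,0) \<and> vcong q u c \<and> rsq u < Y \<and> vgcd u = int d}"
  have "\<forall>d. \<exists>c'. d \<ge> 1 \<longrightarrow> unit_class c' \<and> (\<forall>Y. card (?B d Y) = (if coprime (int d) q then card (primset c' (1 / (real d)\<^sup>2 * Y)) else 0))"
  proof
    fix d :: nat
    show "\<exists>c'. d \<ge> 1 \<longrightarrow> unit_class c' \<and> (\<forall>Y. card (?B d Y) = (if coprime (int d) q then card (primset c' (1 / (real d)\<^sup>2 * Y)) else 0))"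
    proof (cases "d \<ge> 1")
      case True
      show ?thesis by (rule card_fixed_vgcd[OF c True]) blast
    qed simp
  qed
  from choice[OF this]
  obtain C0 where C0: "\<And>d. d \<ge> 1 \<Longrightarrow> unit_class (C0 d)"
    "\<And>d Y. d \<ge> 1 \<Longrightarrow> card (?B d Y) = (if coprime (int d) q then card (primset (C0 d) (1 / (real d)\<^sup>2 * Y)) else 0)"
    by blast
  \<comment> \<open>Index 0 is filled with c so that every \<open>C d\<close> is a unit
    class.\<close>
  define C where "C d = (if d \<ge> 1 then C0 d else c)" for d
  show ?thesis
  proof (intro exI[of _ C] conjI allI impI)
    show "unit_class (C d)" for d using C0 c by (simp add: C_def)
    fix D :: nat and Y :: real assume D: "D \<ge> 1" "Y > 0"
    let ?A = "latset c Y"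
    let ?T = "{u \<in> ?A. vgcd u > int D}"
    have finA: "finite ?A" by (rule finite_subset[OF _ finite_nsq_less[of Y]]) auto
    have "?A = (\<Union>d\<in>{1..D}. ?B d Y) \<union> ?T"
    proof (intro set_eqI iffI)
      fix u assume u: "u \<in> ?A"
      then have p: "vgcd u > 0" by (simp add: vgcd_pos)
      show "u \<in> (\<Union>d\<in>{1..D}. ?B d Y) \<union> ?T"
      proof (cases "int D < vgcd u")
        case False
        then have "nat (vgcd u) \<in> {1..D}" "vgcd u = int (nat (vgcd u))" using p by auto
        then show ?thesis using u by (intro UnI1 UN_I[of "nat (vgcd u)"]) auto
      qed (use u in auto)
    qed auto
    then have "card ?A = card ((\<Union>d\<in>{1..D}. ?B d Y) \<union> ?T)" by (rule arg_cong)
    also have "\<dots> = card (\<Union>d\<in>{1..D}. ?B d Y) + card ?T"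
      using finA by (intro card_Un_disjoint) (auto intro: finite_subset[OF _ finA])
    also have "card (\<Union>d\<in>{1..D}. ?B d Y) = (\<Sum>d=1..D. card (?B d Y))"
      by (intro card_UN_disjoint) (auto intro: finite_subset[OF _ finA])
    also have "\<dots> = card (?B 1 Y) + (\<Sum>d=2..D. card (?B d Y))"
      using D by (simp add: sum.atLeast_Suc_atMost numeral_2_eq_2)
    also have "?B 1 Y = primset c Y"
      by (auto simp: primset_def prim_vgcd vgcd_def)
    also have "(\<Sum>d=2..D. card (?B d Y)) = (\<Sum>d=2..D. if coprime (int d) q then card (primset (C d) (1 / (real d)\<^sup>2 * Y)) else 0)"
      by (intro sum.cong refl) (simp add: C0(2) C_def)
    finally have "real (card ?A) = real (card (primset c Y)) + (\<Sum>d=2..D. if coprime (int d) q then real (card (primset (C d) (1 / (real d)\<^sup>2 * Y))) else 0) + real (card ?T)"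
      by (simp add: if_distrib[of real] cong: if_cong)
    moreover have "card ?T \<le> card {u. u \<noteq> (0, 0) \<and> vgcd u > int D \<and> rsq u < Y}"
      by (intro card_mono finite_subset[OF _ finite_nsq_less[of Y]]) auto
    then have "real (card ?T) \<le> 9 * Y / D"
      using card_big_vgcd_le[OF D] by (meson of_nat_le_iff order_trans)
    ultimately show "real (card ?A)
        - (\<Sum>d=2..D. if coprime (int d) q then real (card (primset (C d) (1 / (real d)\<^sup>2 * Y))) else 0)
        - real (card (primset c Y)) \<in> {0..9 * Y / D}" by simp
  qed
qed

lemma lattice_count_nz:
  "((\<lambda>Y. real (card (latset c Y)) / Y) \<longlongrightarrow> kap * (1 + sig)) at_top"
proof -
  let ?A = "\<lambda>Y. latset c Y"
  let ?B = "\<lambda>Y. {u. vcong q u c \<and> rsq u < Y}"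
  have finB: "finite (?B Y)" for Y by (rule finite_subset[OF _ finite_nsq_less[of Y]]) auto
  have b: "card (?B Y) \<le> card (?A Y) + 1" "card (?A Y) \<le> card (?B Y)" for Y
  proof -
    have "?A Y = ?B Y - {(0,0)}" by auto
    then show "card (?B Y) \<le> card (?A Y) + 1" "card (?A Y) \<le> card (?B Y)"
      using finB[of Y] card_Diff1_le[of "?B Y"] by (auto simp: card_Diff_singleton_if)
  qed
  have l1: "((\<lambda>Y. real (card (?B Y)) / Y) \<longlongrightarrow> kap * (1 + sig)) at_top"
    using lattice_count[OF q_pos, of c] unfolding kap_eq .
  have "((\<lambda>Y. real (card (?B Y)) / Y - 1 / Y) \<longlongrightarrow> kap * (1 + sig) - 0) at_top"
    by (intro tendsto_diff l1 real_tendsto_divide_at_top[OF tendsto_const] filterlim_ident)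
  then have l2: "((\<lambda>Y. real (card (?B Y)) / Y - 1 / Y) \<longlongrightarrow> kap * (1 + sig)) at_top" by simp
  show ?thesis
  proof (rule tendsto_sandwich[OF _ _ l2 l1])
    show "\<forall>\<^sub>F Y in at_top. real (card (?B Y)) / Y - 1 / Y \<le> real (card (?A Y)) / Y"
      using eventually_gt_at_top[of 0]
    proof eventually_elim
      case (elim Y)
      have "real (card (?B Y)) - 1 \<le> real (card (?A Y))" using b(1)[of Y] by linarith
      then show ?case using elim by (simp add: divide_right_mono flip: diff_divide_distrib)
    qed
    show "\<forall>\<^sub>F Y in at_top. real (card (?A Y)) / Y \<le> real (card (?B Y)) / Y"
      using eventually_gt_at_top[of 0] by eventually_elim (use b(2) in \<open>simp add: divide_right_mono\<close>)
  qed
qed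

text \<open>
  Sorting all lattice points by their gcd expresses the count of primitive points through counts
  at smaller radii with total weight \<open>sig < 1\<close>, which makes the error contract.
\<close>

lemma prim_count_contract:
  assumes IH: "\<And>c. unit_class c \<Longrightarrow> lbd (\<lambda>Y. real (card (primset c Y))) (kap - e)"
    "\<And>c. unit_class c \<Longrightarrow> lbd (\<lambda>Y. - real (card (primset c Y))) (- (kap + e))"
    and c: "unit_class c"
  shows "lbd (\<lambda>Y. real (card (primset c Y))) (kap - sig * e)"
    "lbd (\<lambda>Y. - real (card (primset c Y))) (- (kap + sig * e))"
proof -
  obtain C where C: "\<And>d. unit_class (C d)"
    "\<And>D Y. D \<ge> 1 \<Longrightarrow> Y > 0 \<Longrightarrow>
       real (card (latset c Y))
        - (\<Sum>d=2..D. if coprime (int d) q then real (card (primset (C d) (1 / (real d)\<^sup>2 * Y))) else 0)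
        - real (card (primset c Y)) \<in> {0..9 * Y / D}"
    using prim_count_decomp[OF c] by blast
  let ?A = "\<lambda>Y. real (card (latset c Y))"
  let ?S = "\<lambda>D Y. (\<Sum>d=2..D. if coprime (int d) q then real (card (primset (C d) (1 / (real d)\<^sup>2 * Y))) else 0)"
  have lo: "lbd (?S D) (\<Sum>d=2..D. wt d * (kap - e))" for D
  proof (intro lbd_sum)
    fix d assume d: "d \<in> {2..D}"
    show "lbd (\<lambda>Y. if coprime (int d) q then real (card (primset (C d) (1 / (real d)\<^sup>2 * Y))) else 0) (wt d * (kap - e))"
      using lbd_cmult[OF IH(1)[OF C(1)[of d]], of "1 / (real d)\<^sup>2"] d by (auto simp: wt_def lbd_zero)
  qed auto
  have up: "lbd (\<lambda>Y. - ?S D Y) (\<Sum>d=2..D. wt d * - (kap + e))" for D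
    unfolding sum_negf[symmetric]
  proof (intro lbd_sum)
    fix d assume d: "d \<in> {2..D}"
    show "lbd (\<lambda>Y. - (if coprime (int d) q then real (card (primset (C d) (1 / (real d)\<^sup>2 * Y))) else 0)) (wt d * - (kap + e))"
      using lbd_cmult[OF IH(2)[OF C(1)[of d]], of "1 / (real d)\<^sup>2"] d by (auto simp: wt_def lbd_zero)
  qed auto
  \<comment> \<open>The remainder of large gcds is nonnegative and may be dropped, since primitive
    points are bounded from above here. \<open>max 1 D\<close> lets D start at 0.\<close>
  have "lbd (\<lambda>Y. - real (card (primset c Y))) (- (kap * (1 + sig)) + (\<Sum>d=2..D. wt d) * (kap - e))" for D
  proof (rule lbd_mono)
    show "lbd (\<lambda>Y. - ?A Y + ?S (max 1 D) Y) (- (kap * (1 + sig)) + (\<Sum>d=2..max 1 D. wt d * (kap - e)))"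
      by (intro lbd_add lo tendsto_lbd_uminus lattice_count_nz)
    show "- (kap * (1 + sig)) + (\<Sum>d=2..D. wt d) * (kap - e) \<le> - (kap * (1 + sig)) + (\<Sum>d=2..max 1 D. wt d * (kap - e))"
      by (cases "D = 0") (simp_all add: sum_distrib_right max_def)
    show "\<forall>\<^sub>F Y in at_top. - ?A Y + ?S (max 1 D) Y \<le> - real (card (primset c Y))"
      using eventually_gt_at_top[of 0] by eventually_elim (use C(2)[of "max 1 D"] in force)
  qed
  moreover have "(\<lambda>D. - (kap * (1 + sig)) + (\<Sum>d=2..D. wt d) * (kap - e))
      \<longlonglongrightarrow> - (kap * (1 + sig)) + sig * (kap - e)"
    by (intro tendsto_intros wt_lim)
  ultimately have "lbd (\<lambda>Y. - real (card (primset c Y))) (- (kap * (1 + sig)) + sig * (kap - e))"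
    by (rule lbd_limit)
  then show "lbd (\<lambda>Y. - real (card (primset c Y))) (- (kap + sig * e))"
    by (simp add: algebra_simps)
  \<comment> \<open>In this direction the remainder costs \<open>9 / Suc D\<close>, which disappears
    as D grows.\<close>
  have "lbd (\<lambda>Y. real (card (primset c Y))) ((kap * (1 + sig)) - (\<Sum>d=2..Suc D. wt d) * (kap + e) - 9 / Suc D)" for D
  proof (rule lbd_mono)
    show "lbd (\<lambda>Y. ?A Y + - ?S (Suc D) Y + (- 9 / Suc D * Y)) ((kap * (1 + sig)) + (\<Sum>d=2..Suc D. wt d * - (kap + e)) + (- 9 / Suc D))"
      by (intro lbd_add up lbd_tendsto lattice_count_nz)
        (auto intro!: tendsto_eventually eventually_mono[OF eventually_gt_at_top[of 0]])
    show "kap * (1 + sig) - (\<Sum>d=2..Suc D. wt d) * (kap + e) - 9 / Suc D \<le> (kap * (1 + sig)) + (\<Sum>d=2..Suc D. wt d * - (kap + e)) + (- 9 / Suc D)"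
      by (subst sum_distrib_right[symmetric])
        (simp only: mult_minus_right diff_conv_add_uminus minus_divide_left order_refl)
    show "\<forall>\<^sub>F Y in at_top. ?A Y + - ?S (Suc D) Y + (- 9 / Suc D * Y) \<le> real (card (primset c Y))"
      using eventually_gt_at_top[of 0]
    proof eventually_elim
      case (elim Y)
      have "?A Y - ?S (Suc D) Y - real (card (primset c Y)) \<le> 9 * Y / Suc D"
        using C(2)[of "Suc D" Y] elim by simp
      moreover have "- 9 / real (Suc D) * Y = - (9 * Y / Suc D)" by simp
      ultimately show ?case by linarith
    qed
  qed
  moreover have "(\<lambda>D. kap * (1 + sig) - (\<Sum>d=2..Suc D. wt d) * (kap + e) - 9 / Suc D)
      \<longlonglongrightarrow> kap * (1 + sig) - sig * (kap + e) - 0"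
    using LIMSEQ_Suc[OF wt_lim] LIMSEQ_Suc[OF lim_const_over_n, of 9] by (intro tendsto_intros)
  ultimately have "lbd (\<lambda>Y. real (card (primset c Y))) (kap * (1 + sig) - sig * (kap + e) - 0)"
    by (rule lbd_limit)
  then show "lbd (\<lambda>Y. real (card (primset c Y))) (kap - sig * e)"
    by (simp add: algebra_simps)
qed

text \<open>The error starts at kap, because the count is nonnegative and all lattice points
  together have density \<open>kap * (1 + sig) <= 2 * kap\<close>. Each contraction multiplies it by
  sig. The induction runs over all classes together.\<close>

lemma prim_count_iter:
  "unit_class c \<Longrightarrow> lbd (\<lambda>Y. real (card (primset c Y))) (kap - sig ^ n * kap) \<and>
    lbd (\<lambda>Y. - real (card (primset c Y))) (- (kap + sig ^ n * kap))"
proof (induction n arbitrary: c)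
  case 0
  have "lbd (\<lambda>Y. - real (card (latset c Y))) (- (kap * (1 + sig)))"
    by (intro tendsto_lbd_uminus lattice_count_nz)
  then have "lbd (\<lambda>Y. - real (card (primset c Y))) (- (kap + kap))"
  proof (rule lbd_mono)
    show "- (kap + kap) \<le> - (kap * (1 + sig))"
      using mult_left_mono[of sig 1 kap] sig_bounds kap_pos by (simp add: algebra_simps)
    have "card (primset c Y) \<le> card (latset c Y)" for Y
      by (intro card_mono finite_subset[OF _ finite_nsq_less[of Y]]) (auto simp: primset_def prim_def)
    then show "\<forall>\<^sub>F Y in at_top. - real (card (latset c Y)) \<le> - real (card (primset c Y))"
      by simp
  qed
  then show ?case by (auto intro: lbd_nonneg)
next
  case (Suc n)
  then show ?case using prim_count_contract[of "sig ^ n * kap" c] by (simp add: mult.assoc)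
qed

theorem prim_count:
  assumes "unit_class c"
  shows "((\<lambda>Y. real (card (primset c Y)) / Y) \<longlongrightarrow> kap) at_top"
proof (rule lbd_imp_tendsto)
  have s: "(\<lambda>n. sig ^ n * kap) \<longlonglongrightarrow> 0"
    using sig_bounds by (intro tendsto_mult_left_zero LIMSEQ_power_zero) auto
  have "(\<lambda>n. kap - sig ^ n * kap) \<longlonglongrightarrow> kap - 0" "(\<lambda>n. - (kap + sig ^ n * kap)) \<longlonglongrightarrow> - (kap + 0)"
    by (intro tendsto_intros s)+
  then have s: "(\<lambda>n. kap - sig ^ n * kap) \<longlonglongrightarrow> kap" "(\<lambda>n. - (kap + sig ^ n * kap)) \<longlonglongrightarrow> - kap"
    by simp_all
  show "lbd (\<lambda>Y. real (card (primset c Y))) kap" "lbd (\<lambda>Y. - real (card (primset c Y))) (- kap)"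
    using prim_count_iter[OF assms] by (auto intro: lbd_limit[OF _ s(1)] lbd_limit[OF _ s(2)])
qed

end


section \<open>Unimodular bases over a Farey interval\<close>

context level begin

lemma unimodular_class:
  assumes "q dvd crs c d - 1" shows "unit_class c"
  unfolding unit_class_def
proof (rule coprimeI)
  fix r assume r: "r dvd vgcd c" "r dvd q"
  then have "r dvd fst c" "r dvd snd c" by (auto simp: vgcd_def)
  then have "r dvd crs c d" by (simp add: crs_def)
  moreover have "r dvd crs c d - 1" using r(2) assms dvd_trans by blast
  ultimately show "is_unit r" by (metis dvd_diff diff_diff_eq2 add_diff_cancel_left')
qed

lemma crs_comb_dvd:
  assumes "vcong q u c" shows "q dvd crs u d - crs c d"
proof -
  have "crs u d - crs c d = (fst u - fst c) * snd d - (snd u - snd c) * fst d"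
    by (simp add: crs_def algebra_simps)
  then show ?thesis using assms by (simp add: vcong_def)
qed

text \<open>The completions of u form a line \<open>u0 + x u\<close>. The class of \<open>u'\<close>
  fixes x modulo q, and a step of q in x moves \<open>dotp u u'\<close> by \<open>q * nsq u\<close>;
  hence every window of that length contains a completion in the right class.\<close>

lemma partner_exists:
  assumes u: "prim u" "vcong q u d" and d: "q dvd crs d d' - 1"
  shows "\<exists>u'. crs u u' = 1 \<and> vcong q u' d' \<and> q * L * nsq u \<le> dotp u u' \<and> dotp u u' < q * (L + 1) * nsq u"
proof -
  obtain u0 where u0: "crs u u0 = 1" using prim_bezout[OF u(1)] .
  \<comment> \<open>Cramer's rule in the basis u, u0: \<open>d' = a u + (b + 1) u0\<close>, and b
    vanishes modulo q.\<close>
  define a where "a = crs d' u0"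
  define b where "b = crs u d' - 1"
  have "q dvd b"
  proof -
    have "b = (crs u d' - crs d d') + (crs d d' - 1)" by (simp add: b_def)
    then show ?thesis using crs_comb_dvd[OF u(2), of d'] d by (simp only: dvd_add)
  qed
  define n where "n = nsq u"
  have n: "n > 0" using nsq_pos[OF prim_nz[OF u(1)]] by (simp add: n_def)
  define t where "t = dotp u u0 + a * n"
  \<comment> \<open>Moves the product from the window containing t to window L.\<close>
  define s where "s = L - t div (q * n)"
  define u' where "u' = comb 1 u0 (a + q * s) u"
  have crs': "crs u u' = 1"
    using u0 unfolding u'_def by (simp add: crs_def comb_def algebra_simps)
  have e: "x * (fst u * snd u0 - snd u * fst u0) = x" for x using u0 by (simp add: crs_def)
  have "fst d' = a * fst u + (b + 1) * fst u0" "snd d' = a * snd u + (b + 1) * snd u0"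
    using e[of "fst d'"] e[of "snd d'"] by (simp_all add: a_def b_def crs_def algebra_simps)
  then have "fst u' - fst d' = q * (s * fst u) - b * fst u0" "snd u' - snd d' = q * (s * snd u) - b * snd u0"
    by (simp_all add: u'_def comb_def algebra_simps)
  then have cong': "vcong q u' d'" using \<open>q dvd b\<close> by (simp add: vcong_def)
  have "dotp u u' = t + q * s * n"
    by (simp add: u'_def t_def n_def comb_def dotp_def algebra_simps)
  also have "\<dots> = q * L * n + (t - (q * n) * (t div (q * n)))"
    by (simp add: s_def algebra_simps)
  also have "t - (q * n) * (t div (q * n)) = t mod (q * n)" by (simp add: minus_mult_div_eq_mod)
  finally have dot: "dotp u u' = q * L * n + t mod (q * n)" .
  have "0 \<le> t mod (q * n)" "t mod (q * n) < q * n" using q_pos n by auto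
  then have "q * L * n \<le> dotp u u'" "dotp u u' < q * (L + 1) * n"
    unfolding dot by (simp_all add: algebra_simps)
  then show ?thesis using crs' cong' unfolding n_def by blast
qed

text \<open>\<open>0 <= dotp u u'\<close> is a sufficient condition for \<rho> to lie in the Farey
  interval, so counting \<open>Q\<close> gives lower bounds.\<close>

definition Q :: "int \<Rightarrow> int \<Rightarrow> int \<times> int \<Rightarrow> int \<times> int \<Rightarrow> real \<Rightarrow> ((int \<times> int) \<times> (int \<times> int)) set" where
  "Q n N d d' Y = {(u, u'). crs u u' = 1 \<and> vcong q u d \<and> vcong q u' d' \<and> 0 \<le> dotp u u' \<and> rsq (comb N u n u') < Y}"

lemma nsq_comb: "nsq (comb a u b v) = a\<^sup>2 * nsq u + 2 * a * b * dotp u v + b\<^sup>2 * nsq v"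
  by (simp add: dotp_def comb_def power2_eq_square algebra_simps)

lemma finite_Q:
  assumes "n > 0" "N > 0" shows "finite (Q n N d d' Y)"
proof (rule finite_subset)
  show "Q n N d d' Y \<subseteq> {u. rsq u < Y} \<times> {u. rsq u < Y}"
  proof
    fix z assume "z \<in> Q n N d d' Y"
    then obtain u u' where z: "z = (u, u')" "0 \<le> dotp u u'" "rsq (comb N u n u') < Y"
      by (auto simp: Q_def)
    have "1 * nsq u \<le> N\<^sup>2 * nsq u" "1 * nsq u' \<le> n\<^sup>2 * nsq u'"
      using assms nsq_nonneg by (intro mult_right_mono; simp add: power2_eq_square one_le_mult_iff int_one_le_iff_zero_less)+
    moreover have "0 \<le> 2 * N * n * dotp u u'" using z assms by simp
    ultimately have "nsq u \<le> nsq (comb N u n u')" "nsq u' \<le> nsq (comb N u n u')"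
      unfolding nsq_comb using nsq_nonneg[of u] nsq_nonneg[of u'] by linarith+
    then show "z \<in> {u. rsq u < Y} \<times> {u. rsq u < Y}" using z by auto
  qed
qed (simp add: finite_nsq_less)

text \<open>Multiplying by \<open>h = nsq u\<close> and using Lagrange's identity with determinant 1
  turns the left side into \<open>(N h + n t)^2 + n^2\<close>, where \<open>t = dotp u u'\<close> is
  below \<open>q l h\<close>.\<close>

lemma Q_member:
  assumes pos: "n > 0" "N > 0" "l \<ge> 1" and u: "nsq u \<ge> 1" "crs u u' = 1"
    and dot: "0 \<le> dotp u u'" "dotp u u' < q * l * nsq u"
  shows "nsq (comb N u n u') < (N + n * q * l)\<^sup>2 * nsq u + n\<^sup>2"
proof -
  define h where "h = nsq u"
  define t where "t = dotp u u'"
  have h: "h \<ge> 1" using u by (simp add: h_def)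
  have "nsq (comb N u n u') * h = N\<^sup>2 * h\<^sup>2 + 2 * N * n * t * h + n\<^sup>2 * (h * nsq u')"
    by (simp add: nsq_comb h_def t_def power2_eq_square algebra_simps)
  also have "h * nsq u' = t\<^sup>2 + 1" using lagrange[of u u'] u by (simp add: h_def t_def)
  finally have "nsq (comb N u n u') * h = (N * h + n * t)\<^sup>2 + n\<^sup>2"
    by (simp add: power2_eq_square algebra_simps)
  also have "\<dots> < ((N + n * q * l) * h)\<^sup>2 + n\<^sup>2"
  proof -
    have "n * t < n * (q * l * h)" using dot pos by (simp add: t_def h_def)
    then have "N * h + n * t < (N + n * q * l) * h" by (simp add: algebra_simps)
    moreover have "0 \<le> N * h + n * t" using pos h dot by (simp add: t_def)
    ultimately show ?thesis using power_strict_mono[of "N * h + n * t" "(N + n * q * l) * h" 2] by simp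
  qed
  also have "\<dots> \<le> ((N + n * q * l)\<^sup>2 * h + n\<^sup>2) * h"
    using h mult_left_mono[of 1 h "n\<^sup>2"] by (simp add: power2_eq_square algebra_simps)
  finally show ?thesis using h unfolding h_def[symmetric] by (simp add: mult_less_cancel_right)
qed

text \<open>Each u is paired with its partner in every window l = 1..L for which u is short enough.
  The windows are disjoint, so the pairs are distinct.\<close>

lemma card_Q_ge:
  assumes pos: "n > 0" "N > 0" and d: "q dvd crs d d' - 1"
  shows "(\<Sum>l=1..L. card (primset d ((Y - (real_of_int n)\<^sup>2) / (real_of_int (N + n * q * int l))\<^sup>2))) \<le> card (Q n N d d' Y)"
proof -
  let ?B = "\<lambda>l. primset d ((Y - (real_of_int n)\<^sup>2) / (real_of_int (N + n * q * int l))\<^sup>2)"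
  \<comment> \<open>Here z = (l, u), and \<open>u'\<close> is the partner of u in the l-th window.
    Windows are numbered from 1, hence the shift by 1 against \<open>partner_exists\<close>.\<close>
  have "\<forall>z. \<exists>u'. prim (snd z) \<and> vcong q (snd z) d \<longrightarrow> crs (snd z) u' = 1 \<and> vcong q u' d' \<and>
      q * (int (fst z) - 1) * nsq (snd z) \<le> dotp (snd z) u' \<and> dotp (snd z) u' < q * int (fst z) * nsq (snd z)"
  proof
    fix z :: "nat \<times> int \<times> int"
    show "\<exists>u'. prim (snd z) \<and> vcong q (snd z) d \<longrightarrow> crs (snd z) u' = 1 \<and> vcong q u' d' \<and>
      q * (int (fst z) - 1) * nsq (snd z) \<le> dotp (snd z) u' \<and> dotp (snd z) u' < q * int (fst z) * nsq (snd z)"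
      using partner_exists[OF _ _ d, of "snd z" "int (fst z) - 1"] by (cases "prim (snd z) \<and> vcong q (snd z) d") auto
  qed
  from choice[OF this] obtain f where f: "\<And>z. prim (snd z) \<and> vcong q (snd z) d \<Longrightarrow> crs (snd z) (f z) = 1 \<and> vcong q (f z) d' \<and>
      q * (int (fst z) - 1) * nsq (snd z) \<le> dotp (snd z) (f z) \<and> dotp (snd z) (f z) < q * int (fst z) * nsq (snd z)"
    by blast
  let ?S = "Sigma {1..L} ?B"
  have inj: "inj_on (\<lambda>z. (snd z, f z)) ?S"
  proof (rule inj_onI)
    fix z z' assume z: "z \<in> ?S" "z' \<in> ?S" "(snd z, f z) = (snd z', f z')"
    let ?u = "snd z"
    have p: "prim ?u" "vcong q ?u d" using z(1) by (auto simp: primset_def)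
    have h: "q * nsq ?u > 0" using nsq_pos[OF prim_nz[OF p(1)]] q_pos by simp
    have 1: "q * (int (fst z) - 1) * nsq ?u < q * int (fst z') * nsq ?u"
      "q * (int (fst z') - 1) * nsq ?u < q * int (fst z) * nsq ?u"
      using f[of z] f[of z'] p z(3) by auto
    have "(q * nsq ?u) * (int (fst z) - 1) < (q * nsq ?u) * int (fst z')"
      "(q * nsq ?u) * (int (fst z') - 1) < (q * nsq ?u) * int (fst z)"
      using 1 by (simp_all add: mult_ac)
    then have "int (fst z) - 1 < int (fst z')" "int (fst z') - 1 < int (fst z)"
      using h by (simp_all only: mult_less_cancel_left_pos)
    then show "z = z'" using z(3) by (simp add: prod_eq_iff)
  qed
  have sub: "(\<lambda>z. (snd z, f z)) ` ?S \<subseteq> Q n N d d' Y"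
  proof (rule image_subsetI)
    fix z assume z: "z \<in> ?S"
    define l where "l = fst z"
    have l: "l \<in> {1..L}" "snd z \<in> ?B l" using z by (auto simp: l_def)
    let ?u = "snd z" and ?u' = "f z"
    have p: "prim ?u" "vcong q ?u d" using l by (auto simp: primset_def)
    have ff: "crs ?u ?u' = 1" "vcong q ?u' d'" "q * (int l - 1) * nsq ?u \<le> dotp ?u ?u'" "dotp ?u ?u' < q * int l * nsq ?u"
      using f[of z] p by (auto simp: l_def)
    have h: "nsq ?u \<ge> 1" using p by (intro nsq_pos prim_nz)
    have "0 \<le> q * (int l - 1) * nsq ?u" using q_pos l h by simp
    then have dot: "0 \<le> dotp ?u ?u'" using ff by linarith
    have "nsq (comb N ?u n ?u') < (N + n * q * int l)\<^sup>2 * nsq ?u + n\<^sup>2"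
      using l ff by (intro Q_member pos h dot) auto
    then have "rsq (comb N ?u n ?u') < (real_of_int (N + n * q * int l))\<^sup>2 * rsq ?u + (real_of_int n)\<^sup>2"
      by (metis (no_types, lifting) of_int_add of_int_less_iff of_int_mult of_int_power)
    also have "\<dots> \<le> Y"
    proof -
      have "N + n * q * int l > 0" using pos q_pos by (simp add: add_pos_nonneg)
      then have "(real_of_int (N + n * q * int l))\<^sup>2 > 0" by (simp only: zero_less_power of_int_0_less_iff)
      moreover have "rsq ?u < (Y - (real_of_int n)\<^sup>2) / (real_of_int (N + n * q * int l))\<^sup>2"
        using l by (simp add: primset_def)
      ultimately have "rsq ?u * (real_of_int (N + n * q * int l))\<^sup>2 < Y - (real_of_int n)\<^sup>2"
        by (simp only: pos_less_divide_eq)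
      then show ?thesis by (simp only: mult.commute)
    qed
    finally show "(?u, ?u') \<in> Q n N d d' Y"
      using ff p dot by (simp add: Q_def)
  qed
  have "(\<Sum>l=1..L. card (?B l)) = card ?S"
    by (simp add: finite_primset)
  also have "\<dots> \<le> card (Q n N d d' Y)"
    using card_inj_on_le[OF inj sub finite_Q[OF pos]] .
  finally show ?thesis .
qed

text \<open>Summand by summand, \<open>1 / x^2 >= 1 / (x (x + B))\<close>, which telescopes.\<close>

lemma telescope_ge:
  fixes A B :: real
  assumes "A > 0" "B > 0"
  shows "1 / B * (1 / (A + B) - 1 / (A + B * (real L + 1))) \<le> (\<Sum>l=1..L. 1 / (A + B * real l)\<^sup>2)"
proof (induction L)
  case (Suc L)
  define x where "x = A + B * (real L + 1)"
  have x: "x > 0" using assms by (simp add: x_def add_pos_pos)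
  have "1 / B * (1 / x - 1 / (x + B)) = 1 / (x * (x + B))"
    using x assms by (simp add: field_simps)
  also have "\<dots> \<le> 1 / x\<^sup>2"
    using x assms by (intro divide_left_mono) (auto simp: power2_eq_square)
  finally have "1 / B * (1 / x - 1 / (x + B)) \<le> 1 / x\<^sup>2" .
  then show ?case using Suc by (simp add: x_def algebra_simps)
qed (use assms in simp)

text \<open>For fixed L there are finitely many windows, each contributing
  \<open>kap / (N + n q l)^2\<close> by \<open>prim_count\<close>. L tends to infinity after
  Y.\<close>

lemma lbd_Q:
  fixes n N :: int
  assumes pos: "n > 0" "N > 0" and d: "q dvd crs d d' - 1"
  shows "lbd (\<lambda>Y. real (card (Q n N d d' Y))) (kap / (n * q * (N + n * q)))"
proof -
  define A where "A = real_of_int N"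
  define B where "B = real_of_int (n * q)"
  have AB: "A > 0" "B > 0" using pos q_pos by (simp_all add: A_def B_def)
  have step: "lbd (\<lambda>Y. real (card (Q n N d d' Y))) (kap * (1 / B * (1 / (A + B) - 1 / (A + B * (real L + 1)))))" for L
  proof (rule lbd_mono)
    show "lbd (\<lambda>Y. \<Sum>l=1..L. real (card (primset d (1 / (A + B * real l)\<^sup>2 * (Y - (real_of_int n)\<^sup>2))))) (\<Sum>l=1..L. 1 / (A + B * real l)\<^sup>2 * kap)"
    proof (intro lbd_sum)
      fix l
      have "A + B * real l > 0" using AB by (simp add: add_pos_nonneg)
      then have "0 < 1 / (A + B * real l)\<^sup>2" by simp
      from lbd_shift[OF lbd_cmult[OF lbd_tendsto[OF prim_count[OF unimodular_class[OF d]]] this]]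
      show "lbd (\<lambda>Y. real (card (primset d (1 / (A + B * real l)\<^sup>2 * (Y - (real_of_int n)\<^sup>2))))) (1 / (A + B * real l)\<^sup>2 * kap)" .
    qed simp
    show "kap * (1 / B * (1 / (A + B) - 1 / (A + B * (real L + 1)))) \<le> (\<Sum>l=1..L. 1 / (A + B * real l)\<^sup>2 * kap)"
      unfolding sum_distrib_right[symmetric]
      using mult_left_mono[OF telescope_ge[OF AB, of L], of kap] kap_pos by (simp add: mult.commute)
    have "(\<Sum>l=1..L. real (card (primset d (1 / (A + B * real l)\<^sup>2 * (Y - (real_of_int n)\<^sup>2))))) \<le> real (card (Q n N d d' Y))" for Y :: real
    proof -
      have "(\<Sum>l=1..L. real (card (primset d (1 / (A + B * real l)\<^sup>2 * (Y - (real_of_int n)\<^sup>2)))))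
         = real (\<Sum>l=1..L. card (primset d ((Y - (real_of_int n)\<^sup>2) / (real_of_int (N + n * q * int l))\<^sup>2)))"
        by (simp add: A_def B_def)
      then show ?thesis using card_Q_ge[OF pos d, where L = L and Y = Y] by (simp only: of_nat_le_iff)
    qed
    then show "\<forall>\<^sub>F Y in at_top. (\<Sum>l=1..L. real (card (primset d (1 / (A + B * real l)\<^sup>2 * (Y - (real_of_int n)\<^sup>2))))) \<le> real (card (Q n N d d' Y))"
      by simp
  qed
  have "filterlim (\<lambda>L. A + B * (real L + 1)) at_top sequentially"
    using AB by (intro filterlim_tendsto_add_at_top[OF tendsto_const]
      filterlim_tendsto_pos_mult_at_top[OF tendsto_const]) 
      (simp_all add: add.commute[of _ 1] filterlim_tendsto_add_at_top[OF tendsto_const filterlim_real_sequentially])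
  then have "(\<lambda>L. kap * (1 / B * (1 / (A + B) - 1 / (A + B * (real L + 1))))) \<longlonglongrightarrow> kap * (1 / B * (1 / (A + B) - 0))"
    by (intro tendsto_intros real_tendsto_divide_at_top[OF tendsto_const])
  from lbd_limit[OF step this] show ?thesis
    by (simp add: A_def B_def)
qed

text \<open>Exchanging the two coordinates reverses the sign of \<open>crs\<close>, which
  compensates for exchanging u and u'. This interchanges the roles of n and N, for intervals with N
  < n.\<close>

lemma card_Q_swap: "card (Q n N d d' Y) = card (Q N n (prod.swap d') (prod.swap d) Y)"
proof (rule bij_betw_same_card)
  have 1: "(prod.swap u', prod.swap u) \<in> Q N n (prod.swap d') (prod.swap d) Y" if "(u, u') \<in> Q n N d d' Y" for u u' n N d d'
    using that by (auto simp: Q_def vec_defs algebra_simps)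
  show "bij_betw (\<lambda>(u, u'). (prod.swap u', prod.swap u)) (Q n N d d' Y) (Q N n (prod.swap d') (prod.swap d) Y)"
    by (rule bij_betwI[where g = "\<lambda>(u, u'). (prod.swap u', prod.swap u)"])
      (use 1[of _ _ n N d d'] 1[of _ _ N n "prod.swap d'" "prod.swap d"] in auto)
qed

lemma lbd_Q':
  fixes n N :: int
  assumes pos: "n > 0" "N > 0" and d: "q dvd crs d d' - 1"
  shows "lbd (\<lambda>Y. real (card (Q n N d d' Y))) (kap / (N * q * (n + N * q)))"
  using lbd_Q[OF pos(2,1), of "prod.swap d'" "prod.swap d"] d
  by (simp add: card_Q_swap[of n N] crs_def algebra_simps)

text \<open>The inequalities are those for \<rho> in \<open>[a, b)\<close>, multiplied by
  \<open>|v|^2\<close>. For \<open>[0, q)\<close> the bases correspond to the primitive v in the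
  class c, which supplies the total.\<close>

definition Pr :: "int \<times> int \<Rightarrow> int \<times> int \<Rightarrow> real \<Rightarrow> real \<Rightarrow> real \<Rightarrow> ((int \<times> int) \<times> (int \<times> int)) set" where
  "Pr c c' a b Y = {(v, w). crs w v = 1 \<and> vcong q v c \<and> vcong q w c' \<and>
     a * rsq v \<le> real_of_int (dotp w v) \<and> real_of_int (dotp w v) < b * rsq v \<and> rsq v < Y}"

lemma finite_Pr: "finite (Pr c c' a b Y)"
proof (rule finite_subset)
  define B where "B = max \<bar>a\<bar> \<bar>b\<bar> * Y"
  show "Pr c c' a b Y \<subseteq> {v. rsq v < Y} \<times> {w. rsq w < B\<^sup>2 + 2}"
  proof safe
    fix v1 v2 w1 w2 assume a: "((v1, v2), (w1, w2)) \<in> Pr c c' a b Y"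
    let ?v = "(v1, v2)" and ?w = "(w1, w2)"
    have p: "crs ?w ?v = 1" "a * nsq ?v \<le> dotp ?w ?v" "dotp ?w ?v < b * nsq ?v" "rsq ?v < Y"
      using a by (auto simp: Pr_def)
    show "rsq ?v < Y" by fact
    have h: "nsq ?v \<ge> 1" using p(1) by (intro nsq_pos crs_1_nz(2))
    then have h': "rsq ?v \<ge> 0" by simp
    have "\<bar>a * nsq ?v\<bar> \<le> max \<bar>a\<bar> \<bar>b\<bar> * nsq ?v" "\<bar>b * nsq ?v\<bar> \<le> max \<bar>a\<bar> \<bar>b\<bar> * nsq ?v"
      unfolding abs_mult using h' by (auto intro!: mult_right_mono)
    then have "\<bar>real_of_int (dotp ?w ?v)\<bar> \<le> max \<bar>a\<bar> \<bar>b\<bar> * nsq ?v" using p by linarith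
    also have "\<dots> \<le> B" unfolding B_def using p by (intro mult_left_mono) auto
    finally have d: "(real_of_int (dotp ?w ?v))\<^sup>2 \<le> B\<^sup>2" by (meson abs_le_square_iff abs_ge_self order_trans)
    have "nsq ?w * 1 \<le> nsq ?w * nsq ?v" using h nsq_nonneg by (intro mult_left_mono) auto
    also have "\<dots> = (dotp ?w ?v)\<^sup>2 + 1" using lagrange[of ?w ?v] p by simp
    finally have "rsq ?w \<le> (real_of_int (dotp ?w ?v))\<^sup>2 + 1"
      by (metis (no_types, lifting) mult.right_neutral of_int_1 of_int_add of_int_le_iff of_int_power)
    then show "rsq ?w < B\<^sup>2 + 2" using d by linarith
  qed
qed (simp add: finite_nsq_less)

lemma card_Pr_add:
  assumes "a \<le> b" "b \<le> e"
  shows "card (Pr c c' a e Y) = card (Pr c c' a b Y) + card (Pr c c' b e Y)"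
proof -
  have m: "a * rsq v \<le> b * rsq v" "b * rsq v \<le> e * rsq v" for v
    using assms nsq_nonneg[of v] by (auto intro: mult_right_mono)
  have iff: "(a * rsq v \<le> x \<and> x < e * rsq v) \<longleftrightarrow>
     (a * rsq v \<le> x \<and> x < b * rsq v) \<or> (b * rsq v \<le> x \<and> x < e * rsq v)" for v x
    using m[of v] by linarith
  have "Pr c c' a e Y = Pr c c' a b Y \<union> Pr c c' b e Y"
    unfolding Pr_def using iff by blast
  moreover have "Pr c c' a b Y \<inter> Pr c c' b e Y = {}"
    unfolding Pr_def by auto
  ultimately show ?thesis by (simp add: card_Un_disjoint finite_Pr)
qed

lemma lbd_Pr_add:
  assumes "a \<le> b" "b \<le> e" "lbd (\<lambda>Y. real (card (Pr c c' a b Y))) L" "lbd (\<lambda>Y. real (card (Pr c c' b e Y))) K"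
  shows "lbd (\<lambda>Y. real (card (Pr c c' a e Y))) (L + K)"
  using lbd_add[OF assms(3,4)] by (simp add: card_Pr_add[OF assms(1,2)])

text \<open>The inverse substitution is \<open>u = n w - m v\<close>, \<open>u' = M v - N w\<close>,
  integral because the determinant is 1, and the classes transform in the same way. The two bounds
  on \<rho> say that \<open>dotp u v >= 0\<close> and \<open>dotp u' v > 0\<close>; both follow from
  \<open>dotp u u' >= 0\<close>, as v is a positive combination of u and u'.\<close>

lemma card_Q_le_Pr:
  fixes n N m M :: int
  assumes pos: "n > 0" "N > 0" and det: "M * n - m * N = 1"
  shows "card (Q n N (comb n c' (-m) c) (comb M c (-N) c') Y) \<le> card (Pr c c' (m / n) (M / N) Y)"
proof (rule card_inj_on_le[OF _ _ finite_Pr])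
  let ?f = "\<lambda>(u, u'). (comb N u n u', comb M u m u')"
  have bwd: "comb n (comb M u m u') (-m) (comb N u n u') = u" "comb M (comb N u n u') (-N) (comb M u m u') = u'" for u u'
  proof -
    have 1: "n * (M * x + m * y) + - m * (N * x + n * y) = (M * n - m * N) * x"
      "M * (N * x + n * y) + - N * (M * x + m * y) = (M * n - m * N) * y" for x y by algebra+
    show "comb n (comb M u m u') (-m) (comb N u n u') = u" "comb M (comb N u n u') (-N) (comb M u m u') = u'"
      unfolding comb_def fst_conv snd_conv 1 by (simp_all add: det)
  qed
  have fwd: "comb N (comb n c' (-m) c) n (comb M c (-N) c') = c" "comb M (comb n c' (-m) c) m (comb M c (-N) c') = c'"
  proof -
    have 1: "N * (n * x + - m * y) + n * (M * y + - N * x) = (M * n - m * N) * y"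
      "M * (n * x + - m * y) + m * (M * y + - N * x) = (M * n - m * N) * x" for x y by algebra+
    show "comb N (comb n c' (-m) c) n (comb M c (-N) c') = c" "comb M (comb n c' (-m) c) m (comb M c (-N) c') = c'"
      unfolding comb_def fst_conv snd_conv 1 by (simp_all add: det)
  qed
  show "inj_on ?f (Q n N (comb n c' (-m) c) (comb M c (-N) c') Y)"
    by (rule inj_on_inverseI[where g = "\<lambda>(v, w). (comb n w (-m) v, comb M v (-N) w)"])
      (auto simp only: bwd split_beta fst_conv snd_conv prod.collapse)
  show "?f ` Q n N (comb n c' (-m) c) (comb M c (-N) c') Y \<subseteq> Pr c c' (m / n) (M / N) Y"
  proof
    fix z assume "z \<in> ?f ` Q n N (comb n c' (-m) c) (comb M c (-N) c') Y"
    then obtain u u' where z: "z = (comb N u n u', comb M u m u')" and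
      uu: "crs u u' = 1" "vcong q u (comb n c' (-m) c)" "vcong q u' (comb M c (-N) c')" "0 \<le> dotp u u'"
        "rsq (comb N u n u') < Y" by (auto simp: Q_def)
    let ?v = "comb N u n u'" and ?w = "comb M u m u'"
    have "crs ?w ?v = (M * n - m * N) * crs u u'"
      by (simp add: crs_def comb_def algebra_simps)
    then have 1: "crs ?w ?v = 1" using det uu by simp
    have 2: "vcong q ?v c" "vcong q ?w c'"
      using vcong_comb[OF uu(2,3), of N n] vcong_comb[OF uu(2,3), of M m] by (simp_all only: fwd)
    have "n * dotp ?w ?v - m * nsq ?v = (M * n - m * N) * (N * nsq u + n * dotp u u')"
      by (simp add: dotp_def comb_def algebra_simps)
    moreover have "0 \<le> N * nsq u + n * dotp u u'" using pos uu nsq_nonneg by simp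
    ultimately have "m * nsq ?v \<le> n * dotp ?w ?v" using det by simp
    then have "real_of_int m * nsq ?v \<le> n * dotp ?w ?v" by (metis of_int_le_iff of_int_mult)
    then have 3: "m / n * nsq ?v \<le> dotp ?w ?v" using pos by (simp add: field_simps)
    have "M * nsq ?v - N * dotp ?w ?v = (M * n - m * N) * (N * dotp u u' + n * nsq u')"
      by (simp add: dotp_def comb_def algebra_simps)
    moreover have "nsq u' > 0" using nsq_pos[OF crs_1_nz(2)[OF uu(1)]] by simp
    then have "0 < N * dotp u u' + n * nsq u'" using pos uu by (simp add: add_nonneg_pos)
    ultimately have "N * dotp ?w ?v < M * nsq ?v" using det by simp
    then have "real_of_int N * dotp ?w ?v < M * nsq ?v" by (metis of_int_less_iff of_int_mult)
    then have 4: "dotp ?w ?v < M / N * nsq ?v" using pos by (simp add: field_simps)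
    show "z \<in> Pr c c' (m / n) (M / N) Y" using z 1 2 3 4 uu by (simp add: Pr_def)
  qed
qed

lemma lbd_Pr_direct:
  fixes n N m M :: int
  assumes pos: "n > 0" "N > 0" and det: "M * n - m * N = 1" and c: "q dvd crs c' c - 1"
  shows "lbd (\<lambda>Y. real (card (Pr c c' (m / n) (M / N) Y))) (kap / (n * q * (N + n * q)))"
    "lbd (\<lambda>Y. real (card (Pr c c' (m / n) (M / N) Y))) (kap / (N * q * (n + N * q)))"
proof -
  have "crs (comb n c' (-m) c) (comb M c (-N) c') = (M * n - m * N) * crs c' c"
    by (simp add: crs_def comb_def algebra_simps)
  then have d: "q dvd crs (comb n c' (-m) c) (comb M c (-N) c') - 1" using c det by simp
  have le: "\<forall>\<^sub>F Y in at_top. real (card (Q n N (comb n c' (-m) c) (comb M c (-N) c') Y)) \<le> real (card (Pr c c' (m / n) (M / N) Y))"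
    using card_Q_le_Pr[OF pos det] by simp
  show "lbd (\<lambda>Y. real (card (Pr c c' (m / n) (M / N) Y))) (kap / (n * q * (N + n * q)))"
    using lbd_mono[OF lbd_Q[OF pos d] order_refl le] .
  show "lbd (\<lambda>Y. real (card (Pr c c' (m / n) (M / N) Y))) (kap / (N * q * (n + N * q)))"
    using lbd_mono[OF lbd_Q'[OF pos d] order_refl le] .
qed

end


section \<open>Equidistribution of the bases\<close>

context level begin

context
  fixes c c' :: "int \<times> int"
  assumes unimod: "q dvd crs c' c - 1"
begin

abbreviation cnt :: "real \<Rightarrow> real \<Rightarrow> real \<Rightarrow> real" where
  "cnt a b Y \<equiv> real (card (Pr c c' a b Y))"

text \<open>\<open>1 / (n N)\<close> is the length of the Farey interval and \<open>kap / q\<close>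
  the expected density of \<rho>, so \<theta> is the guaranteed share of the expected count. The
  goal is \<theta> = 1, reached by improving the trivial \<theta> = 0.\<close>

definition farey_lbd :: "real \<Rightarrow> bool" where
  "farey_lbd \<theta> \<longleftrightarrow> (\<forall>(m::int) (n::int) (M::int) (N::int). n > 0 \<longrightarrow> N > 0 \<longrightarrow> M * n - m * N = 1 \<longrightarrow>
     lbd (cnt (m / n) (M / N)) (\<theta> * (kap / q) * (1 / (real_of_int n * real_of_int N))))"

lemma farey_lbdD:
  fixes m n M N :: int
  shows "farey_lbd \<theta> \<Longrightarrow> n > 0 \<Longrightarrow> N > 0 \<Longrightarrow> M * n - m * N = 1 \<Longrightarrow>
    lbd (cnt (m / n) (M / N)) (\<theta> * (kap / q) * (1 / (real_of_int n * real_of_int N)))"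
  unfolding farey_lbd_def by blast

lemma frac_le_int:
  fixes m n M N :: int
  assumes "n > 0" "N > 0" "m * N \<le> M * n"
  shows "real_of_int m / real_of_int n \<le> real_of_int M / real_of_int N"
proof -
  have "real_of_int m * N \<le> real_of_int M * n" using assms(3) by (metis of_int_le_iff of_int_mult)
  then show ?thesis using assms by (simp add: field_simps)
qed

lemma farey_order:
  fixes m n M N :: int
  assumes "n > 0" "N > 0" "M * n - m * N = 1"
  shows "real_of_int m / n \<le> M / N" "real_of_int M / N - m / n = 1 / (real_of_int n * real_of_int N)"
proof -
  have "real_of_int M * n - m * N = 1" using assms(3) by (metis of_int_1 of_int_diff of_int_mult)
  then show 1: "real_of_int M / N - m / n = 1 / (real_of_int n * real_of_int N)" using assms by (simp add: field_simps)
  show "real_of_int m / n \<le> M / N" using assms by (intro frac_le_int) auto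
qed

text \<open>The fractions \<open>(M + i m) / (N + i n)\<close> descend from \<open>M / N\<close>
  towards \<open>m / n\<close>, and consecutive ones are Farey neighbours, so the hypothesis applies
  to each link.\<close>

lemma farey_chain_right:
  fixes m n M N :: int
  assumes th: "farey_lbd \<theta>" and pos: "n > 0" "N > 0" and det: "M * n - m * N = 1"
  shows "lbd (cnt ((M + int i * m) / (N + int i * n)) (M / N))
    (\<theta> * (kap / q) * (real_of_int M / N - (M + int i * m) / (N + int i * n)))"
proof (induction i)
  case 0
  show ?case by (rule lbd_nonneg) auto
next
  case (Suc i)
  have p: "N + int i * n > 0" "N + int (Suc i) * n > 0" using pos by (simp_all add: add_pos_nonneg)
  have d: "(M + int i * m) * (N + int (Suc i) * n) - (M + int (Suc i) * m) * (N + int i * n) = 1"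
    "M * (N + int i * n) - (M + int i * m) * N = int i"
    using det unfolding of_nat_Suc by algebra+
  have le: "real_of_int (M + int i * m) / (N + int i * n) \<le> M / N"
    using d(2) p pos by (intro frac_le_int) auto
  note fo = farey_order[OF p(2,1) d(1)]
  have "lbd (cnt ((M + int (Suc i) * m) / (N + int (Suc i) * n)) ((M + int i * m) / (N + int i * n)))
      (\<theta> * (kap / q) * (real_of_int (M + int i * m) / (N + int i * n) - real_of_int (M + int (Suc i) * m) / (N + int (Suc i) * n)))"
    unfolding fo(2) by (rule farey_lbdD[OF th p(2,1) d(1)])
  from lbd_Pr_add[OF fo(1) le this Suc.IH] show ?case
    by (simp only: distrib_left[symmetric] diff_add_cancel add.commute) (simp add: algebra_simps)
qed

lemma farey_chain_left:
  fixes m n M N :: int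
  assumes th: "farey_lbd \<theta>" and pos: "n > 0" "N > 0" and det: "M * n - m * N = 1"
  shows "lbd (cnt (m / n) ((m + int i * M) / (n + int i * N)))
    (\<theta> * (kap / q) * ((m + int i * M) / (n + int i * N) - real_of_int m / n))"
proof (induction i)
  case 0
  show ?case by (rule lbd_nonneg) auto
next
  case (Suc i)
  have p: "n + int i * N > 0" "n + int (Suc i) * N > 0" using pos by (simp_all add: add_pos_nonneg)
  have d: "(m + int (Suc i) * M) * (n + int i * N) - (m + int i * M) * (n + int (Suc i) * N) = 1"
    "(m + int i * M) * n - m * (n + int i * N) = int i"
    using det unfolding of_nat_Suc by algebra+
  have le: "real_of_int m / n \<le> (m + int i * M) / (n + int i * N)"
    using d(2) p pos by (intro frac_le_int) auto
  note fo = farey_order[OF p d(1)]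
  have "lbd (cnt ((m + int i * M) / (n + int i * N)) ((m + int (Suc i) * M) / (n + int (Suc i) * N)))
      (\<theta> * (kap / q) * (real_of_int (m + int (Suc i) * M) / (n + int (Suc i) * N) - real_of_int (m + int i * M) / (n + int i * N)))"
    unfolding fo(2) by (rule farey_lbdD[OF th p d(1)])
  from lbd_Pr_add[OF le fo(1) Suc.IH this] show ?case
    by (simp add: algebra_simps)
qed

text \<open>Used with x = q and k = kap. The piece next to the endpoint with denominator n has
  relative length \<open>p = N / (N + j n) >= 1 / (1 + j)\<close> and carries at least the share
  \<open>\<beta> = j / (j + x)\<close>; the rest carries \<theta>.\<close>

lemma step_arith:
  fixes n N j \<theta> k x :: real
  assumes pos: "n > 0" "N \<ge> n" "j \<ge> 1" "x > 0" "k > 0" and th: "\<theta> \<le> j / (j + x)"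
  shows "(\<theta> + (j / (j + x) - \<theta>) / (1 + j)) * (k / x) * (1 / (n * N)) \<le>
    k / (n * x * (N + j * n + n * x)) + \<theta> * (k / x) * (1 / (n * N) - 1 / (n * (N + j * n)))"
proof -
  define p where "p = N / (N + j * n)"
  define \<beta> where "\<beta> = j / (j + x)"
  have pp: "N + j * n > 0" "N > 0" "N + j * n + n * x > 0"
    using pos mult_pos_pos[of j n] mult_pos_pos[of n x] by linarith+
  have "N + j * n \<le> N * (1 + j)" using pos by (simp add: algebra_simps mult_left_mono)
  then have p1: "1 / (1 + j) \<le> p" unfolding p_def using pos pp by (simp add: divide_le_eq pos_le_divide_eq field_simps)
  have "\<beta> * (N + j * n + n * x) \<le> N + j * n"
  proof -
    have "j * (N + j * n + n * x) \<le> (N + j * n) * (j + x)" using pos pp by (simp add: algebra_simps)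
    then show ?thesis using pos unfolding \<beta>_def by (simp add: pos_divide_le_eq)
  qed
  then have "\<beta> / (N + j * n) \<le> 1 / (N + j * n + n * x)" using pp by (simp add: field_simps)
  then have b: "1 / (n * N) * (p * \<beta>) \<le> 1 / (n * (N + j * n + n * x))"
    using pos pp mult_left_mono[of "\<beta> / (N + j * n)" "1 / (N + j * n + n * x)" "1 / n"] by (simp add: p_def)
  have "\<theta> + (\<beta> - \<theta>) / (1 + j) \<le> \<theta> + p * (\<beta> - \<theta>)"
    using mult_right_mono[OF p1, of "\<beta> - \<theta>"] th by (simp add: \<beta>_def)
  then have "(\<theta> + (\<beta> - \<theta>) / (1 + j)) * (1 / (n * N)) \<le> (p * \<beta> + \<theta> * (1 - p)) * (1 / (n * N))"
    using pos pp by (intro mult_right_mono) (auto simp: algebra_simps)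
  also have "\<dots> = 1 / (n * N) * (p * \<beta>) + \<theta> * (1 / (n * N) - 1 / (n * (N + j * n)))"
  proof -
    have "p * (1 / (n * N)) = 1 / (n * (N + j * n))" using pos pp by (simp add: p_def)
    moreover have "(p * \<beta> + \<theta> * (1 - p)) * y = y * (p * \<beta>) + \<theta> * (y - p * y)" for y
      by (simp add: algebra_simps)
    ultimately show ?thesis by metis
  qed
  also have "\<dots> \<le> 1 / (n * (N + j * n + n * x)) + \<theta> * (1 / (n * N) - 1 / (n * (N + j * n)))"
    using b by simp
  finally have "(k / x) * ((\<theta> + (\<beta> - \<theta>) / (1 + j)) * (1 / (n * N))) \<le>
     (k / x) * (1 / (n * (N + j * n + n * x)) + \<theta> * (1 / (n * N) - 1 / (n * (N + j * n))))"
    using pos by (intro mult_left_mono) auto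
  also have "\<dots> = k / (n * x * (N + j * n + n * x)) + \<theta> * (k / x) * (1 / (n * N) - 1 / (n * (N + j * n)))"
    by (simp add: ring_distribs mult_ac)
  finally show ?thesis by (simp add: \<beta>_def mult_ac)
qed

text \<open>
  A part of relative length at least \<open>1 / (1 + j)\<close>, adjacent to the endpoint with the smaller
  denominator, is bounded directly by \<open>lbd_Pr_direct\<close>; the rest is a union of \<open>j\<close> Farey intervals.
\<close>

lemma farey_lbd_step:
  fixes j :: nat
  assumes th: "farey_lbd \<theta>" "\<theta> \<le> j / (j + q)" and j: "j \<ge> 1"
  shows "farey_lbd (\<theta> + (j / (j + q) - \<theta>) / (1 + j))"
  unfolding farey_lbd_def
proof (intro allI impI)
  fix m n M N :: int assume pos: "n > 0" "N > 0" and det: "M * n - m * N = 1"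
  note fo = farey_order[OF pos det]
  show "lbd (cnt (m / n) (M / N)) ((\<theta> + (j / (j + q) - \<theta>) / (1 + j)) * (kap / q) * (1 / (real_of_int n * real_of_int N)))"
  proof (cases "n \<le> N")
    case True
    let ?M = "M + int j * m" and ?N = "N + int j * n"
    have p: "?N > 0" using pos by (simp add: add_pos_nonneg)
    have d: "?M * n - m * ?N = 1" using det by (simp add: algebra_simps)
    note fo' = farey_order[OF pos(1) p d]
    have "?M * N \<le> M * ?N" 
    proof -
      have "M * ?N - ?M * N = int j" using det by algebra
      then show ?thesis by simp
    qed
    then have le: "real_of_int ?M / ?N \<le> M / N" using p pos
      by (intro frac_le_int)
    have "lbd (cnt (m / n) (M / N)) (kap / (n * q * (?N + n * q)) + \<theta> * (kap / q) * (real_of_int M / N - ?M / ?N))"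
      by (rule lbd_Pr_add[OF fo'(1) le lbd_Pr_direct(1)[OF pos(1) p d unimod] farey_chain_right[OF th(1) pos det]])
    moreover have "real_of_int M / N - ?M / ?N = 1 / (real_of_int n * real_of_int N) - 1 / (real_of_int n * real_of_int ?N)"
      using fo(2) fo'(2) by linarith
    ultimately have "lbd (cnt (m / n) (M / N)) (kap / (n * q * (?N + n * q)) + \<theta> * (kap / q) * (1 / (real_of_int n * real_of_int N) - 1 / (real_of_int n * real_of_int ?N)))"
      by simp
    then show ?thesis
      using step_arith[of n N j q kap \<theta>] True pos j th q_pos kap_pos
      by (intro lbd_mono[where g = "cnt (m / n) (M / N)"]) (auto simp: algebra_simps)
  next
    case False
    let ?M = "m + int j * M" and ?N = "n + int j * N"
    have p: "?N > 0" using pos by (simp add: add_pos_nonneg)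
    have d: "M * ?N - ?M * N = 1" using det by (simp add: algebra_simps)
    note fo' = farey_order[OF p pos(2) d]
    have "m * ?N \<le> ?M * n"
    proof -
      have "?M * n - m * ?N = int j" using det by algebra
      then show ?thesis by simp
    qed
    then have le: "real_of_int m / n \<le> ?M / ?N" using p pos
      by (intro frac_le_int)
    have "lbd (cnt (m / n) (M / N)) (\<theta> * (kap / q) * (?M / ?N - real_of_int m / n) + kap / (N * q * (?N + N * q)))"
      by (rule lbd_Pr_add[OF le fo'(1) farey_chain_left[OF th(1) pos det] lbd_Pr_direct(2)[OF p pos(2) d unimod]])
    moreover have "?M / ?N - real_of_int m / n = 1 / (real_of_int n * real_of_int N) - 1 / (real_of_int ?N * real_of_int N)"
      using fo(2) fo'(2) by linarith
    ultimately have "lbd (cnt (m / n) (M / N)) (\<theta> * (kap / q) * (1 / (real_of_int n * real_of_int N) - 1 / (real_of_int ?N * real_of_int N)) + kap / (N * q * (?N + N * q)))"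
      by simp
    then show ?thesis
      using step_arith[of N n j q kap \<theta>] False pos j th q_pos kap_pos
      by (intro lbd_mono[where g = "cnt (m / n) (M / N)"]) (auto simp: algebra_simps)
  qed
qed

text \<open>The recursion of \<open>farey_lbd_step\<close> has the fixed point \<beta> and shrinks
  the distance to it by the factor \<open>r = 1 - 1 / (1 + j)\<close>. It starts at \<theta> =
  0.\<close>

lemma farey_lbd_beta:
  fixes j :: nat
  assumes j: "j \<ge> 1" shows "farey_lbd (j / (j + q))"
proof -
  define \<beta> where "\<beta> = real j / (j + q)"
  define r where "r = 1 - 1 / (1 + real j)"
  have r: "0 \<le> r" "r < 1" using j by (auto simp: r_def)
  have b: "\<beta> \<ge> 0" using q_pos by (simp add: \<beta>_def)
  have it: "farey_lbd (\<beta> - \<beta> * r ^ i)" for i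
  proof (induction i)
    case 0
    show ?case unfolding farey_lbd_def by (auto intro!: lbd_nonneg)
  next
    case (Suc i)
    have "farey_lbd ((\<beta> - \<beta> * r ^ i) + (\<beta> - (\<beta> - \<beta> * r ^ i)) / (1 + j))"
    proof -
      have "\<beta> - \<beta> * r ^ i \<le> real j / (j + q)"
        using mult_nonneg_nonneg[OF b zero_le_power[OF r(1), of i]] by (simp add: \<beta>_def)
      from farey_lbd_step[OF Suc this j] show ?thesis by (simp add: \<beta>_def)
    qed
    also have "(\<beta> - \<beta> * r ^ i) + (\<beta> - (\<beta> - \<beta> * r ^ i)) / (1 + j) = \<beta> - \<beta> * r ^ Suc i"
      by (simp add: r_def algebra_simps)
    finally show ?case .
  qed
  show ?thesis unfolding farey_lbd_def
  proof (intro allI impI)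
    fix m n M N :: int assume a: "n > 0" "N > 0" "M * n - m * N = 1"
    have "(\<lambda>i. r ^ i) \<longlonglongrightarrow> 0" using r by (rule LIMSEQ_realpow_zero)
    then have "(\<lambda>i. (\<beta> - \<beta> * r ^ i) * (kap / q) * (1 / (real_of_int n * real_of_int N))) \<longlonglongrightarrow> (\<beta> - \<beta> * 0) * (kap / q) * (1 / (real_of_int n * real_of_int N))"
      by (intro tendsto_mult tendsto_diff tendsto_const)
    from lbd_limit[OF farey_lbdD[OF it a] this]
    show "lbd (cnt (m / n) (M / N)) (j / (j + q) * (kap / q) * (1 / (real_of_int n * real_of_int N)))"
      by (simp add: \<beta>_def)
  qed
qed

text \<open>The loss of the direct estimate vanishes as j grows, since the piece to which it is
  applied then has very unequal denominators.\<close>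

lemma farey_lbd_1: "farey_lbd 1"
  unfolding farey_lbd_def
proof (intro allI impI)
  fix m n M N :: int assume a: "n > 0" "N > 0" "M * n - m * N = 1"
  have "(\<lambda>j. real j / (real j + q)) \<longlonglongrightarrow> 1"
  proof -
    have "(\<lambda>j. 1 - q / (q + real j)) \<longlonglongrightarrow> 1 - 0"
      by (intro tendsto_intros real_tendsto_divide_at_top[OF tendsto_const]
        filterlim_tendsto_add_at_top[OF tendsto_const] filterlim_real_sequentially)
    moreover have "1 - q / (q + real j) = real j / (real j + q)" for j
      using q_pos by (simp add: field_simps add_pos_nonneg)
    ultimately show ?thesis by simp
  qed
  then have "(\<lambda>j. real j / (real j + q)  * (kap / q) * (1 / (real_of_int n * real_of_int N))) \<longlonglongrightarrow> 1 * (kap / q) * (1 / (real_of_int n * real_of_int N))"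
    by (intro tendsto_intros)
  then have "(\<lambda>j. real (Suc j) / (real (Suc j) + q)  * (kap / q) * (1 / (real_of_int n * real_of_int N))) \<longlonglongrightarrow> 1 * (kap / q) * (1 / (real_of_int n * real_of_int N))"
    by (rule LIMSEQ_Suc)
  moreover have "farey_lbd (real (Suc j) / (real (Suc j) + q))" for j
    using farey_lbd_beta[of "Suc j"] by simp
  from farey_lbdD[OF this a]
  have "lbd (cnt (m / n) (M / N)) (real (Suc j) / (real (Suc j) + q) * (kap / q) * (1 / (real_of_int n * real_of_int N)))" for j .
  ultimately show "lbd (cnt (m / n) (M / N)) (1 * (kap / q) * (1 / (real_of_int n * real_of_int N)))"
    by (rule lbd_limit[rotated])
qed

text \<open>Repeated cutting at the mediant: the part without b is counted in full by
  \<open>farey_lbd_1\<close>, the part with b is cut again, and only the last interval around b is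
  lost. Its length is at most \<open>1 / (n + N - 1)\<close>, as \<open>n N >= n + N - 1\<close>,
  and every cut raises the sum of the denominators by at least 1; this gives the r in the
  bound.\<close>

lemma farey_split:
  fixes m n M N :: int
  assumes "n > 0" "N > 0" "M * n - m * N = 1" "m / n \<le> b" "b \<le> M / N"
  shows "lbd (cnt (m / n) b) (kap / q * (b - m / n - 1 / (n + N - 1 + real r)))
    \<and> lbd (cnt b (M / N)) (kap / q * (M / N - b - 1 / (n + N - 1 + real r)))"
  using assms
proof (induction r arbitrary: m n M N)
  case 0
  have "0 \<le> (n - 1) * (N - 1)" using 0 by simp
  then have "real_of_int (n + N - 1) \<le> real_of_int (n * N)" by (simp only: of_int_le_iff) (simp add: algebra_simps)
  then have "1 / (real_of_int n * real_of_int N) \<le> 1 / (n + N - 1)" using 0 by (simp add: frac_le)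
  then have "b - m / n - 1 / (n + N - 1 + real 0) \<le> 0" "M / N - b - 1 / (n + N - 1 + real 0) \<le> 0"
    using farey_order(2)[OF 0(1-3)] 0 by simp_all
  then show ?case using kap_pos q_pos by (intro conjI lbd_nonneg mult_nonneg_nonpos) simp_all
next
  case (Suc r)
  have pos: "n + N > 0" using Suc.prems by simp
  have d1: "(m + M) * n - m * (n + N) = 1" and d2: "M * (n + N) - (m + M) * N = 1"
    using Suc.prems by (simp_all add: algebra_simps)
  note f1 = farey_order[OF Suc.prems(1) pos d1] and f2 = farey_order[OF pos Suc.prems(2) d2]
  let ?e = "1 / (n + N - 1 + real (Suc r))"
  have e1: "1 / (n + (n + N) - 1 + real r) \<le> ?e" and e2: "1 / ((n + N) + N - 1 + real r) \<le> ?e"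
    using Suc.prems by (intro divide_left_mono; simp add: mult_pos_pos)+
  have k: "kap / q \<ge> 0" using kap_pos q_pos by simp
  note F = farey_lbdD[OF farey_lbd_1]
  show ?case
  proof (cases "b \<le> (m + M) / (n + N)")
    case True
    have ih: "lbd (cnt (m / n) b) (kap / q * (b - m / n - 1 / (n + (n + N) - 1 + real r)))"
      "lbd (cnt b ((m + M) / (n + N))) (kap / q * ((m + M) / (n + N) - b - 1 / (n + (n + N) - 1 + real r)))"
      using Suc.IH[OF Suc.prems(1) pos d1] Suc.prems True by auto
    have "lbd (cnt (m / n) b) (kap / q * (b - m / n - ?e))"
      using ih(1) by (rule lbd_mono) (use e1 k in \<open>intro mult_left_mono, auto\<close>)
    moreover have "lbd (cnt ((m + M) / (n + N)) (M / N)) (kap / q * (M / N - (m + M) / (n + N)))"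
      using F[OF pos Suc.prems(2) d2] unfolding f2(2) by simp
    from lbd_Pr_add[OF True f2(1) ih(2) this]
    have "lbd (cnt b (M / N)) (kap / q * (M / N - b - ?e))"
      by (rule lbd_mono) (use e1 k in \<open>unfold distrib_left[symmetric], intro mult_left_mono, auto\<close>)
    ultimately show ?thesis by blast
  next
    case False
    then have le: "(m + M) / (n + N) \<le> b" by simp
    have ih: "lbd (cnt ((m + M) / (n + N)) b) (kap / q * (b - (m + M) / (n + N) - 1 / ((n + N) + N - 1 + real r)))"
      "lbd (cnt b (M / N)) (kap / q * (M / N - b - 1 / ((n + N) + N - 1 + real r)))"
      using Suc.IH[OF pos Suc.prems(2) d2] Suc.prems le by auto
    have "lbd (cnt b (M / N)) (kap / q * (M / N - b - ?e))"
      using ih(2) by (rule lbd_mono) (use e2 k in \<open>intro mult_left_mono, auto\<close>)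
    moreover have "lbd (cnt (m / n) ((m + M) / (n + N))) (kap / q * ((m + M) / (n + N) - m / n))"
      using F[OF Suc.prems(1) pos d1] unfolding f1(2) by simp
    from lbd_Pr_add[OF f1(1) le this ih(1)]
    have "lbd (cnt (m / n) b) (kap / q * (b - m / n - ?e))"
      by (rule lbd_mono) (use e2 k in \<open>unfold distrib_left[symmetric], intro mult_left_mono, auto\<close>)
    ultimately show ?thesis by blast
  qed
qed

text \<open>\<open>i / 1\<close> and \<open>(i + 1) / 1\<close> are Farey neighbours, and the loss
  in \<open>farey_split\<close> vanishes as r grows.\<close>

lemma lbd_unit_interval:
  fixes i :: int and b :: real
  assumes "i \<le> b" "b \<le> i + 1"
  shows "lbd (cnt i b) (kap / q * (b - i))" "lbd (cnt b (i + 1)) (kap / q * (i + 1 - b))"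
proof -
  have t: "(\<lambda>r. kap / q * (x - 1 / (1 + 1 - 1 + real r))) \<longlonglongrightarrow> kap / q * (x - 0)" for x
    by (intro tendsto_intros real_tendsto_divide_at_top[OF tendsto_const]
      filterlim_tendsto_add_at_top[OF tendsto_const] filterlim_real_sequentially)
  have s: "lbd (cnt i b) (kap / q * (b - i - 1 / (1 + 1 - 1 + real r)))"
    "lbd (cnt b (i + 1)) (kap / q * (i + 1 - b - 1 / (1 + 1 - 1 + real r)))" for r
    using farey_split[of 1 1 "i + 1" i b r] assms by simp_all
  show "lbd (cnt i b) (kap / q * (b - i))" "lbd (cnt b (i + 1)) (kap / q * (i + 1 - b))"
    using lbd_limit[OF s(1) t] lbd_limit[OF s(2) t] by simp_all
qed

lemma lbd_int_interval: "lbd (cnt (real_of_int i) (real_of_int i + real k)) (kap / q * k)"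
proof (induction k)
  case 0
  show ?case by (rule lbd_nonneg) auto
next
  case (Suc k)
  have "lbd (cnt (real_of_int i + real k) (real_of_int i + real (Suc k))) (kap / q * 1)"
    using lbd_unit_interval(1)[of "i + int k" "i + int k + 1"] by (simp add: algebra_simps)
  from lbd_Pr_add[OF _ _ Suc this] show ?case by (simp add: algebra_simps add_divide_distrib)
qed

lemma lbd_Pr:
  fixes b :: real
  assumes "0 \<le> b" "b \<le> q"
  shows "lbd (cnt 0 b) (kap / q * b)" "lbd (cnt b q) (kap / q * (q - b))"
proof -
  define i where "i = \<lfloor>b\<rfloor>"
  have i: "real_of_int i \<le> b" "b \<le> i + 1" "i \<ge> 0" using assms unfolding i_def by linarith+
  have "lbd (cnt 0 i) (kap / q * i)" using lbd_int_interval[of 0 "nat i"] i by simp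
  from lbd_Pr_add[OF _ i(1) this lbd_unit_interval(1)[OF i(1,2)]] i
  show "lbd (cnt 0 b) (kap / q * b)" by (simp add: algebra_simps flip: add_divide_distrib)
  show "lbd (cnt b q) (kap / q * (q - b))"
  proof (cases "b = q")
    case True
    then show ?thesis by (auto intro: lbd_nonneg)
  next
    case False
    then have "i + 1 \<le> q" using assms unfolding i_def by linarith
    then have "lbd (cnt (real_of_int (i + 1)) q) (kap / q * (q - (i + 1)))"
      using lbd_int_interval[of "i + 1" "nat (q - (i + 1))"] by simp
    from lbd_Pr_add[OF i(2) _ lbd_unit_interval(2)[OF i(1,2)], of q "kap / q * (q - (i + 1))"] this \<open>i + 1 \<le> q\<close>
    have "lbd (cnt b q) (kap / q * (i + 1 - b) + kap / q * (q - (i + 1)))" by simp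
    moreover have "kap / q * (i + 1 - b) + kap / q * (q - (i + 1)) = kap / q * (q - b)"
      unfolding distrib_left[symmetric] by simp
    ultimately show ?thesis by simp
  qed
qed

text \<open>Two completions of v differ by a multiple \<open>a v\<close>. The congruence makes a
  divisible by q, and products within one window of length \<open>q * nsq v\<close> give
  \<open>|a| < q\<close>.\<close>

lemma partner_unique:
  assumes "crs w v = 1" "crs w' v = 1" "vcong q w w'"
    "0 \<le> dotp w v" "dotp w v < q * nsq v" "0 \<le> dotp w' v" "dotp w' v < q * nsq v"
  shows "w = w'"
proof -
  define a where "a = crs w (comb 1 w (-1) w')"
  have z: "crs (comb 1 w (-1) w') v = 0" using assms(1,2) by (simp add: crs_def comb_def algebra_simps)
  have e: "x * (fst w * snd v - snd w * fst v) = x" for x using assms(1) by (simp add: crs_def)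
  have 1: "fst w - fst w' = a * fst v" "snd w - snd w' = a * snd v"
    using e[of "fst w - fst w'"] e[of "snd w - snd w'"] z
    unfolding a_def crs_def comb_def fst_conv snd_conv by algebra+
  have "q dvd a"
    using assms(3) by (auto simp: a_def crs_def comb_def vcong_def)
  have "dotp w v - dotp w' v = (fst w - fst w') * fst v + (snd w - snd w') * snd v"
    by (simp add: dotp_def algebra_simps)
  then have "a * nsq v = dotp w v - dotp w' v" unfolding 1 by (simp add: dotp_def algebra_simps)
  then have "\<bar>a * nsq v\<bar> < q * nsq v" using assms(4-7) by linarith
  then have "\<bar>a\<bar> * nsq v < q * nsq v" using nsq_nonneg[of v] by (simp add: abs_mult)
  then have "\<bar>a\<bar> < q" using nsq_nonneg[of v] by (simp add: mult_less_cancel_right)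
  then have "a = 0" using \<open>q dvd a\<close> dvd_imp_le_int[of a q] by force
  then show ?thesis using 1 by (simp add: prod_eq_iff)
qed

lemma bij_Pr_primset: "bij_betw fst (Pr c c' 0 q Y) (primset c Y)"
  unfolding bij_betw_def
proof
  show "inj_on fst (Pr c c' 0 q Y)"
  proof (rule inj_onI)
    fix x y assume xy: "x \<in> Pr c c' 0 q Y" "y \<in> Pr c c' 0 q Y" "fst x = fst y"
    obtain v w w' where e: "x = (v, w)" "y = (v, w')" using xy(3) by (metis prod.collapse)
    have *: "crs w v = 1 \<and> vcong q w c' \<and> 0 \<le> dotp w v \<and> dotp w v < q * nsq v" if "(v, w) \<in> Pr c c' 0 q Y" for w
      using that by (simp add: Pr_def flip: of_int_mult)
    have m: "(v, w) \<in> Pr c c' 0 q Y" "(v, w') \<in> Pr c c' 0 q Y" using xy e by simp_all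
    then have "vcong q w w'" using *[OF m(1)] *[OF m(2)] vcong_trans[OF _ vcong_sym] by blast
    then have "w = w'" using *[OF m(1)] *[OF m(2)] by (intro partner_unique[of w v w']) auto
    then show "x = y" using e by simp
  qed
  show "fst ` Pr c c' 0 q Y = primset c Y"
  proof (intro set_eqI iffI)
    fix v assume "v \<in> fst ` Pr c c' 0 q Y"
    then show "v \<in> primset c Y" by (auto simp: Pr_def primset_def intro: crs_1_prim(2))
  next
    fix v assume v: "v \<in> primset c Y"
    \<comment> \<open>\<open>partner_exists\<close> completes on the other side; swapping the
      coordinates adapts the orientation to \<open>crs w v = 1\<close>.\<close>
    have "prim (prod.swap v)" "vcong q (prod.swap v) (prod.swap c)"
      using v by (auto simp: primset_def prim_def vcong_def coprime_commute)
    moreover have "q dvd crs (prod.swap c) (prod.swap c') - 1"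
      using unimod by (simp add: crs_def algebra_simps)
    ultimately obtain u where u: "crs (prod.swap v) u = 1" "vcong q u (prod.swap c')"
      "q * 0 * nsq (prod.swap v) \<le> dotp (prod.swap v) u" "dotp (prod.swap v) u < q * (0 + 1) * nsq (prod.swap v)"
      using partner_exists by blast
    have "crs (prod.swap u) v = 1" "vcong q (prod.swap u) c'" "0 \<le> dotp (prod.swap u) v" "dotp (prod.swap u) v < q * nsq v"
      using u by (auto simp: vec_defs algebra_simps)
    then have "(v, prod.swap u) \<in> Pr c c' 0 q Y"
      using v by (simp add: Pr_def primset_def flip: of_int_mult)
    then show "v \<in> fst ` Pr c c' 0 q Y" by force
  qed
qed

lemma cnt_total: "cnt 0 q Y = real (card (primset c Y))"
  using bij_betw_same_card[OF bij_Pr_primset] by simp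

lemma unit_class_c: "unit_class c"
  using unimodular_class[of "prod.swap c" "prod.swap c'"] unimod
  by (simp add: crs_def unit_class_def vgcd_def gcd.commute algebra_simps)

text \<open>The lower bounds for \<open>[0, x)\<close> and \<open>[x, q)\<close> already add up to
  the density kap of all bases, so both are attained.\<close>

theorem cnt_tendsto:
  fixes a b :: real
  assumes "0 \<le> a" "a \<le> b" "b \<le> q"
  shows "((\<lambda>Y. cnt a b Y / Y) \<longlongrightarrow> kap / q * (b - a)) at_top"
proof -
  have *: "((\<lambda>Y. cnt 0 x Y / Y) \<longlongrightarrow> kap / q * x) at_top" if "0 \<le> x" "x \<le> q" for x :: real
  proof (rule lbd_squeeze[OF lbd_Pr[OF that]])
    have "(cnt 0 x Y + cnt x q Y) = real (card (primset c Y))" for Y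
      using card_Pr_add[OF that, where c = c and c' = c' and Y = Y] cnt_total[of Y] by simp
    moreover have "kap / q * x + kap / q * (q - x) = kap"
      using q_pos by (simp add: field_simps)
    ultimately show "((\<lambda>Y. (cnt 0 x Y + cnt x q Y) / Y) \<longlongrightarrow> kap / q * x + kap / q * (q - x)) at_top"
      using prim_count[OF unit_class_c] by simp
  qed
  have "((\<lambda>Y. cnt 0 b Y / Y - cnt 0 a Y / Y) \<longlongrightarrow> kap / q * b - kap / q * a) at_top"
    using assms by (intro tendsto_diff *) auto
  moreover have "cnt 0 b Y / Y - cnt 0 a Y / Y = cnt a b Y / Y" for Y
    using card_Pr_add[OF assms(1,2), where c = c and c' = c' and Y = Y] by (simp add: add_divide_distrib)
  ultimately show ?thesis by (simp add: right_diff_distrib)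
qed

end
end

section \<open>From boxes to open sets\<close>

definition dyad :: "nat \<Rightarrow> real \<times> real \<Rightarrow> int \<times> int" where
  "dyad n x = (\<lfloor>2 ^ n * fst x\<rfloor>, \<lfloor>2 ^ n * snd x\<rfloor>)"

lemma dyad_cell:
  "{x. dyad n x = z} = {real_of_int (fst z) / 2 ^ n..<(real_of_int (fst z) + 1) / 2 ^ n} \<times> {real_of_int (snd z) / 2 ^ n..<(real_of_int (snd z) + 1) / 2 ^ n}"
proof -
  have *: "\<lfloor>2 ^ n * y\<rfloor> = i \<longleftrightarrow> y \<in> {i / 2 ^ n..<(i + 1) / 2 ^ n}" for y :: real and i :: int
    unfolding floor_eq_iff by (auto simp: field_simps)
  show ?thesis
    unfolding dyad_def by (auto simp: * prod_eq_iff)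
qed

lemma floor_div_2: "\<lfloor>2 * y\<rfloor> div 2 = \<lfloor>y :: real\<rfloor>"
proof -
  have "real_of_int \<lfloor>y\<rfloor> \<le> y" "y < \<lfloor>y\<rfloor> + 1" by linarith+
  then have "2 * \<lfloor>y\<rfloor> \<le> \<lfloor>2 * y\<rfloor>" "\<lfloor>2 * y\<rfloor> < 2 * \<lfloor>y\<rfloor> + 2" by linarith+
  then show ?thesis by linarith
qed

lemma dyad_Suc: "dyad (Suc n) y = dyad (Suc n) x \<Longrightarrow> dyad n y = dyad n x"
proof -
  have "dyad n x = (fst (dyad (Suc n) x) div 2, snd (dyad (Suc n) x) div 2)" for x
    by (simp add: dyad_def floor_div_2 mult.assoc)
  then show "dyad (Suc n) y = dyad (Suc n) x \<Longrightarrow> dyad n y = dyad n x" by simp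
qed

lemma dyad_dist: "dyad n y = dyad n x \<Longrightarrow> dist y x \<le> 2 / 2 ^ n"
proof -
  assume a: "dyad n y = dyad n x"
  have *: "\<bar>s - t\<bar> \<le> 1 / 2 ^ n" if "\<lfloor>2 ^ n * s\<rfloor> = \<lfloor>2 ^ n * t\<rfloor>" for s t :: real
  proof -
    have "\<bar>2 ^ n * s - 2 ^ n * t\<bar> < 1" using that by linarith
    then have "2 ^ n * \<bar>s - t\<bar> < 1" by (simp add: abs_mult flip: right_diff_distrib)
    then show ?thesis by (simp add: field_simps)
  qed
  have "dist y x \<le> \<bar>fst y - fst x\<bar> + \<bar>snd y - snd x\<bar>"
    using sqrt_sum_squares_le_sum_abs[of "fst y - fst x" "snd y - snd x"] by (simp add: dist_prod_def dist_real_def)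
  also have "\<dots> \<le> 2 / 2 ^ n" using *[of "fst y" "fst x"] *[of "snd y" "snd x"] a by (simp add: dyad_def)
  finally show ?thesis .
qed

text \<open>An inner approximation of U by dyadic squares of side \<open>1 / 2 ^ n\<close>. For open
  U it grows to U, and for bounded U it is a finite union of boxes.\<close>

definition dyad_inner :: "(real \<times> real) set \<Rightarrow> nat \<Rightarrow> (real \<times> real) set" where
  "dyad_inner U n = {x. \<forall>y. dyad n y = dyad n x \<longrightarrow> y \<in> U}"

lemma dyad_inner_incseq: "incseq (dyad_inner U)"
  by (rule incseq_SucI) (auto simp: dyad_inner_def dest: dyad_Suc)

lemma dyad_inner_Union:
  assumes "open U" shows "(\<Union>n. dyad_inner U n) = U"
proof
  show "(\<Union>n. dyad_inner U n) \<subseteq> U" by (auto simp: dyad_inner_def)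
  show "U \<subseteq> (\<Union>n. dyad_inner U n)"
  proof
    fix x assume "x \<in> U"
    then obtain e where e: "e > 0" "\<And>y. dist y x < e \<Longrightarrow> y \<in> U" using assms unfolding open_dist by blast
    obtain n where "(1 / 2 :: real) ^ n < e / 2" using e real_arch_pow_inv[of "e/2" "1/2"] by auto
    then have "2 / 2 ^ n < e" by (simp add: power_one_over field_simps)
    then have "x \<in> dyad_inner U n" unfolding dyad_inner_def using e dyad_dist[of n _ x] by force
    then show "x \<in> (\<Union>n. dyad_inner U n)" by blast
  qed
qed

definition cells_in :: "(real \<times> real) set \<Rightarrow> nat \<Rightarrow> (int \<times> int) set" where
  "cells_in U n = {z. {x. dyad n x = z} \<subseteq> U}"

lemma dyad_inner_cells: "dyad_inner U n = (\<Union>z\<in>cells_in U n. {x. dyad n x = z})"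
  by (auto simp: dyad_inner_def cells_in_def)

lemma cells_in_bounds:
  assumes "U \<subseteq> {0<..<1} \<times> {0<..<real_of_int q}" "z \<in> cells_in U n"
  shows "0 \<le> fst z" "fst z + 1 \<le> 2 ^ n" "0 \<le> snd z" "snd z + 1 \<le> q * 2 ^ n"
proof -
  have "(real_of_int (fst z) / 2 ^ n, real_of_int (snd z) / 2 ^ n) \<in> {x. dyad n x = z}" by (simp add: dyad_def)
  then have "(real_of_int (fst z) / 2 ^ n, real_of_int (snd z) / 2 ^ n) \<in> {0<..<1} \<times> {0<..<real_of_int q}"
    using assms unfolding cells_in_def by blast
  then have "0 < fst z" "real_of_int (fst z) < real_of_int (2 ^ n)" "0 < snd z" "real_of_int (snd z) < real_of_int (q * 2 ^ n)"
    by (auto simp: zero_less_divide_iff pos_divide_less_eq)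
  then have "0 < fst z" "fst z < 2 ^ n" "0 < snd z" "snd z < q * 2 ^ n"
    unfolding of_int_less_iff by simp_all
  then show "0 \<le> fst z" "fst z + 1 \<le> 2 ^ n" "0 \<le> snd z" "snd z + 1 \<le> q * 2 ^ n" by linarith+
qed

lemma finite_cells_in:
  assumes "U \<subseteq> {0<..<1} \<times> {0<..<real_of_int q}" shows "finite (cells_in U n)"
proof (rule finite_subset)
  show "cells_in U n \<subseteq> {0..2 ^ n} \<times> {0..q * 2 ^ n}"
    using cells_in_bounds[OF assms, of _ n] by (fastforce simp: mem_Times_iff)
qed simp

lemma measure_dyad_cell: "measure lborel {x. dyad n x = z} = (1 / 2 ^ n) * (1 / 2 ^ n)"
  unfolding dyad_cell
  by (subst measure_def, subst emeasure_lborel_half_open_Times) (auto simp: divide_right_mono diff_divide_distrib[symmetric])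

lemma sets_dyad_cell: "{x. dyad n x = z} \<in> sets borel"
  unfolding dyad_cell by (rule half_open_Times_sets)

context level begin

context
  fixes c c' :: "int \<times> int"
  assumes unimod: "q dvd crs c' c - 1"
begin

definition hits :: "(real \<times> real) set \<Rightarrow> real \<Rightarrow> ((int \<times> int) \<times> (int \<times> int)) set" where
  "hits A Y = {(v, w) \<in> Pr c c' 0 q Y. (nsq v / Y, dotp w v / nsq v) \<in> A}"

lemma finite_hits: "finite (hits A Y)"
  by (rule finite_subset[OF _ finite_Pr[of c c' 0 q Y]]) (auto simp: hits_def)

text \<open>For Y > 0 the hits of such a box form the difference of the sets \<open>Pr\<close> at
  the radii \<open>h2 * Y\<close> and \<open>h1 * Y\<close>, and both have known
  asymptotics.\<close>

lemma hits_box: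
  fixes a b h1 h2 :: real
  assumes h: "0 \<le> h1" "h1 \<le> h2" "h2 \<le> 1" and ab: "0 \<le> a" "a \<le> b" "b \<le> q"
  shows "lbd (\<lambda>Y. real (card (hits ({h1..<h2} \<times> {a..<b}) Y))) (kap / q * ((h2 - h1) * (b - a)))"
proof (rule lbd_tendsto)
  have *: "((\<lambda>Y. real (card (Pr c c' a b (h * Y))) / Y) \<longlongrightarrow> kap / q * (b - a) * h) at_top" if "h \<ge> 0" for h :: real
  proof (cases "h = 0")
    case True
    have "Pr c c' a b 0 = {}"
    proof -
      have "\<not> rsq v < 0" for v using nsq_nonneg[of v] by linarith
      then show ?thesis by (simp add: Pr_def)
    qed
    then show ?thesis using True by simp
  next
    case False
    then have h: "h > 0" using that by simp
    have "filterlim (\<lambda>Y. h * Y) at_top at_top"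
      by (rule filterlim_tendsto_pos_mult_at_top[OF tendsto_const h filterlim_ident])
    from filterlim_compose[OF cnt_tendsto[OF unimod ab] this]
    have "((\<lambda>Y. real (card (Pr c c' a b (h * Y))) / (h * Y) * h) \<longlongrightarrow> kap / q * (b - a) * h) at_top"
      by (intro tendsto_mult tendsto_const)
    then show ?thesis using h by simp
  qed
  have "((\<lambda>Y. real (card (Pr c c' a b (h2 * Y))) / Y - real (card (Pr c c' a b (h1 * Y))) / Y)
      \<longlongrightarrow> kap / q * (b - a) * h2 - kap / q * (b - a) * h1) at_top"
    using h by (intro tendsto_diff *) auto
  moreover have "\<forall>\<^sub>F Y in at_top. real (card (Pr c c' a b (h2 * Y))) / Y - real (card (Pr c c' a b (h1 * Y))) / Y
      = real (card (hits ({h1..<h2} \<times> {a..<b}) Y)) / Y"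
    using eventually_gt_at_top[of 0]
  proof eventually_elim
    case (elim Y)
    have "h1 * Y \<le> h2 * Y" using h elim by (intro mult_right_mono) auto
    have "hits ({h1..<h2} \<times> {a..<b}) Y = Pr c c' a b (h2 * Y) - Pr c c' a b (h1 * Y)" (is "?L = ?R")
    proof -
      have "(v, w) \<in> ?L \<longleftrightarrow> (v, w) \<in> ?R" for v w
      proof (cases "crs w v = 1")
        case True
        then have n: "rsq v > 0" using nsq_pos[OF crs_1_nz(2)[OF True]] by linarith
        have 1: "h2 * Y \<le> 1 * Y" using h elim by (intro mult_right_mono) auto
        have 2: "0 \<le> a * rsq v" using n ab by simp
        have 3: "b * rsq v \<le> q * rsq v"
          using n ab by (intro mult_right_mono) auto
        have "rsq v < h2 * Y \<Longrightarrow> rsq v < Y" using 1 by linarith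
        moreover have "real_of_int (dotp w v) < b * rsq v \<Longrightarrow> real_of_int (dotp w v) < q * rsq v"
          using 3 by linarith
        moreover have "a * rsq v \<le> real_of_int (dotp w v) \<Longrightarrow> 0 \<le> real_of_int (dotp w v)"
          using 2 by linarith
        ultimately show ?thesis using n elim
          by (auto simp: hits_def Pr_def pos_le_divide_eq pos_divide_less_eq not_less simp del: of_int_mult)
      qed (auto simp: hits_def Pr_def)
      then show ?thesis by auto
    qed
    moreover have "Pr c c' a b (h1 * Y) \<subseteq> Pr c c' a b (h2 * Y)"
      using \<open>h1 * Y \<le> h2 * Y\<close> by (auto simp: Pr_def)
    ultimately have "card (hits ({h1..<h2} \<times> {a..<b}) Y) = card (Pr c c' a b (h2 * Y)) - card (Pr c c' a b (h1 * Y))"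
      "card (Pr c c' a b (h1 * Y)) \<le> card (Pr c c' a b (h2 * Y))"
      by (simp_all add: card_Diff_subset finite_Pr card_mono)
    then show ?case by (simp add: of_nat_diff diff_divide_distrib)
  qed
  ultimately have "((\<lambda>Y. real (card (hits ({h1..<h2} \<times> {a..<b}) Y)) / Y) \<longlongrightarrow> kap / q * (b - a) * h2 - kap / q * (b - a) * h1) at_top"
    by (rule Lim_transform_eventually)
  moreover have "x * (b - a) * h2 - x * (b - a) * h1 = x * ((h2 - h1) * (b - a))" for x :: real
    by (simp add: algebra_simps)
  ultimately show "((\<lambda>Y. real (card (hits ({h1..<h2} \<times> {a..<b}) Y)) / Y) \<longlongrightarrow> kap / q * ((h2 - h1) * (b - a))) at_top"
    by metis
qed

lemma lbd_hits_inner: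
  assumes "U \<subseteq> {0<..<1} \<times> {0<..<real_of_int q}"
  shows "lbd (\<lambda>Y. real (card (hits (dyad_inner U n) Y))) (kap / q * measure lborel (dyad_inner U n))"
proof -
  note fin = finite_cells_in[OF assms, of n]
  have "lbd (\<lambda>Y. \<Sum>z\<in>cells_in U n. real (card (hits {x. dyad n x = z} Y))) (\<Sum>z\<in>cells_in U n. kap / q * ((1 / 2 ^ n) * (1 / 2 ^ n)))"
  proof (intro lbd_sum fin)
    fix z assume z: "z \<in> cells_in U n"
    note b = cells_in_bounds[OF assms z]
    have "real_of_int (fst z + 1) \<le> 2 ^ n" "real_of_int (snd z + 1) \<le> q * 2 ^ n"
      using b(2,4) by (metis of_int_le_iff of_int_numeral of_int_power of_int_mult)+
    then have "lbd (\<lambda>Y. real (card (hits ({real_of_int (fst z) / 2 ^ n..<(real_of_int (fst z) + 1) / 2 ^ n} \<times> {real_of_int (snd z) / 2 ^ n..<(real_of_int (snd z) + 1) / 2 ^ n}) Y)))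
        (kap / q * (((real_of_int (fst z) + 1) / 2 ^ n - real_of_int (fst z) / 2 ^ n) * ((real_of_int (snd z) + 1) / 2 ^ n - real_of_int (snd z) / 2 ^ n)))"
      using b by (intro hits_box) (auto simp: divide_right_mono divide_le_eq)
    then show "lbd (\<lambda>Y. real (card (hits {x. dyad n x = z} Y))) (kap / q * ((1 / 2 ^ n) * (1 / 2 ^ n)))"
      unfolding dyad_cell by (simp add: diff_divide_distrib[symmetric])
  qed
  moreover have "(\<Sum>z\<in>cells_in U n. real (card (hits {x. dyad n x = z} Y))) = real (card (hits (dyad_inner U n) Y))" for Y
  proof -
    have "hits (dyad_inner U n) Y = (\<Union>z\<in>cells_in U n. hits {x. dyad n x = z} Y)"
      unfolding dyad_inner_cells hits_def by auto
    moreover have "card (\<Union>z\<in>cells_in U n. hits {x. dyad n x = z} Y) = (\<Sum>z\<in>cells_in U n. card (hits {x. dyad n x = z} Y))"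
      by (intro card_UN_disjoint fin) (auto simp: finite_hits, auto simp: hits_def)
    ultimately show ?thesis by simp
  qed
  moreover have "measure lborel (dyad_inner U n) = (\<Sum>z\<in>cells_in U n. measure lborel {x. dyad n x = z})"
    unfolding dyad_inner_cells
  proof (intro measure_finite_Union fin)
    show "(\<lambda>z. {x. dyad n x = z}) ` cells_in U n \<subseteq> sets lborel" using sets_dyad_cell by auto
    show "disjoint_family_on (\<lambda>z. {x. dyad n x = z}) (cells_in U n)" by (auto simp: disjoint_family_on_def)
    show "emeasure lborel {x. dyad n x = z} \<noteq> \<infinity>" for z
      unfolding dyad_cell by (subst emeasure_lborel_half_open_Times) (auto simp: divide_right_mono)
  qed
  ultimately show ?thesis by (simp add: measure_dyad_cell sum_distrib_left mult.commute)
qed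

text \<open>The area of an open set is the supremum of the areas of its dyadic inner approximations,
  so a lower bound is what survives.\<close>

theorem lbd_hits_open:
  assumes "open U" "U \<subseteq> {0<..<1} \<times> {0<..<real_of_int q}"
  shows "lbd (\<lambda>Y. real (card (hits U Y))) (kap / q * measure lborel U)"
proof -
  have "bounded ({0..1::real} \<times> {0..real_of_int q})"
    by (intro compact_imp_bounded compact_Times compact_Icc)
  moreover have "U \<subseteq> {0..1} \<times> {0..real_of_int q}" using assms(2) by force
  ultimately have "bounded U" by (rule bounded_subset)
  then have fin: "emeasure lborel U \<noteq> \<infinity>" using emeasure_bounded_finite by fastforce
  have "(\<lambda>n. measure lborel (dyad_inner U n)) \<longlonglongrightarrow> measure lborel (\<Union>n. dyad_inner U n)"
  proof (rule Lim_measure_incseq)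
    show "range (dyad_inner U) \<subseteq> sets lborel"
      unfolding dyad_inner_cells using finite_cells_in[OF assms(2)] sets_dyad_cell by (auto intro!: sets.finite_UN)
  qed (use fin in \<open>simp_all add: dyad_inner_incseq dyad_inner_Union[OF assms(1)]\<close>)
  then have "(\<lambda>n. kap / q * measure lborel (dyad_inner U n)) \<longlonglongrightarrow> kap / q * measure lborel U"
    unfolding dyad_inner_Union[OF assms(1)] by (intro tendsto_mult tendsto_const)
  moreover have "lbd (\<lambda>Y. real (card (hits U Y))) (kap / q * measure lborel (dyad_inner U n))" for n
  proof (rule lbd_mono[OF lbd_hits_inner[OF assms(2)] order_refl])
    have "card (hits (dyad_inner U n) Y) \<le> card (hits U Y)" for Y
      by (intro card_mono finite_hits) (auto simp: hits_def dyad_inner_def)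
    then show "\<forall>\<^sub>F Y in at_top. real (card (hits (dyad_inner U n) Y)) \<le> real (card (hits U Y))" by simp
  qed
  ultimately show ?thesis by (rule lbd_limit[rotated])
qed

end
end

section \<open>The limiting gap condition\<close>

text \<open>
  The triple \<open>(i, j, k)\<close> stands for the vector \<open>u = i v + j w\<close> with multiplier \<open>k\<close>, and the point for
  \<open>(h, \<rho>) = (|v|\<^sup>2 / Y, w \<cdot> v / |v|\<^sup>2)\<close>. With \<open>e = 1 / Y\<^sup>2\<close> the second inequality says
  \<open>k\<^sup>2 |u|\<^sup>2 < Y\<close>, since \<open>|u|\<^sup>2 |v|\<^sup>2 = (u \<cdot> v)\<^sup>2 + j\<^sup>2\<close>; the limit corresponds to \<open>e = 0\<close>.
\<close>

definition strict_cond :: "real \<Rightarrow> real \<Rightarrow> int \<times> int \<times> int \<Rightarrow> real \<times> real \<Rightarrow> bool" where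
  "strict_cond t e \<tau> x \<longleftrightarrow> (case \<tau> of (i, j, k) \<Rightarrow>
     real_of_int j < t * (fst x * (real_of_int i + real_of_int j * snd x)) \<and>
     (real_of_int k)\<^sup>2 * ((fst x * (real_of_int i + real_of_int j * snd x))\<^sup>2 + e * (real_of_int j)\<^sup>2) < fst x)"

text \<open>The closed counterpart of \<open>strict_cond t 0\<close>. Its negation is open, so
  isolated positions can be approximated from inside as well.\<close>

definition weak_cond :: "real \<Rightarrow> int \<times> int \<times> int \<Rightarrow> real \<times> real \<Rightarrow> bool" where
  "weak_cond t \<tau> x \<longleftrightarrow> (case \<tau> of (i, j, k) \<Rightarrow>
     real_of_int j \<le> t * (fst x * (real_of_int i + real_of_int j * snd x)) \<and>
     (real_of_int k)\<^sup>2 * (fst x * (real_of_int i + real_of_int j * snd x))\<^sup>2 \<le> fst x)"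

text \<open>Since \<open>j >= 1\<close>, the first inequality forces the projection
  \<open>h (i + j \<rho>)\<close> to be positive, which makes it monotone in t.\<close>

lemma strict_cond_mono:
  assumes "strict_cond t e (i, j, k) x" "0 \<le> t" "t \<le> t'" "0 \<le> e'" "e' \<le> e" "j \<ge> 1"
  shows "strict_cond t' e' (i, j, k) x"
proof -
  let ?s = "fst x * (real_of_int i + real_of_int j * snd x)"
  have a: "real_of_int j < t * ?s" "(real_of_int k)\<^sup>2 * (?s\<^sup>2 + e * (real_of_int j)\<^sup>2) < fst x"
    using assms(1) by (auto simp: strict_cond_def)
  have "t * ?s > 0" using a assms by linarith
  then have "?s > 0" using assms(2) by (simp add: zero_less_mult_iff)
  then have "t * ?s \<le> t' * ?s" using assms by (intro mult_right_mono) auto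
  moreover have "(real_of_int k)\<^sup>2 * (?s\<^sup>2 + e' * (real_of_int j)\<^sup>2) \<le> (real_of_int k)\<^sup>2 * (?s\<^sup>2 + e * (real_of_int j)\<^sup>2)"
    using assms by (intro mult_left_mono add_left_mono mult_right_mono) auto
  ultimately show ?thesis using a by (simp add: strict_cond_def)
qed

lemma strict_imp_weak:
  assumes "strict_cond t e (i, j, k) x" "0 \<le> t" "t \<le> t'" "0 \<le> e" "j \<ge> 1"
  shows "weak_cond t' (i, j, k) x"
  using strict_cond_mono[OF assms(1-3), of 0] assms by (simp add: strict_cond_def weak_cond_def)

lemma open_strict: "open {x. strict_cond t e \<tau> x}"
  by (cases \<tau>) (auto simp: strict_cond_def intro!: open_Collect_conj open_Collect_less continuous_intros)

lemma open_not_weak: "open {x. \<not> weak_cond t \<tau> x}"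
  by (cases \<tau>) (auto simp: weak_cond_def not_le intro!: open_Collect_disj open_Collect_less continuous_intros
     simp del: disj_not1 simp: de_Morgan_conj)

text \<open>Put \<open>s = i + j \<rho>\<close>. The second inequality with \<open>h < 1\<close>
  gives \<open>k h s <= 1\<close>, then the first gives \<open>k j <= B\<close>, and
  \<open>0 < s <= 1 / \<delta>\<close> confines i. So only finitely many triples matter away from
  \<open>h = 0\<close>.\<close>

lemma weak_cond_finite:
  assumes "weak_cond t (i, j, k) x" "\<delta> < fst x" "fst x < 1" "\<delta> > 0" "0 \<le> snd x" "snd x \<le> b" "0 \<le> t" "t \<le> B" "j \<ge> 1" "k \<ge> 1"
  shows "i \<in> {- \<lceil>B * b\<rceil>..\<lceil>1 / \<delta>\<rceil>}" "j \<in> {1..\<lceil>B\<rceil>}" "k \<in> {1..\<lceil>B\<rceil>}"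
proof -
  define s where "s = real_of_int i + real_of_int j * snd x"
  define h where "h = fst x"
  have h: "0 < h" "h < 1" "\<delta> < h" using assms by (auto simp: h_def)
  have 1: "real_of_int j \<le> t * (h * s)" and 2: "(real_of_int k)\<^sup>2 * (h * s)\<^sup>2 \<le> h"
    using assms(1) by (auto simp: weak_cond_def h_def s_def)
  have "t * (h * s) > 0" using 1 assms by linarith
  then have hs: "h * s > 0" using assms(7) by (simp add: zero_less_mult_iff)
  then have s: "s > 0" using h by (simp add: zero_less_mult_iff)
  have B: "B \<ge> 0" using assms by simp
  have khs: "(real_of_int k * (h * s))\<^sup>2 \<le> 1" using 2 h by (simp add: power_mult_distrib)
  then have khs: "real_of_int k * (h * s) \<le> 1" unfolding abs_square_le_1 by linarith
  have "1 * (h * s) \<le> real_of_int k * (h * s)" using hs assms by (intro mult_right_mono) auto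
  then have hs1: "h * s \<le> 1" using khs by linarith
  have "t * (h * s) \<le> B * 1" using assms hs1 hs B by (intro mult_mono) auto
  then have jB: "real_of_int j \<le> B" using 1 by simp
  then show "j \<in> {1..\<lceil>B\<rceil>}" using assms by (simp add: le_ceiling_iff)
  have "real_of_int k * real_of_int j \<le> real_of_int k * (t * (h * s))" using 1 assms by (intro mult_left_mono) auto
  also have "\<dots> = t * (real_of_int k * (h * s))" by simp
  also have "\<dots> \<le> B * 1" using assms khs hs B by (intro mult_mono) auto
  finally have "real_of_int k * real_of_int j \<le> B" by simp
  moreover have "real_of_int k * 1 \<le> real_of_int k * real_of_int j" using assms by (intro mult_left_mono) auto
  ultimately have "real_of_int k \<le> B" by linarith
  then show "k \<in> {1..\<lceil>B\<rceil>}" using assms by (simp add: le_ceiling_iff)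
  have "real_of_int j * snd x \<ge> 0" "real_of_int j * snd x \<le> B * b"
    using assms jB by (auto intro!: mult_mono)
  moreover have "s \<le> 1 / \<delta>"
  proof -
    have "\<delta> * s \<le> h * s" using h s by (intro mult_right_mono) auto
    then show ?thesis using hs1 assms(4) by (simp add: field_simps)
  qed
  ultimately have "real_of_int i \<le> 1 / \<delta>" "real_of_int i \<ge> - (B * b)" using s unfolding s_def by linarith+
  then show "i \<in> {- \<lceil>B * b\<rceil>..\<lceil>1 / \<delta>\<rceil>}" by simp linarith
qed

text \<open>By Fubini. It is meant for the boundary curve of each condition, which meets every line
  of constant h in at most two points.\<close>

lemma null_sets_countable_slices:
  assumes "A \<in> sets (borel :: (real \<times> real) measure)" "\<And>h. countable (Pair h -` A)"
  shows "A \<in> null_sets lborel"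
proof -
  have A: "A \<in> sets (lborel \<Otimes>\<^sub>M lborel)" using assms(1) by (subst lborel_prod) simp
  have "emeasure (lborel \<Otimes>\<^sub>M lborel) A = (\<integral>\<^sup>+h. emeasure lborel (Pair h -` A) \<partial>lborel)"
    by (rule lborel.emeasure_pair_measure_alt[OF A])
  also have "\<dots> = 0" using assms(2) by (simp add: emeasure_lborel_countable)
  finally show ?thesis using assms(1) by (simp add: lborel_prod null_sets_def)
qed

section \<open>The open regions of close and of isolated positions\<close>

locale region =
  fixes T :: "(int \<times> int \<times> int) set" and a b :: real
  assumes T: "\<And>i j k. (i, j, k) \<in> T \<Longrightarrow> j \<ge> 1 \<and> k \<ge> 1"
    and ab: "0 < a" "a \<le> 1" "0 < b"
begin

definition Om :: "(real \<times> real) set" where "Om = {0<..<a} \<times> {0<..<b}"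

text \<open>\<open>W t 0\<close> collects the limit positions of vectors with a neighbour within
  slope \<open>t / Y\<close>; positive e stands for finite Y. \<open>Out\<close> is its counterpart
  for isolated vectors, and the two fill \<open>Om\<close> up to a null set.\<close>

definition W :: "real \<Rightarrow> real \<Rightarrow> (real \<times> real) set" where
  "W t e = {x \<in> Om. \<exists>\<tau>\<in>T. strict_cond t e \<tau> x}"

definition Out :: "real \<Rightarrow> (real \<times> real) set" where
  "Out t = {x \<in> Om. \<forall>\<tau>\<in>T. \<not> weak_cond t \<tau> x}"

definition D :: "real \<Rightarrow> real" where "D t = measure lborel (W t 0)"

lemma open_Om: "open Om" unfolding Om_def by (intro open_Times) auto

lemma Om_bounds: "x \<in> Om \<Longrightarrow> 0 < fst x \<and> fst x < a \<and> fst x < 1 \<and> 0 < snd x \<and> snd x < b"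
  using ab by (auto simp: Om_def)

lemma open_W: "open (W t e)"
proof -
  have "W t e = Om \<inter> (\<Union>\<tau>\<in>T. {x. strict_cond t e \<tau> x})" by (auto simp: W_def)
  then show ?thesis by (simp only:) (intro open_Int open_Om open_UN ballI open_strict)
qed

definition box :: "real \<Rightarrow> real \<Rightarrow> (int \<times> int \<times> int) set" where
  "box \<delta> B = T \<inter> ({- \<lceil>B * b\<rceil>..\<lceil>1 / \<delta>\<rceil>} \<times> {1..\<lceil>B\<rceil>} \<times> {1..\<lceil>B\<rceil>})"

lemma finite_box: "finite (box \<delta> B)" by (simp add: box_def)

lemma weak_in_box:
  assumes "weak_cond t \<tau> x" "\<tau> \<in> T" "x \<in> Om" "\<delta> < fst x" "\<delta> > 0" "0 \<le> t" "t \<le> B"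
  shows "\<tau> \<in> box \<delta> B"
proof -
  obtain i j k where \<tau>: "\<tau> = (i, j, k)" by (cases \<tau>)
  show ?thesis
    using weak_cond_finite[of t i j k x \<delta> b B] assms T[of i j k] Om_bounds[OF assms(3)]
    by (auto simp: \<tau> box_def)
qed

text \<open>The infinite intersection over T is open because for \<open>h > 1 / (m + 1)\<close> only
  the finitely many triples in \<open>box\<close> can satisfy \<open>weak_cond\<close>.\<close>

lemma open_Out:
  assumes "0 \<le> t" shows "open (Out t)"
proof -
  have "Out t = (\<Union>m::nat. (Om \<inter> {x. 1 / (real m + 1) < fst x}) \<inter> (\<Inter>\<tau>\<in>box (1 / (real m + 1)) t. {x. \<not> weak_cond t \<tau> x}))" (is "_ = ?R")
  proof (intro set_eqI iffI)
    fix x assume x: "x \<in> Out t"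
    then have "0 < fst x" using Om_bounds by (auto simp: Out_def)
    then obtain m where "1 / real (Suc m) < fst x" using nat_approx_posE by blast
    then have "1 / (real m + 1) < fst x" by (simp add: add.commute)
    then show "x \<in> ?R" using x by (intro UN_I[of m]) (auto simp: Out_def box_def)
  next
    fix x assume "x \<in> ?R"
    then obtain m :: nat where m: "x \<in> Om" "1 / (real m + 1) < fst x"
      "\<forall>\<tau>\<in>box (1 / (real m + 1)) t. \<not> weak_cond t \<tau> x" by auto
    then show "x \<in> Out t"
      using weak_in_box[OF _ _ m(1,2) _ assms order_refl] by (auto simp: Out_def)
  qed
  moreover have "open ?R"
    by (intro open_UN ballI open_Int open_Om open_INT finite_box open_not_weak open_Collect_less continuous_intros)
  ultimately show ?thesis by simp
qed

lemma emeasure_Om: "emeasure lborel Om = ennreal (a * b)"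
proof -
  have "emeasure lborel Om = emeasure (lborel \<Otimes>\<^sub>M lborel) ({0<..<a} \<times> {0<..<b})"
    by (simp add: lborel_prod Om_def)
  also have "\<dots> = emeasure lborel {0<..<a} * emeasure lborel {0<..<b}"
    by (intro lborel.emeasure_pair_measure_Times) auto
  also have "\<dots> = ennreal (a * b)" using ab by (simp add: ennreal_mult)
  finally show ?thesis .
qed

lemma measure_Om: "measure lborel Om = a * b"
  using emeasure_Om ab by (simp add: measure_def)

lemma fmeas: "A \<subseteq> Om \<Longrightarrow> open A \<Longrightarrow> A \<in> fmeasurable lborel"
  using emeasure_mono[of A Om lborel] open_Om emeasure_Om
  by (intro fmeasurableI) (auto simp: top.not_eq_extremum le_less_trans[OF _ ennreal_less_top])

lemma Lim_measure_open:
  assumes "incseq A" "\<And>n. open (A n)" "\<And>n. A n \<subseteq> Om"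
  shows "(\<lambda>n. measure lborel (A n)) \<longlonglongrightarrow> measure lborel (\<Union>n::nat. A n)"
proof (rule Lim_measure_incseq[OF _ assms(1)])
  have "(\<Union>n. A n) \<in> fmeasurable lborel" using assms by (intro fmeas) auto
  then show "emeasure lborel (\<Union>n. A n) \<noteq> \<infinity>" by (auto dest: fmeasurableD2)
qed (use assms in auto)

lemma W_mono: "0 \<le> t \<Longrightarrow> t \<le> t' \<Longrightarrow> 0 \<le> e' \<Longrightarrow> e' \<le> e \<Longrightarrow> W t e \<subseteq> W t' e'"
  unfolding W_def using strict_cond_mono T by fast

text \<open>Increases to t, strictly below t for t > 0 and constantly 0 for t = 0; the
  multiplicative form keeps it nonnegative.\<close>

definition lt :: "real \<Rightarrow> nat \<Rightarrow> real" where "lt t n = t * (1 - 1 / real (Suc n))"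

lemma lt_bounds: "0 \<le> t \<Longrightarrow> 0 \<le> lt t n \<and> lt t n \<le> t"
  by (simp add: lt_def mult_left_le)

lemma lt_mono: "0 \<le> t \<Longrightarrow> m \<le> n \<Longrightarrow> lt t m \<le> lt t n"
  unfolding lt_def by (intro mult_left_mono diff_left_mono divide_left_mono) auto

lemma lt_lim: "(\<lambda>n. lt t n) \<longlonglongrightarrow> t"
proof -
  have "(\<lambda>n. t * (1 - 1 / real (Suc n))) \<longlonglongrightarrow> t * (1 - 0)"
    by (intro tendsto_intros LIMSEQ_Suc[OF lim_const_over_n])
  then show ?thesis by (simp add: lt_def[abs_def])
qed

lemma inv_Suc_lim: "(\<lambda>n. 1 / real (Suc n)) \<longlonglongrightarrow> 0"
  by (intro LIMSEQ_Suc[OF lim_const_over_n])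

text \<open>Strict inequalities survive a small decrease of t and a small increase of e, so these
  sets exhaust \<open>W t 0\<close>.\<close>

lemma W_lim:
  assumes "0 \<le> t"
  shows "(\<lambda>n. measure lborel (W (lt t n) (1 / real (Suc n)))) \<longlonglongrightarrow> D t"
proof -
  have "incseq (\<lambda>n. W (lt t n) (1 / real (Suc n)))"
    unfolding incseq_def using lt_mono[OF assms] lt_bounds[OF assms]
    by (intro allI impI W_mono) (auto simp: field_simps)
  from Lim_measure_open[OF this open_W]
  have "(\<lambda>n. measure lborel (W (lt t n) (1 / real (Suc n)))) \<longlonglongrightarrow> measure lborel (\<Union>n. W (lt t n) (1 / real (Suc n)))"
    by (auto simp: W_def)
  also have "(\<Union>n. W (lt t n) (1 / real (Suc n))) = W t 0"
  proof
    show "(\<Union>n. W (lt t n) (1 / real (Suc n))) \<subseteq> W t 0"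
      using lt_bounds[OF assms] by (intro UN_least W_mono) auto
    show "W t 0 \<subseteq> (\<Union>n. W (lt t n) (1 / real (Suc n)))"
    proof
      fix x assume "x \<in> W t 0"
      then obtain i j k where x: "x \<in> Om" "(i, j, k) \<in> T" "strict_cond t 0 (i, j, k) x" by (auto simp: W_def)
      let ?s = "fst x * (real_of_int i + real_of_int j * snd x)"
      have 1: "(\<lambda>n. lt t n * ?s) \<longlonglongrightarrow> t * ?s" by (intro tendsto_intros lt_lim)
      have 2: "(\<lambda>n. (real_of_int k)\<^sup>2 * (?s\<^sup>2 + 1 / real (Suc n) * (real_of_int j)\<^sup>2)) \<longlonglongrightarrow> (real_of_int k)\<^sup>2 * (?s\<^sup>2 + 0 * (real_of_int j)\<^sup>2)"
        by (intro tendsto_intros inv_Suc_lim)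
      have "\<forall>\<^sub>F n in sequentially. strict_cond (lt t n) (1 / real (Suc n)) (i, j, k) x"
        using order_tendstoD(1)[OF 1, of "real_of_int j"] order_tendstoD(2)[OF 2, of "fst x"] x(3)
        unfolding strict_cond_def by (auto elim: eventually_elim2)
      then obtain n where "strict_cond (lt t n) (1 / real (Suc n)) (i, j, k) x"
        unfolding eventually_sequentially by blast
      then show "x \<in> (\<Union>n. W (lt t n) (1 / real (Suc n)))" using x by (auto simp: W_def)
    qed
  qed
  finally show ?thesis by (simp add: D_def)
qed

text \<open>A point of \<open>Om\<close> outside both sets satisfies the weak condition of some
  triple with equality in one of its two inequalities, hence lies on one of countably many
  curves.\<close>

lemma measure_Out:
  assumes "0 \<le> t" shows "measure lborel (Out t) = a * b - D t"
proof -
  define N where "N = Om - Out t - W t 0"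
  have sub: "Out t \<subseteq> Om" "W t 0 \<subseteq> Om" "Out t \<inter> W t 0 = {}"
    using strict_imp_weak[OF _ assms order_refl order_refl] T by (auto simp: Out_def W_def)
  have Nb: "N \<in> sets borel" unfolding N_def using open_Om open_Out[OF assms] open_W by auto
  have "N \<in> null_sets lborel"
  proof -
    \<comment> \<open>\<open>E1\<close> and \<open>E2\<close> are the curves of equality in the
      first and the second inequality. For fixed h they leave at most one and two values of
      \<rho>.\<close>
    define E1 where "E1 \<tau> = {x::real \<times> real. case \<tau> of (i::int, j::int, k::int) \<Rightarrow> real_of_int j = t * (fst x * (real_of_int i + real_of_int j * snd x))}" for \<tau>
    define E2 where "E2 \<tau> = Om \<inter> {x::real \<times> real. case \<tau> of (i::int, j::int, k::int) \<Rightarrow> (real_of_int k)\<^sup>2 * (fst x * (real_of_int i + real_of_int j * snd x))\<^sup>2 = fst x}" for \<tau>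
    have "N \<subseteq> (\<Union>\<tau>\<in>T. E1 \<tau> \<union> E2 \<tau>)"
    proof
      fix x assume "x \<in> N"
      then obtain i j k where x: "x \<in> Om" "(i, j, k) \<in> T" "weak_cond t (i, j, k) x" "\<not> strict_cond t 0 (i, j, k) x"
        by (auto simp: N_def Out_def W_def)
      then have "x \<in> E1 (i, j, k) \<union> E2 (i, j, k)"
        by (auto simp: E1_def E2_def weak_cond_def strict_cond_def)
      then show "x \<in> (\<Union>\<tau>\<in>T. E1 \<tau> \<union> E2 \<tau>)" using x(2) by blast
    qed
    moreover have "E1 \<tau> \<in> null_sets lborel" if "\<tau> \<in> T" for \<tau>
    proof (rule null_sets_countable_slices)
      obtain i j k where \<tau>: "\<tau> = (i, j, k)" by (cases \<tau>)
      have j: "j \<ge> 1" using T that \<tau> by blast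
      show "E1 \<tau> \<in> sets borel" unfolding E1_def \<tau>
        by (auto intro!: borel_closed closed_Collect_eq continuous_intros)
      fix h :: real
      have "Pair h -` E1 \<tau> \<subseteq> {(real_of_int j / (t * h) - i) / j}"
      proof
        fix r assume "r \<in> Pair h -` E1 \<tau>"
        then have e: "real_of_int j = t * (h * (real_of_int i + real_of_int j * r))" by (simp add: E1_def \<tau>)
        then have "t * h \<noteq> 0" using j by (metis mult.assoc mult_zero_left of_int_0_eq_iff not_one_le_zero)
        then have "real_of_int j / (t * h) = real_of_int i + real_of_int j * r"
          using e by (simp add: field_simps)
        then show "r \<in> {(real_of_int j / (t * h) - i) / j}" using j by simp
      qed
      then show "countable (Pair h -` E1 \<tau>)" by (rule countable_subset) simp
    qed
    moreover have "E2 \<tau> \<in> null_sets lborel" if "\<tau> \<in> T" for \<tau>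
    proof (rule null_sets_countable_slices)
      obtain i j k where \<tau>: "\<tau> = (i, j, k)" by (cases \<tau>)
      have jk: "j \<ge> 1" "k \<ge> 1" using T that \<tau> by blast+
      have "{x::real \<times> real. (real_of_int k)\<^sup>2 * (fst x * (real_of_int i + real_of_int j * snd x))\<^sup>2 = fst x} \<in> sets borel"
        by (auto intro!: borel_closed closed_Collect_eq continuous_intros)
      then show "E2 \<tau> \<in> sets borel" unfolding E2_def \<tau> using open_Om by auto
      fix h :: real
      define d where "d = sqrt (1 / (k\<^sup>2 * h))"
      have "Pair h -` E2 \<tau> \<subseteq> {(d - i) / j, (- d - i) / j}"
      proof
        fix r assume "r \<in> Pair h -` E2 \<tau>"
        then have e: "(real_of_int k)\<^sup>2 * (h * (real_of_int i + real_of_int j * r))\<^sup>2 = h" and "(h, r) \<in> Om"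
          by (auto simp: E2_def \<tau>)
        then have h: "h > 0" using Om_bounds by auto
        have "(real_of_int i + real_of_int j * r)\<^sup>2 = 1 / ((real_of_int k)\<^sup>2 * h)"
        proof -
          have "h * ((real_of_int i + real_of_int j * r)\<^sup>2 * ((real_of_int k)\<^sup>2 * h)) = h * 1"
            using e by (simp add: power_mult_distrib power2_eq_square mult_ac)
          then have "(real_of_int i + real_of_int j * r)\<^sup>2 * ((real_of_int k)\<^sup>2 * h) = 1"
            using h unfolding mult_cancel_left by simp
          then show ?thesis using h jk by (subst eq_divide_eq) simp
        qed
        also have "\<dots> = d\<^sup>2" using h by (simp add: d_def)
        finally have "real_of_int i + real_of_int j * r = d \<or> real_of_int i + real_of_int j * r = - d"
          by (simp add: power2_eq_iff)
        then show "r \<in> {(d - i) / j, (- d - i) / j}" using jk by (auto simp: field_simps)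
      qed
      then show "countable (Pair h -` E2 \<tau>)" by (rule countable_subset) simp
    qed
    ultimately have "(\<Union>\<tau>\<in>T. E1 \<tau> \<union> E2 \<tau>) \<in> null_sets lborel"
      by (intro null_sets_UN') auto
    then show ?thesis using \<open>N \<subseteq> _\<close> Nb by (auto intro: null_sets_subset)
  qed
  then have "measure lborel N = 0" by (simp add: null_setsD1 measure_def)
  have Om_eq: "Om = (Out t \<union> W t 0) \<union> N" using sub by (auto simp: N_def)
  have f: "Out t \<in> fmeasurable lborel" "W t 0 \<in> fmeasurable lborel" "Om \<in> fmeasurable lborel"
    using sub open_Out[OF assms] open_W open_Om by (auto intro: fmeas)
  then have fN: "N \<in> fmeasurable lborel" unfolding N_def by auto
  have add: "measure lborel (A \<union> B) = measure lborel A + measure lborel B"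
    if "A \<in> fmeasurable lborel" "B \<in> fmeasurable lborel" "A \<inter> B = {}" for A B :: "(real \<times> real) set"
  proof -
    have "B - A = B" using that(3) by blast
    then show ?thesis using measure_Un2[OF that(1,2)] by simp
  qed
  have "measure lborel Om = measure lborel (Out t \<union> W t 0) + measure lborel N"
    unfolding Om_eq using f fN by (intro add) (auto simp: N_def)
  also have "measure lborel (Out t \<union> W t 0) = measure lborel (Out t) + measure lborel (W t 0)"
    using f sub by (intro add) auto
  finally show ?thesis using \<open>measure lborel N = 0\<close> by (simp add: measure_Om D_def)
qed

text \<open>Failure of \<open>weak_cond\<close> persists under a small increase of t, uniformly over
  the triples: for parameters up to \<open>t + 1\<close> only those in the finite set
  \<open>box \<delta> (t + 1)\<close> matter.\<close>

lemma Out_lim: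
  assumes "0 \<le> t"
  shows "(\<lambda>n. measure lborel (Out (t + 1 / real (Suc n)))) \<longlonglongrightarrow> a * b - D t"
proof -
  have pos: "0 \<le> t + 1 / real (Suc n)" for n using assms by simp
  have mono: "Out t' \<subseteq> Out t''" if "0 \<le> t''" "t'' \<le> t'" for t' t''
  proof -
    have "weak_cond t' \<tau> x" if "weak_cond t'' \<tau> x" "\<tau> \<in> T" "x \<in> Om" for \<tau> x
    proof -
      obtain i j k where \<tau>: "\<tau> = (i, j, k)" by (cases \<tau>)
      let ?s = "fst x * (real_of_int i + real_of_int j * snd x)"
      have 1: "real_of_int j \<le> t'' * ?s" using that by (simp add: \<tau> weak_cond_def)
      moreover have "j \<ge> 1" using T that \<tau> by blast
      ultimately have "t'' * ?s > 0" by linarith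
      then have "?s > 0" using \<open>0 \<le> t''\<close> by (simp add: zero_less_mult_iff)
      then have "t'' * ?s \<le> t' * ?s" using \<open>t'' \<le> t'\<close> by (intro mult_right_mono) auto
      then show ?thesis using that(1) by (simp add: \<tau> weak_cond_def)
    qed
    then show ?thesis by (auto simp: Out_def)
  qed
  have "incseq (\<lambda>n. Out (t + 1 / real (Suc n)))"
    unfolding incseq_def using assms by (intro allI impI mono pos) (auto simp: field_simps)
  from Lim_measure_open[OF this open_Out[OF pos]]
  have "(\<lambda>n. measure lborel (Out (t + 1 / real (Suc n)))) \<longlonglongrightarrow> measure lborel (\<Union>n. Out (t + 1 / real (Suc n)))"
    by (auto simp: Out_def)
  also have "(\<Union>n. Out (t + 1 / real (Suc n))) = Out t"
  proof
    show "(\<Union>n. Out (t + 1 / real (Suc n))) \<subseteq> Out t" using assms by (intro UN_least mono) auto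
    show "Out t \<subseteq> (\<Union>n. Out (t + 1 / real (Suc n)))"
    proof
      fix x assume x: "x \<in> Out t"
      then have xOm: "x \<in> Om" by (simp add: Out_def)
      define \<delta> where "\<delta> = fst x / 2"
      have \<delta>: "0 < \<delta>" "\<delta> < fst x" using Om_bounds[OF xOm] by (auto simp: \<delta>_def)
      have "\<forall>\<^sub>F n in sequentially. \<forall>\<tau>\<in>box \<delta> (t + 1). \<not> weak_cond (t + 1 / real (Suc n)) \<tau> x"
      proof (intro eventually_ball_finite finite_box ballI)
        fix \<tau> assume "\<tau> \<in> box \<delta> (t + 1)"
        then have nw: "\<not> weak_cond t \<tau> x" using x by (auto simp: box_def Out_def)
        obtain i j k where \<tau>: "\<tau> = (i, j, k)" by (cases \<tau>)
        let ?s = "fst x * (real_of_int i + real_of_int j * snd x)"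
        have 1: "(\<lambda>n. (t + 1 / real (Suc n)) * ?s) \<longlonglongrightarrow> (t + 0) * ?s" by (intro tendsto_intros inv_Suc_lim)
        show "\<forall>\<^sub>F n in sequentially. \<not> weak_cond (t + 1 / real (Suc n)) \<tau> x"
        proof (cases "real_of_int j \<le> t * ?s")
          case True
          then show ?thesis using nw by (simp add: weak_cond_def \<tau>)
        next
          case False
          then have "(t + 0) * ?s < real_of_int j" by simp
          from order_tendstoD(2)[OF 1 this] show ?thesis
            by eventually_elim (unfold weak_cond_def \<tau> split_conv, linarith)
        qed
      qed
      then obtain n where n: "\<forall>\<tau>\<in>box \<delta> (t + 1). \<not> weak_cond (t + 1 / real (Suc n)) \<tau> x"
        unfolding eventually_sequentially by blast
      have "t + 1 / real (Suc n) \<le> t + 1" by simp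
      then have "\<not> weak_cond (t + 1 / real (Suc n)) \<tau> x" if "\<tau> \<in> T" for \<tau>
        using n weak_in_box[OF _ that xOm \<delta>(2,1) pos[of n], of "t + 1"] by blast
      then have "x \<in> Out (t + 1 / real (Suc n))"
        using xOm unfolding Out_def by blast
      then show "x \<in> (\<Union>n. Out (t + 1 / real (Suc n)))" by blast
    qed
  qed
  finally show ?thesis by (simp add: measure_Out[OF assms])
qed

lemma D_0: "D 0 = 0"
proof -
  have "W 0 0 = {}" using T by (fastforce simp: W_def strict_cond_def)
  then show ?thesis by (simp add: D_def)
qed

lemma D_mono: "0 \<le> s \<Longrightarrow> s \<le> t \<Longrightarrow> D s \<le> D t"
  unfolding D_def using W_mono[of s t 0 0] open_W
  by (intro measure_mono_fmeasurable fmeas) (auto simp: W_def)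

text \<open>By monotonicity of \<open>D\<close>, continuity from the left comes from
  \<open>W_lim\<close>, and continuity from the right from \<open>Out_lim\<close> together with the
  null boundary in \<open>measure_Out\<close>.\<close>

lemma D_continuous: "continuous_on {0..} D"
  unfolding continuous_on_def
proof
  fix t :: real assume "t \<in> {0..}"
  then have t: "0 \<le> t" by simp
  show "(D \<longlongrightarrow> D t) (at t within {0..})"
  proof (rule order_tendstoI)
    fix y assume "y < D t"
    from order_tendstoD(1)[OF W_lim[OF t] this]
    obtain n where n: "y < measure lborel (W (lt t n) (1 / real (Suc n)))"
      by (meson eventually_sequentially order_refl)
    have "W (lt t n) (1 / real (Suc n)) \<subseteq> W (lt t n) 0" using lt_bounds[OF t] by (intro W_mono) auto
    then have "measure lborel (W (lt t n) (1 / real (Suc n))) \<le> D (lt t n)"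
      unfolding D_def using open_W by (intro measure_mono_fmeasurable fmeas) (auto simp: W_def)
    then have y: "y < D s" if "lt t n \<le> s" for s
      using n D_mono[OF _ that] lt_bounds[OF t, of n] by linarith
    show "\<forall>\<^sub>F s in at t within {0..}. y < D s"
    proof (cases "t = 0")
      case True
      then show ?thesis using y by (auto simp: eventually_at_filter lt_def)
    next
      case False
      then have "lt t n < t" using t by (simp add: lt_def)
      then have "\<forall>\<^sub>F s in at t within {0..}. lt t n < s"
        by (intro order_tendstoD(1)[OF tendsto_ident_at])
      then show ?thesis by eventually_elim (use y in auto)
    qed
  next
    fix y assume "D t < y"
    then have "a * b - y < a * b - D t" by simp
    from order_tendstoD(1)[OF Out_lim[OF t] this]
    obtain n where n: "a * b - y < measure lborel (Out (t + 1 / real (Suc n)))"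
      by (meson eventually_sequentially order_refl)
    then have "D (t + 1 / real (Suc n)) < y" using t by (subst (asm) measure_Out) auto
    then have y: "D s < y" if "s \<le> t + 1 / real (Suc n)" "0 \<le> s" for s
      using D_mono[OF that(2,1)] by linarith
    have "\<forall>\<^sub>F s in at t within {0..}. s < t + 1 / real (Suc n)"
      by (intro order_tendstoD(2)[OF tendsto_ident_at]) simp
    moreover have "\<forall>\<^sub>F s in at t within {0..}. s \<in> {0..}" by (simp add: eventually_at_filter)
    ultimately show "\<forall>\<^sub>F s in at t within {0..}. D s < y"
      by eventually_elim (use y in auto)
  qed
qed

end


section \<open>Counting vectors with a large gap\<close>

context level begin

lemma prim_count_scaled:
  assumes "unit_class c" "a > 0"
  shows "((\<lambda>Y. real (card (primset c (a * Y))) / Y) \<longlongrightarrow> kap * a) at_top"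
proof -
  have "filterlim (\<lambda>Y. a * Y) at_top at_top"
    by (rule filterlim_tendsto_pos_mult_at_top[OF tendsto_const assms(2) filterlim_ident])
  from filterlim_compose[OF prim_count[OF assms(1)] this]
  have "((\<lambda>Y. real (card (primset c (a * Y))) / (a * Y) * a) \<longlongrightarrow> kap * a) at_top"
    by (intro tendsto_mult tendsto_const)
  then show ?thesis using assms(2) by simp
qed

definition near :: "(int \<times> int \<times> int) set \<Rightarrow> real \<Rightarrow> real \<Rightarrow> (int \<times> int) \<times> (int \<times> int) \<Rightarrow> bool" where
  "near T t Y = (\<lambda>(v, w). \<exists>\<tau>\<in>T. strict_cond t (1 / Y\<^sup>2) \<tau> (nsq v / Y, dotp w v / nsq v))"

text \<open>Bases with and without a close neighbour contain the hits of \<open>W\<close> and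
  \<open>Out\<close>, whose areas add up to that of \<open>Om\<close>, so \<open>lbd_squeeze\<close>
  applies. The margins \<open>lt t n\<close>, \<open>1 / Suc n\<close> and
  \<open>t + 1 / Suc n\<close> absorb the differences between \<open>tt Y\<close> and t and between
  \<open>1 / Y^2\<close> and 0.\<close>

lemma far_tendsto:
  fixes tt :: "real \<Rightarrow> real"
  assumes unimod: "q dvd crs c' c - 1" and reg: "region T a (real_of_int q)"
    and tt: "(tt \<longlongrightarrow> t) at_top" "\<forall>\<^sub>F Y in at_top. 0 \<le> tt Y" and t: "0 \<le> t"
  shows "((\<lambda>Y. real (card {z \<in> Pr c c' 0 q (a * Y). \<not> near T (tt Y) Y z}) / Y)
      \<longlongrightarrow> kap / q * (a * q - region.D T a (real_of_int q) t)) at_top"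
proof (rule lbd_squeeze)
  interpret region T a "real_of_int q" by (rule reg)
  let ?P = "\<lambda>Y. Pr c c' 0 q (a * Y)"
  let ?F = "\<lambda>Y. {z \<in> ?P Y. \<not> near T (tt Y) Y z}"
  let ?N = "\<lambda>Y. {z \<in> ?P Y. near T (tt Y) Y z}"
  have sub: "Om \<subseteq> {0<..<1} \<times> {0<..<real_of_int q}" using ab by (auto simp: Om_def)
  have kq: "kap / q \<ge> 0" using kap_pos q_pos by simp
  \<comment> \<open>\<open>hits\<close> reaches up to the radius Y; the bound \<open>h < a\<close>
    built into \<open>Om\<close> lowers this to \<open>a * Y\<close>.\<close>
  have inP: "z \<in> ?P Y" if "z \<in> hits c c' A Y" "A \<subseteq> Om" "Y > 0" for z A Y
  proof -
    obtain v w where z: "z = (v, w)" "(v, w) \<in> Pr c c' 0 q Y" "(nsq v / Y, dotp w v / nsq v) \<in> A"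
      using \<open>z \<in> hits c c' A Y\<close> by (auto simp: hits_def[OF unimod])
    then have "nsq v / Y < a" using that(2) by (auto simp: Om_def)
    then show ?thesis using z that(3) by (auto simp: Pr_def pos_divide_less_eq)
  qed
  show "lbd (\<lambda>Y. real (card (?N Y))) (kap / q * D t)"
  proof (rule lbd_limit)
    show "(\<lambda>n. kap / q * measure lborel (W (lt t n) (1 / real (Suc n)))) \<longlonglongrightarrow> kap / q * D t"
      by (intro tendsto_mult tendsto_const W_lim t)
    fix n
    show "lbd (\<lambda>Y. real (card (?N Y))) (kap / q * measure lborel (W (lt t n) (1 / real (Suc n))))"
    proof (rule lbd_mono[OF lbd_hits_open[OF unimod open_W] order_refl])
      show "W (lt t n) (1 / real (Suc n)) \<subseteq> {0<..<1} \<times> {0<..<real_of_int q}" using sub by (auto simp: W_def)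
      have e1: "\<forall>\<^sub>F Y in at_top. lt t n \<le> tt Y"
      proof (cases "t = 0")
        case True
        then show ?thesis using tt(2) by (simp add: lt_def)
      next
        case False
        then have "lt t n < t" using t by (simp add: lt_def)
        from order_tendstoD(1)[OF tt(1) this] show ?thesis by eventually_elim simp
      qed
      have "((\<lambda>Y::real. 1 / Y\<^sup>2) \<longlongrightarrow> 0) at_top"
        by (intro real_tendsto_divide_at_top[OF tendsto_const] filterlim_pow_at_top filterlim_ident) simp
      from order_tendstoD(2)[OF this, of "1 / real (Suc n)"]
      have e2: "\<forall>\<^sub>F Y in at_top. 1 / Y\<^sup>2 < 1 / real (Suc n)" by simp
      show "\<forall>\<^sub>F Y in at_top. real (card (hits c c' (W (lt t n) (1 / real (Suc n))) Y)) \<le> real (card (?N Y))"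
        using e1 e2 eventually_gt_at_top[of 0]
      proof eventually_elim
        case (elim Y)
        have "W (lt t n) (1 / real (Suc n)) \<subseteq> W (tt Y) (1 / Y\<^sup>2)"
          using elim lt_bounds[OF t] by (intro W_mono) auto
        then have "near T (tt Y) Y z" if "z \<in> hits c c' (W (lt t n) (1 / real (Suc n))) Y" for z
          using that by (auto simp: near_def hits_def[OF unimod] W_def)
        moreover have "z \<in> ?P Y" if "z \<in> hits c c' (W (lt t n) (1 / real (Suc n))) Y" for z
          using inP[OF that] elim by (auto simp: W_def)
        ultimately have "hits c c' (W (lt t n) (1 / real (Suc n))) Y \<subseteq> ?N Y" by blast
        then show ?case by (simp add: card_mono finite_Pr)
      qed
    qed
  qed
  show "lbd (\<lambda>Y. real (card (?F Y))) (kap / q * (a * q - D t))"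
  proof (rule lbd_limit)
    show "(\<lambda>n. kap / q * measure lborel (Out (t + 1 / real (Suc n)))) \<longlonglongrightarrow> kap / q * (a * q - D t)"
      by (intro tendsto_mult tendsto_const Out_lim t)
    fix n
    show "lbd (\<lambda>Y. real (card (?F Y))) (kap / q * measure lborel (Out (t + 1 / real (Suc n))))"
    proof (rule lbd_mono[OF lbd_hits_open[OF unimod open_Out] order_refl])
      show "Out (t + 1 / real (Suc n)) \<subseteq> {0<..<1} \<times> {0<..<real_of_int q}" using sub by (auto simp: Out_def)
      show "0 \<le> t + 1 / real (Suc n)" using t by simp
      have "t < t + 1 / real (Suc n)" by simp
      note e1 = order_tendstoD(2)[OF tt(1) this]
      show "\<forall>\<^sub>F Y in at_top. real (card (hits c c' (Out (t + 1 / real (Suc n))) Y)) \<le> real (card (?F Y))"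
        using e1 tt(2) eventually_gt_at_top[of 0]
      proof eventually_elim
        case (elim Y)
        have "\<not> near T (tt Y) Y z" if z: "z \<in> hits c c' (Out (t + 1 / real (Suc n))) Y" for z
        proof
          assume "near T (tt Y) Y z"
          then obtain v w i j k where z': "z = (v, w)" "(i, j, k) \<in> T" "strict_cond (tt Y) (1 / Y\<^sup>2) (i, j, k) (nsq v / Y, dotp w v / nsq v)"
            by (auto simp: near_def)
          then have "weak_cond (t + 1 / real (Suc n)) (i, j, k) (nsq v / Y, dotp w v / nsq v)"
            using elim T by (intro strict_imp_weak[OF z'(3)]) auto
          then show False using z z' by (auto simp: hits_def[OF unimod] Out_def)
        qed
        moreover have "z \<in> ?P Y" if "z \<in> hits c c' (Out (t + 1 / real (Suc n))) Y" for z
          using inP[OF that] elim by (auto simp: Out_def)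
        ultimately have "hits c c' (Out (t + 1 / real (Suc n))) Y \<subseteq> ?F Y" by blast
        then show ?case by (simp add: card_mono finite_Pr)
      qed
    qed
  qed
  have "card (?F Y) + card (?N Y) = card (primset c (a * Y))" for Y
  proof -
    have "card (?P Y) = card (?F Y \<union> ?N Y)" by (rule arg_cong[of _ _ card]) auto
    also have "\<dots> = card (?F Y) + card (?N Y)" by (intro card_Un_disjoint) (auto simp: finite_Pr)
    finally show ?thesis using bij_betw_same_card[OF bij_Pr_primset[OF unimod], of "a * Y"] by (simp only:)
  qed
  then have e: "real (card (?F Y)) + real (card (?N Y)) = real (card (primset c (a * Y)))" for Y
    unfolding of_nat_add[symmetric] by (simp only:)
  have "kap / q * (a * q - D t) + kap / q * D t = kap * a" using q_pos by (simp add: field_simps)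
  then show "((\<lambda>Y. (real (card (?F Y)) + real (card (?N Y))) / Y) \<longlongrightarrow> kap / q * (a * q - D t) + kap / q * D t) at_top"
    unfolding e using prim_count_scaled[OF unit_class_c[OF unimod], of a] ab by simp
qed

text \<open>Positive density shows that the class contains a primitive vector. A completion of it,
  negated for orientation, represents the class sought.\<close>

lemma partner_class_exists:
  assumes "unit_class c" shows "\<exists>c'. q dvd crs c' c - 1"
proof -
  have "\<forall>\<^sub>F Y in at_top. 0 < real (card (primset c Y)) / Y"
    by (rule order_tendstoD(1)[OF prim_count[OF assms] kap_pos])
  then obtain Y where "0 < real (card (primset c Y)) / Y" by (auto simp: eventually_at_top_linorder)
  then have "primset c Y \<noteq> {}" by auto
  then obtain v where v: "prim v" "vcong q v c" by (auto simp: primset_def)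
  obtain u where "crs v u = 1" using prim_bezout[OF v(1)] .
  then have "crs (scal (-1) u) c - 1 = - (crs v u - crs c u)"
    by (simp add: crs_def scal_def algebra_simps)
  then have "q dvd crs (scal (-1) u) c - 1"
    using crs_comb_dvd[OF v(2), of u] by (simp only: dvd_minus_iff)
  then show ?thesis by blast
qed

end

section \<open>The directions sorted by residue class\<close>

locale pointed_level = level +
  fixes p :: "int \<times> int"
  assumes p: "coprime (vgcd p) q"
begin

text \<open>With \<open>p = q \<alpha>\<close> and \<open>Y = (q T)^2\<close> these are the
  primitive direction vectors: k is the gcd of \<open>q x\<close> for a visible point x, so
  \<open>q x = k v\<close>.\<close>

definition V :: "real \<Rightarrow> (int \<times> int) set" where
  "V Y = {v. prim v \<and> (\<exists>k. 1 \<le> k \<and> k \<le> q \<and> vcong q (scal k v) p \<and> real_of_int (k\<^sup>2 * nsq v) < Y)}"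

definition mults :: "int \<times> int \<Rightarrow> int set" where
  "mults c = {k \<in> {1..q}. vcong q (scal k c) p}"

text \<open>The visible point nearest to the origin on the ray of v has the least multiplier, so
  \<open>kmin\<close> alone decides membership in \<open>V Y\<close>. \<open>rad\<close> is the
  resulting bound for \<open>|v|^2 / Y\<close>.\<close>

definition kmin :: "int \<times> int \<Rightarrow> int" where "kmin c = Min (mults c)"

definition Cl :: "(int \<times> int) set" where
  "Cl = {c \<in> {0..<q} \<times> {0..<q}. unit_class c \<and> mults c \<noteq> {}}"

text \<open>Chosen once per class, so that \<open>trip c\<close> is the same for all v in the
  class.\<close>

definition partner :: "int \<times> int \<Rightarrow> int \<times> int" where
  "partner c = (SOME c'. q dvd crs c' c - 1)"

text \<open>For \<open>u = i v + j w\<close> the congruence puts \<open>k u\<close> into the class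
  of p, and it depends on v and w only through their classes. Coprimality of i and j is primitivity
  of u, and \<open>j >= 1\<close> puts u on the clockwise side of v.\<close>

definition trip :: "int \<times> int \<Rightarrow> (int \<times> int \<times> int) set" where
  "trip c = {(i, j, k). j \<ge> 1 \<and> 1 \<le> k \<and> k \<le> q \<and> coprime i j \<and> vcong q (scal k (comb i c j (partner c))) p}"

definition rad :: "int \<times> int \<Rightarrow> real" where "rad c = 1 / (real_of_int (kmin c))\<^sup>2"

lemma partner: "c \<in> Cl \<Longrightarrow> q dvd crs (partner c) c - 1"
  unfolding partner_def by (rule someI_ex[OF partner_class_exists]) (simp add: Cl_def)

lemma kmin: "c \<in> Cl \<Longrightarrow> kmin c \<in> mults c" "k \<in> mults c \<Longrightarrow> kmin c \<le> k"
proof -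
  have fin: "finite (mults c)" by (rule finite_subset[of _ "{1..q}"]) (auto simp: mults_def)
  show "c \<in> Cl \<Longrightarrow> kmin c \<in> mults c" unfolding kmin_def by (rule Min_in[OF fin]) (simp add: Cl_def)
  show "k \<in> mults c \<Longrightarrow> kmin c \<le> k" unfolding kmin_def by (rule Min_le[OF fin])
qed

lemma finite_Cl: "finite Cl" by (rule finite_subset[of _ "{0..<q} \<times> {0..<q}"]) (auto simp: Cl_def)

lemma region_trip: "c \<in> Cl \<Longrightarrow> region (trip c) (rad c) (real_of_int q)"
proof
  assume c: "c \<in> Cl"
  then have "kmin c \<ge> 1" using kmin(1)[OF c] by (simp add: mults_def)
  then show "0 < rad c" "rad c \<le> 1" by (auto simp: rad_def)
  show "0 < real_of_int q" using q_pos by simp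
qed (auto simp: trip_def)

lemma vcong_scal: "vcong q u u' \<Longrightarrow> vcong q (scal k u) (scal k u')"
  using vcong_comb[of q u u' u u' k 0] by (simp add: comb_def scal_def)

lemma vcong_scal_iff: "vcong q u u' \<Longrightarrow> vcong q (scal k u) p \<longleftrightarrow> vcong q (scal k u') p"
  using vcong_scal[of u u' k] vcong_trans vcong_sym by blast

lemma V_class:
  assumes c: "c \<in> Cl" and v: "prim v" "vcong q v c" and Y: "Y > 0"
  shows "v \<in> V Y \<longleftrightarrow> v \<in> primset c (rad c * Y)"
proof -
  have k: "1 \<le> kmin c" "kmin c \<le> q" "vcong q (scal (kmin c) c) p" using kmin(1)[OF c] by (auto simp: mults_def)
  have k2: "(real_of_int (kmin c))\<^sup>2 > 0" using k by simp
  have "v \<in> V Y \<longleftrightarrow> real_of_int ((kmin c)\<^sup>2 * nsq v) < Y"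
  proof
    assume "v \<in> V Y"
    then obtain j where j: "1 \<le> j" "j \<le> q" "vcong q (scal j v) p" "real_of_int (j\<^sup>2 * nsq v) < Y" by (auto simp: V_def)
    then have "j \<in> mults c" using vcong_scal_iff[OF v(2)] by (simp add: mults_def)
    then have "(kmin c)\<^sup>2 * nsq v \<le> j\<^sup>2 * nsq v"
      using kmin(2) k nsq_nonneg by (intro mult_right_mono power_mono) auto
    then show "real_of_int ((kmin c)\<^sup>2 * nsq v) < Y" using j(4) by linarith
  next
    assume "real_of_int ((kmin c)\<^sup>2 * nsq v) < Y"
    then show "v \<in> V Y" using v k vcong_scal_iff[OF v(2)] unfolding V_def by blast
  qed
  also have "\<dots> \<longleftrightarrow> v \<in> primset c (rad c * Y)"
    using v k2 by (simp add: primset_def rad_def field_simps)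
  finally show ?thesis .
qed

lemma V_decomp:
  assumes "Y > 0" shows "V Y = (\<Union>c\<in>Cl. primset c (rad c * Y))"
proof (intro set_eqI iffI)
  fix v assume v: "v \<in> V Y"
  let ?c = "(fst v mod q, snd v mod q)"
  have pv: "prim v" using v by (simp add: V_def)
  have cong: "vcong q v ?c" by (simp add: vcong_def)
  have "unit_class v" using pv by (simp add: unit_class_def prim_vgcd)
  then have "unit_class ?c" using unit_class_vcong[OF cong] by simp
  moreover have "mults ?c \<noteq> {}" using v vcong_scal_iff[OF cong] by (auto simp: V_def mults_def)
  ultimately have "?c \<in> Cl" using q_pos by (simp add: Cl_def)
  then show "v \<in> (\<Union>c\<in>Cl. primset c (rad c * Y))" using V_class[OF _ pv cong assms] v by blast
next
  fix v assume "v \<in> (\<Union>c\<in>Cl. primset c (rad c * Y))"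
  then obtain c where c: "c \<in> Cl" "v \<in> primset c (rad c * Y)" by blast
  then have "prim v" "vcong q v c" by (simp_all add: primset_def)
  then show "v \<in> V Y" using V_class[OF c(1) _ _ assms] c(2) by blast
qed

lemma primset_disjoint:
  assumes "c \<in> Cl" "d \<in> Cl" "c \<noteq> d" shows "primset c X \<inter> primset d Z = {}"
proof -
  have "c = d" if "vcong q v c" "vcong q v d" for v
  proof -
    have "vcong q c d" using that vcong_sym vcong_trans by blast
    then have "q dvd fst c - fst d" "q dvd snd c - snd d" by (simp_all add: vcong_def)
    moreover have "\<bar>fst c - fst d\<bar> < q" "\<bar>snd c - snd d\<bar> < q" using assms(1,2) by (auto simp: Cl_def)
    ultimately have "fst c - fst d = 0" "snd c - snd d = 0"
      using dvd_imp_le_int[of "fst c - fst d" q] dvd_imp_le_int[of "snd c - snd d" q] by force+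
    then show ?thesis by (simp add: prod_eq_iff)
  qed
  then show ?thesis using assms(3) by (auto simp: primset_def)
qed

lemma finite_V: "finite (V Y)"
proof (cases "Y > 0")
  case True
  then show ?thesis by (simp add: V_decomp finite_Cl finite_primset)
next
  case False
  have "real_of_int (k\<^sup>2 * nsq v) \<ge> 0" for k v using nsq_nonneg by simp
  then have "V Y = {}" using False unfolding V_def by (smt (verit) empty_Collect_eq)
  then show ?thesis by simp
qed

definition dens :: real where "dens = (\<Sum>c\<in>Cl. kap * rad c)"

lemma card_V_tendsto: "((\<lambda>Y. real (card (V Y)) / Y) \<longlongrightarrow> dens) at_top"
proof -
  have "((\<lambda>Y. \<Sum>c\<in>Cl. real (card (primset c (rad c * Y))) / Y) \<longlongrightarrow> dens) at_top"
    unfolding dens_def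
  proof (intro tendsto_sum prim_count_scaled)
    fix c assume c: "c \<in> Cl"
    then show "unit_class c" by (simp add: Cl_def)
    show "rad c > 0" using region_trip[OF c] by (simp add: region_def)
  qed
  moreover have "\<forall>\<^sub>F Y in at_top. (\<Sum>c\<in>Cl. real (card (primset c (rad c * Y))) / Y) = real (card (V Y)) / Y"
    using eventually_gt_at_top[of 0]
  proof eventually_elim
    case (elim Y)
    have "card (V Y) = (\<Sum>c\<in>Cl. card (primset c (rad c * Y)))"
      unfolding V_decomp[OF elim] using primset_disjoint by (intro card_UN_disjoint finite_Cl) (auto simp: finite_primset)
    then show ?case by (simp add: sum_divide_distrib)
  qed
  ultimately show ?thesis by (rule Lim_transform_eventually)
qed

text \<open>The class of p itself admits the multiplier 1, so \<open>Cl\<close> is not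
  empty.\<close>

lemma dens_pos: "dens > 0"
proof -
  let ?c = "(fst p mod q, snd p mod q)"
  have cong: "vcong q p ?c" by (simp add: vcong_def)
  have "unit_class ?c" using unit_class_vcong[OF cong] p by (simp add: unit_class_def)
  moreover have "1 \<in> mults ?c" using q_pos vcong_sym[OF cong] by (simp add: mults_def scal_def)
  ultimately have "?c \<in> Cl" using q_pos by (auto simp: Cl_def)
  moreover have "kap * rad c > 0" if "c \<in> Cl" for c
    using region_trip[OF that] kap_pos by (simp add: region_def)
  ultimately show ?thesis unfolding dens_def by (intro sum_pos finite_Cl) auto
qed

text \<open>\<open>crs u v / dotp u v\<close> is the tangent of the angle from u to v. So for r > 0
  some direction precedes v by an acute angle with tangent below r.\<close>

definition close :: "real \<Rightarrow> real \<Rightarrow> int \<times> int \<Rightarrow> bool" where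
  "close Y r v \<longleftrightarrow> (\<exists>u\<in>V Y. 0 < crs u v \<and> real_of_int (crs u v) < r * real_of_int (dotp u v))"

text \<open>Every u is \<open>crs w u\<close> times v plus \<open>crs u v\<close> times w. Here
  \<open>h (i + j \<rho>) = dotp u v / Y\<close>, which is why r gets multiplied by Y, and
  Lagrange's identity expresses \<open>|u|^2\<close> through h and \<open>dotp u v\<close>, which
  produces the term with \<open>1 / Y^2\<close>.\<close>

lemma close_iff_near:
  assumes c: "c \<in> Cl" and Y: "Y > 0" and z: "(v, w) \<in> Pr c (partner c) 0 q (rad c * Y)"
  shows "close Y r v \<longleftrightarrow> near (trip c) (r * Y) Y (v, w)"
proof -
  have wv: "crs w v = 1" "vcong q v c" "vcong q w (partner c)" using z by (auto simp: Pr_def)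
  define h where "h = rsq v"
  have h: "h > 0" using nsq_pos[OF crs_1_nz(2)[OF wv(1)]] unfolding h_def by linarith
  have iff: "strict_cond (r * Y) (1 / Y\<^sup>2) (i, j, k) (nsq v / Y, dotp w v / nsq v) \<longleftrightarrow>
    real_of_int (crs u v) < r * real_of_int (dotp u v) \<and> real_of_int (k\<^sup>2 * nsq u) < Y"
    if u: "u = comb i v j w" for i j k u
  proof -
    have cu: "crs u v = j" using wv(1) unfolding u by (simp add: crs_def comb_def algebra_simps)
    have "dotp u v = i * nsq v + j * dotp w v" unfolding u by (simp add: dotp_def comb_def algebra_simps)
    then have d: "real_of_int (dotp u v) = i * h + j * dotp w v" by (simp add: h_def)
    then have s: "nsq v / Y * (real_of_int i + real_of_int j * (dotp w v / nsq v)) = dotp u v / Y"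
      using h Y unfolding h_def[symmetric] by (simp add: field_simps)
    have nn: "rsq u * h = (real_of_int (dotp u v))\<^sup>2 + (real_of_int j)\<^sup>2"
      using lagrange[of u v] cu unfolding h_def by (metis of_int_add of_int_mult of_int_power)
    have "(real_of_int k)\<^sup>2 * ((dotp u v / Y)\<^sup>2 + 1 / Y\<^sup>2 * (real_of_int j)\<^sup>2) = (real_of_int k)\<^sup>2 * nsq u * h / Y\<^sup>2"
      using nn by (simp add: power_divide add_divide_distrib[symmetric])
    also have "\<dots> < h / Y \<longleftrightarrow> (real_of_int k)\<^sup>2 * nsq u * h < h * Y"
      using Y by (simp add: power2_eq_square field_simps)
    also have "\<dots> \<longleftrightarrow> real_of_int (k\<^sup>2 * nsq u) < Y" using h by (simp add: mult.commute[of h])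
    finally show ?thesis using s Y by (simp add: strict_cond_def cu h_def)
  qed
  have cramer: "u = comb (crs w u) v (crs u v) w" for u
  proof -
    have e: "x * (fst w * snd v - snd w * fst v) = x" for x using wv(1) by (simp add: crs_def)
    show ?thesis using e[of "fst u"] e[of "snd u"]
      by (simp add: comb_def crs_def prod_eq_iff algebra_simps)
  qed
  have mem: "prim u \<longleftrightarrow> coprime i j" if "u = comb i v j w" for u i j
  proof
    have ij: "crs w u = i" "crs u v = j" using wv(1) that by (simp_all add: crs_def comb_def algebra_simps)
    show "coprime i j" if "prim u"
    proof (rule coprimeI)
      fix r assume "r dvd i" "r dvd j"
      then have "r dvd fst u" "r dvd snd u" using \<open>u = comb i v j w\<close> by (auto simp: comb_def)
      then show "is_unit r" using \<open>prim u\<close> coprime_common_divisor unfolding prim_def by blast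
    qed
    show "prim u" if "coprime i j"
      unfolding prim_def
    proof (rule coprimeI)
      fix r assume "r dvd fst u" "r dvd snd u"
      then have "r dvd crs w u" "r dvd crs u v" by (simp_all add: crs_def)
      then show "is_unit r" using that ij coprime_common_divisor by blast
    qed
  qed
  have cg: "vcong q (scal k (comb i v j w)) p \<longleftrightarrow> vcong q (scal k (comb i c j (partner c))) p" for i j k
    by (rule vcong_scal_iff[OF vcong_comb[OF wv(2,3)]])
  show ?thesis
  proof
    assume "close Y r v"
    then obtain u k where u: "prim u" "1 \<le> k" "k \<le> q" "vcong q (scal k u) p" "real_of_int (k\<^sup>2 * nsq u) < Y"
      "0 < crs u v" "real_of_int (crs u v) < r * real_of_int (dotp u v)"
      by (auto simp: close_def V_def)
    let ?i = "crs w u" and ?j = "crs u v"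
    have "vcong q (scal k (comb ?i v ?j w)) p" using u(4) cramer[of u] by simp
    then have "(?i, ?j, k) \<in> trip c"
      using u mem[OF cramer] cg by (simp add: trip_def)
    moreover have "strict_cond (r * Y) (1 / Y\<^sup>2) (?i, ?j, k) (nsq v / Y, dotp w v / nsq v)"
      using iff[OF cramer] u by simp
    ultimately show "near (trip c) (r * Y) Y (v, w)" unfolding near_def by auto
  next
    assume "near (trip c) (r * Y) Y (v, w)"
    then obtain i j k where t: "(i, j, k) \<in> trip c" "strict_cond (r * Y) (1 / Y\<^sup>2) (i, j, k) (nsq v / Y, dotp w v / nsq v)"
      unfolding near_def by auto
    let ?u = "comb i v j w"
    have "crs ?u v = j" using wv(1) by (simp add: crs_def comb_def algebra_simps)
    moreover have "?u \<in> V Y"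
      using t iff[OF refl, of i j k] mem[OF refl, of i j] cg unfolding V_def trip_def by blast
    ultimately show "close Y r v" using t iff[OF refl, of i j k] unfolding close_def trip_def by force
  qed
qed

definition farlim :: "real \<Rightarrow> real" where
  "farlim t = (\<Sum>c\<in>Cl. kap / q * (rad c * q - region.D (trip c) (rad c) (real_of_int q) t))"

lemma card_far:
  assumes Y: "Y > 0"
  shows "card {v \<in> V Y. \<not> close Y r v} =
    (\<Sum>c\<in>Cl. card {z \<in> Pr c (partner c) 0 q (rad c * Y). \<not> near (trip c) (r * Y) Y z})"
proof -
  have "{v \<in> V Y. \<not> close Y r v} = (\<Union>c\<in>Cl. {v \<in> primset c (rad c * Y). \<not> close Y r v})"
    unfolding V_decomp[OF Y] by auto
  also have "card \<dots> = (\<Sum>c\<in>Cl. card {v \<in> primset c (rad c * Y). \<not> close Y r v})"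
  proof (intro card_UN_disjoint finite_Cl ballI impI)
    fix c d assume "c \<in> Cl" "d \<in> Cl" "c \<noteq> d"
    then show "{v \<in> primset c (rad c * Y). \<not> close Y r v} \<inter> {v \<in> primset d (rad d * Y). \<not> close Y r v} = {}"
      using primset_disjoint by blast
  qed (simp add: finite_primset)
  also have "\<dots> = (\<Sum>c\<in>Cl. card {z \<in> Pr c (partner c) 0 q (rad c * Y). \<not> near (trip c) (r * Y) Y z})"
  proof (rule sum.cong[OF refl])
    fix c assume c: "c \<in> Cl"
    note bij = bij_Pr_primset[OF partner[OF c], of "rad c * Y"]
    have "{v \<in> primset c (rad c * Y). \<not> close Y r v} = fst ` {z \<in> Pr c (partner c) 0 q (rad c * Y). \<not> near (trip c) (r * Y) Y z}" (is "_ = fst ` ?S")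
      using close_iff_near[OF c Y] unfolding bij_betw_imp_surj_on[OF bij, symmetric] by force
    moreover have "inj_on fst ?S" using bij_betw_imp_inj_on[OF bij] by (rule inj_on_subset) auto
    ultimately show "card {v \<in> primset c (rad c * Y). \<not> close Y r v} = card ?S"
      by (simp add: card_image)
  qed
  finally show ?thesis .
qed

theorem far_count_tendsto:
  assumes tt: "((\<lambda>Y. r Y * Y) \<longlongrightarrow> t) at_top" "\<forall>\<^sub>F Y in at_top. 0 \<le> r Y" and t: "0 \<le> t"
  shows "((\<lambda>Y. real (card {v \<in> V Y. \<not> close Y (r Y) v}) / Y) \<longlongrightarrow> farlim t) at_top"
proof -
  have nn: "\<forall>\<^sub>F Y in at_top. 0 \<le> r Y * Y"
    using tt(2) eventually_ge_at_top[of 0] by eventually_elim simp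
  have "((\<lambda>Y. \<Sum>c\<in>Cl. real (card {z \<in> Pr c (partner c) 0 q (rad c * Y). \<not> near (trip c) (r Y * Y) Y z}) / Y) \<longlongrightarrow> farlim t) at_top"
    unfolding farlim_def by (intro tendsto_sum far_tendsto partner region_trip tt(1) nn t)
  moreover have "\<forall>\<^sub>F Y in at_top. (\<Sum>c\<in>Cl. real (card {z \<in> Pr c (partner c) 0 q (rad c * Y). \<not> near (trip c) (r Y * Y) Y z}) / Y)
     = real (card {v \<in> V Y. \<not> close Y (r Y) v}) / Y"
    using eventually_gt_at_top[of 0]
    by eventually_elim (simp add: card_far sum_divide_distrib)
  ultimately show ?thesis by (rule Lim_transform_eventually)
qed

lemma farlim_0: "farlim 0 = dens"
  unfolding farlim_def dens_def
  using q_pos by (intro sum.cong refl) (simp add: region.D_0[OF region_trip])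

lemma farlim_antimono: "0 \<le> s \<Longrightarrow> s \<le> t \<Longrightarrow> farlim t \<le> farlim s"
  unfolding farlim_def using kap_pos q_pos
  by (intro sum_mono mult_left_mono diff_left_mono region.D_mono[OF region_trip]) auto

lemma farlim_continuous: "continuous_on {0..} farlim"
  unfolding farlim_def[abs_def]
  by (intro continuous_intros region.D_continuous[OF region_trip])

end


section \<open>Angles and gaps\<close>

definition cv :: "int \<times> int \<Rightarrow> complex" where
  "cv v = Complex (real_of_int (fst v)) (real_of_int (snd v))"

definition ang :: "int \<times> int \<Rightarrow> real" where "ang v = Arg (cv v) / (2 * pi)"

lemma ang_bounds: "- (1/2) < ang v" "ang v \<le> 1/2"
  using Arg_bounded[of "cv v"] by (auto simp: ang_def field_simps)

lemma cv_nz: "v \<noteq> (0, 0) \<Longrightarrow> cv v \<noteq> 0"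
  by (cases v) (auto simp: cv_def complex_eq_iff)

lemma cv_mult_cnj: "cv v * cnj (cv u) = Complex (dotp u v) (crs u v)"
  by (simp add: cv_def dotp_def crs_def complex_eq_iff algebra_simps)

lemma rcis_quotient:
  "Complex (dotp u v) (crs u v) = rcis (cmod (cv v) * cmod (cv u)) (Arg (cv v) - Arg (cv u))"
proof -
  have "cv v * cnj (cv u) = rcis (cmod (cv v)) (Arg (cv v)) * cnj (rcis (cmod (cv u)) (Arg (cv u)))"
    by (simp add: rcis_cmod_Arg)
  also have "cnj (rcis (cmod (cv u)) (Arg (cv u))) = rcis (cmod (cv u)) (- Arg (cv u))"
    by (simp add: rcis_def cis_cnj)
  finally show ?thesis by (simp add: cv_mult_cnj rcis_mult)
qed

lemma rcis_2pi: "rcis r (x + 2 * pi) = rcis r x" "rcis r (x - 2 * pi) = rcis r x"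
proof -
  have *: "rcis r (x + 2 * pi) = rcis r x" for x
    using cis_mult[of x "2 * pi"] by (simp add: rcis_def)
  show "rcis r (x + 2 * pi) = rcis r x" by (rule *)
  show "rcis r (x - 2 * pi) = rcis r x" using *[of "x - 2 * pi"] by simp
qed

text \<open>The right side forces \<open>Re z > 0\<close>, as \<open>tan a\<close> is positive. This
  confines z to the open first quadrant, where tan is increasing.\<close>

lemma Arg_pos_less_iff:
  assumes "z \<noteq> 0" "0 < a" "a < pi / 2"
  shows "0 < Arg z \<and> Arg z < a \<longleftrightarrow> 0 < Im z \<and> Im z < tan a * Re z"
proof -
  define r where "r = cmod z"
  define \<phi> where "\<phi> = Arg z"
  have r: "r > 0" using assms by (simp add: r_def)
  have "z = rcis r \<phi>" by (simp add: r_def \<phi>_def rcis_cmod_Arg)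
  then have re: "Re z = r * cos \<phi>" and im: "Im z = r * sin \<phi>" by simp_all
  have b: "- pi < \<phi>" "\<phi> \<le> pi" using Arg_bounded[of z] by (simp_all add: \<phi>_def)
  have t: "tan a > 0" using assms by (intro tan_gt_zero)
  have tan\<phi>: "tan \<phi> = sin \<phi> / cos \<phi>" by (simp add: tan_def)
  have "0 < \<phi> \<and> \<phi> < a \<longleftrightarrow> 0 < r * sin \<phi> \<and> r * sin \<phi> < tan a * (r * cos \<phi>)"
  proof
    assume p: "0 < \<phi> \<and> \<phi> < a"
    then have "0 < sin \<phi>" "0 < cos \<phi>" using assms by (auto intro!: sin_gt_zero cos_gt_zero)
    moreover have "tan \<phi> < tan a" using p assms by (intro tan_monotone) auto
    ultimately have "sin \<phi> < tan a * cos \<phi>" by (simp add: tan\<phi> pos_divide_less_eq)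
    then have "r * sin \<phi> < r * (tan a * cos \<phi>)" using r by (intro mult_strict_left_mono)
    then show "0 < r * sin \<phi> \<and> r * sin \<phi> < tan a * (r * cos \<phi>)"
      using r \<open>0 < sin \<phi>\<close> by (simp add: mult_ac)
  next
    assume p: "0 < r * sin \<phi> \<and> r * sin \<phi> < tan a * (r * cos \<phi>)"
    then have s: "sin \<phi> > 0" using r by (simp add: zero_less_mult_iff)
    have "r * sin \<phi> < r * (tan a * cos \<phi>)" using p by (simp add: mult_ac)
    then have l: "sin \<phi> < tan a * cos \<phi>" using r by simp
    then have "tan a * cos \<phi> > 0" using s by linarith
    then have c: "cos \<phi> > 0" using t by (simp add: zero_less_mult_iff)
    have "\<phi> > 0"
    proof (rule ccontr)
      assume "\<not> \<phi> > 0"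
      then have "sin (- \<phi>) \<ge> 0" using b by (intro sin_ge_zero) auto
      then show False using s by simp
    qed
    moreover have "\<phi> < pi / 2"
    proof (rule ccontr)
      assume n: "\<not> \<phi> < pi / 2"
      then have "sin (\<phi> - pi / 2) \<ge> 0" using b by (intro sin_ge_zero) auto
      then have "- cos \<phi> \<ge> 0" by (simp add: sin_diff)
      then show False using c by simp
    qed
    moreover have "\<phi> < a"
    proof (rule ccontr)
      assume "\<not> \<phi> < a"
      then have "tan a \<le> tan \<phi>" using assms \<open>\<phi> < pi/2\<close> tan_monotone[of a \<phi>] by (cases "a = \<phi>") auto
      moreover have "tan \<phi> < tan a" using l c by (simp add: tan\<phi> pos_divide_less_eq)
      ultimately show False by simp
    qed
    ultimately show "0 < \<phi> \<and> \<phi> < a" by simp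
  qed
  then show ?thesis by (simp add: re im \<phi>_def)
qed

text \<open>The second alternative is a neighbour across the cut of the argument, its angle lowered
  by one turn. Together they say that the argument of \<open>cv v * cnj (cv u)\<close> lies in
  \<open>(0, 2 pi \<delta>)\<close>, and \<open>\<delta> < 1/4\<close> keeps this below a right
  angle.\<close>

lemma ang_close_iff:
  assumes nz: "u \<noteq> (0, 0)" "v \<noteq> (0, 0)" and d: "0 \<le> \<delta>" "\<delta> < 1/4"
  shows "(ang v - \<delta> < ang u \<and> ang u < ang v) \<or> ang v - \<delta> < ang u - 1 \<longleftrightarrow>
    0 < crs u v \<and> real_of_int (crs u v) < tan (2 * pi * \<delta>) * real_of_int (dotp u v)"
proof (cases "\<delta> = 0")
  case True
  then show ?thesis using ang_bounds[of u] ang_bounds[of v] by auto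
next
  case False
  then have d0: "\<delta> > 0" using d by simp
  define z where "z = Complex (dotp u v) (crs u v)"
  define x where "x = Arg (cv v) - Arg (cv u)"
  define r where "r = cmod (cv v) * cmod (cv u)"
  have z: "z = rcis r x" unfolding z_def x_def r_def by (rule rcis_quotient)
  have r: "r > 0" using nz by (simp add: r_def cv_nz)
  then have znz: "z \<noteq> 0" using z by (metis rcis_eq_zero_iff less_irrefl)
  have xb: "- (2 * pi) < x" "x < 2 * pi"
    using Arg_bounded[of "cv v"] Arg_bounded[of "cv u"] by (auto simp: x_def)
  have a: "0 < 2 * pi * \<delta>" "2 * pi * \<delta> < pi / 2" using d d0 by auto
  have ang: "ang v - ang u = x / (2 * pi)" by (simp add: ang_def x_def diff_divide_distrib)
  have "(ang v - \<delta> < ang u \<and> ang u < ang v) \<longleftrightarrow> 0 < ang v - ang u \<and> ang v - ang u < \<delta>" by linarith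
  also have "\<dots> \<longleftrightarrow> 0 < x \<and> x < 2 * pi * \<delta>" unfolding ang by (simp add: zero_less_divide_iff pos_divide_less_eq mult.commute)
  finally have 1: "(ang v - \<delta> < ang u \<and> ang u < ang v) \<longleftrightarrow> 0 < x \<and> x < 2 * pi * \<delta>" .
  have "ang v - \<delta> < ang u - 1 \<longleftrightarrow> ang v - ang u + 1 < \<delta>" by linarith
  also have "ang v - ang u + 1 = (x + 2 * pi) / (2 * pi)" unfolding ang by (simp add: add_divide_distrib)
  finally have 2: "ang v - \<delta> < ang u - 1 \<longleftrightarrow> x + 2 * pi < 2 * pi * \<delta>"
    by (simp add: pos_divide_less_eq mult.commute)
  have 3: "(0 < x \<and> x < 2 * pi * \<delta>) \<or> x + 2 * pi < 2 * pi * \<delta> \<longleftrightarrow> 0 < Arg z \<and> Arg z < 2 * pi * \<delta>"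
  proof
    assume "(0 < x \<and> x < 2 * pi * \<delta>) \<or> x + 2 * pi < 2 * pi * \<delta>"
    then show "0 < Arg z \<and> Arg z < 2 * pi * \<delta>"
    proof
      assume h: "0 < x \<and> x < 2 * pi * \<delta>"
      then have "x \<in> {- pi<..pi}" using a(2) unfolding greaterThanAtMost_iff by linarith
      then have "Arg z = x" by (intro Arg_unique'[OF r _ z])
      then show ?thesis using h by simp
    next
      assume h: "x + 2 * pi < 2 * pi * \<delta>"
      then have "x + 2 * pi \<in> {- pi<..pi}" using a(2) xb unfolding greaterThanAtMost_iff by linarith
      then have "Arg z = x + 2 * pi" by (intro Arg_unique'[OF r]) (auto simp: z rcis_2pi)
      then show ?thesis using h xb by simp
    qed
  next
    assume h: "0 < Arg z \<and> Arg z < 2 * pi * \<delta>"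
    \<comment> \<open>The difference x of two arguments equals \<open>Arg z\<close> up to a full
      turn; its range tells which.\<close>
    consider "0 < x" "x \<le> pi" | "x > pi" | "- pi < x" "x \<le> 0" | "x \<le> - pi" by linarith
    then show "(0 < x \<and> x < 2 * pi * \<delta>) \<or> x + 2 * pi < 2 * pi * \<delta>"
    proof cases
      case 1
      then have "Arg z = x" by (intro Arg_unique'[OF r _ z]) auto
      then show ?thesis using h by simp
    next
      case 2
      then have "Arg z = x - 2 * pi" using xb by (intro Arg_unique'[OF r]) (auto simp: z rcis_2pi)
      then show ?thesis using h xb by simp
    next
      case 3
      then have "Arg z = x" by (intro Arg_unique'[OF r _ z]) auto
      then show ?thesis using h 3 by simp
    next
      case 4
      then have "Arg z = x + 2 * pi" using xb by (intro Arg_unique'[OF r]) (auto simp: z rcis_2pi)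
      then show ?thesis using h by simp
    qed
  qed
  show ?thesis unfolding 1 2 3 Arg_pos_less_iff[OF znz a] by (simp add: z_def)
qed

text \<open>Equal arguments give \<open>crs u v = 0\<close> and \<open>dotp u v > 0\<close>.
  Completing u to a basis shows that v is an integer multiple t of u; comparing gcds gives
  \<open>|t| = 1\<close>, and the positive product gives t = 1.\<close>

lemma ang_inj: "inj_on ang {v. prim v}"
proof (rule inj_onI)
  fix v u assume p: "v \<in> {v. prim v}" "u \<in> {v. prim v}" and e: "ang v = ang u"
  have nz: "v \<noteq> (0,0)" "u \<noteq> (0,0)" using p prim_nz by auto
  have "Arg (cv v) = Arg (cv u)" using e by (simp add: ang_def)
  then have "Complex (dotp u v) (crs u v) = of_real (cmod (cv v) * cmod (cv u))"
    unfolding rcis_quotient by (simp add: rcis_def)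
  then have c: "crs u v = 0" and d: "real_of_int (dotp u v) = cmod (cv v) * cmod (cv u)"
    by (simp_all add: complex_eq_iff)
  have "dotp u v > 0" using d cv_nz[OF nz(1)] cv_nz[OF nz(2)] by (simp flip: of_int_0_less_iff[where 'a = real])
  obtain w where w: "crs u w = 1" using p prim_bezout by blast
  define t where "t = crs v w"
  have x: "y * (fst u * snd w - snd u * fst w) = y" for y using w by (simp add: crs_def)
  have c': "fst u * snd v = snd u * fst v" using c by (simp add: crs_def)
  have "t * fst u = fst v * (fst u * snd w) - (fst u * snd v) * fst w" by (simp add: t_def crs_def algebra_simps)
  also have "\<dots> = fst v" using x[of "fst v"] unfolding c' by (simp add: algebra_simps)
  finally have "fst v = t * fst u" ..
  have "t * snd u = (snd u * fst v) * snd w - snd v * (snd u * fst w)" by (simp add: t_def crs_def algebra_simps)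
  also have "\<dots> = snd v" using x[of "snd v"] unfolding c'[symmetric] by (simp add: algebra_simps)
  finally have "snd v = t * snd u" ..
  note \<open>fst v = t * fst u\<close> this
  then have v: "v = scal t u" by (simp add: scal_def prod_eq_iff)
  then have "\<bar>t\<bar> * vgcd u = vgcd v" by (simp add: vgcd_scal)
  then have "\<bar>t\<bar> = 1" using p by (simp add: prim_vgcd)
  moreover have "dotp u v = t * nsq u" by (simp add: v dotp_def scal_def algebra_simps)
  then have "t > 0" using \<open>dotp u v > 0\<close> nsq_nonneg[of u] by (simp add: zero_less_mult_iff)
  ultimately show "v = u" using v by (simp add: scal_def)
qed

section \<open>Gaps of a finite set on the circle of length one\<close>

locale circular =
  fixes A :: "real set"
  assumes A: "finite A" "A \<noteq> {}" "\<And>d. d \<in> A \<Longrightarrow> - (1/2) < d \<and> d \<le> 1/2"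
begin

definition xs :: "real list" where "xs = sorted_list_of_set A"

definition xi :: "nat \<Rightarrow> real" where
  "xi j = (if j = 0 then xs ! (card A - 1) - 1 else xs ! (j - 1))"

lemma xs: "set xs = A" "length xs = card A" "sorted xs" "distinct xs"
  using A by (simp_all add: xs_def)

lemma card_pos: "card A > 0" using A by (simp add: card_gt_0_iff)

lemma xs_less: "i < j \<Longrightarrow> j < card A \<Longrightarrow> xs ! i < xs ! j"
  using xs strict_sorted_iff[of xs] sorted_wrt_iff_nth_less[of "(<)" xs] by auto

lemma xs_in: "i < card A \<Longrightarrow> xs ! i \<in> A"
  using nth_mem[of i xs] by (simp add: xs(1,2))

lemma in_A_nth: "d \<in> A \<Longrightarrow> \<exists>i<card A. d = xs ! i"
  using in_set_conv_nth[of d xs] by (auto simp: xs(1,2))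

lemma xi_gap_nonneg:
  assumes "j \<in> {1..card A}" shows "xi j - xi (j - 1) \<ge> 0"
proof (cases "j = 1")
  case True
  then show ?thesis using A(3)[OF xs_in[of 0]] A(3)[OF xs_in[of "card A - 1"]] card_pos by (simp add: xi_def)
next
  case False
  then have "xs ! (j - 2) < xs ! (j - 1)" using assms by (intro xs_less) auto
  then show ?thesis using False assms by (simp add: xi_def numeral_2_eq_2)
qed

lemma xi_gap_sum: "(\<Sum>j\<in>{1..card A}. xi j - xi (j - 1)) = 1"
proof -
  have "(\<Sum>j\<in>{1..n}. xi j - xi (j - 1)) = xi n - xi 0" for n
    by (induction n) auto
  then show ?thesis using card_pos by (simp add: xi_def)
qed

text \<open>The copy \<open>d' - 1\<close> represents a point reached across the cut. It lies below
  d automatically, as A is contained in a half-open interval of length one.\<close>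

definition isolated :: "real \<Rightarrow> real \<Rightarrow> bool" where
  "isolated \<delta> d \<longleftrightarrow> (\<forall>d'\<in>A. \<not> ((d - \<delta> < d' \<and> d' < d) \<or> d - \<delta> < d' - 1))"

text \<open>Isolation of \<open>xi j\<close> can be tested on its predecessor. For j = 1 this is the
  largest point lowered by one; for other j all copies lowered by one lie below the
  predecessor.\<close>

lemma gap_iff_isolated:
  assumes j: "j \<in> {1..card A}" shows "xi j - xi (j - 1) \<ge> \<delta> \<longleftrightarrow> isolated \<delta> (xi j)"
proof (cases "j = 1")
  case True
  have first: "xs ! 0 \<le> d'" "d' \<le> xs ! (card A - 1)" if d': "d' \<in> A" for d'
  proof -
    obtain i where i: "i < card A" "d' = xs ! i" using in_A_nth[OF d'] by blast
    show "xs ! 0 \<le> d'" "d' \<le> xs ! (card A - 1)"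
      using i xs(2,3) by (auto intro!: sorted_nth_mono)
  qed
  have "xi j - xi (j - 1) \<ge> \<delta> \<longleftrightarrow> xs ! (card A - 1) - 1 \<le> xs ! 0 - \<delta>"
    using True by (auto simp: xi_def)
  also have "\<dots> \<longleftrightarrow> isolated \<delta> (xi j)"
  proof
    assume h: "xs ! (card A - 1) - 1 \<le> xs ! 0 - \<delta>"
    show "isolated \<delta> (xi j)" unfolding isolated_def
    proof
      fix d' assume "d' \<in> A"
      from first[OF this] h True show "\<not> ((xi j - \<delta> < d' \<and> d' < xi j) \<or> xi j - \<delta> < d' - 1)"
        by (simp add: xi_def)
    qed
  next
    assume "isolated \<delta> (xi j)"
    then have "\<not> xi j - \<delta> < xs ! (card A - 1) - 1"
      using xs_in[of "card A - 1"] card_pos unfolding isolated_def by auto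
    then show "xs ! (card A - 1) - 1 \<le> xs ! 0 - \<delta>" using True by (simp add: xi_def)
  qed
  finally show ?thesis .
next
  case False
  let ?p = "xs ! (j - 2)"
  have p: "xi (j - 1) = ?p" "xi j = xs ! (j - 1)" using False j by (auto simp: xi_def numeral_2_eq_2)
  have pA: "?p \<in> A" "?p < xi j" using j False xs_in[of "j - 2"] xs_less[of "j - 2" "j - 1"] p by auto
  have below: "d' \<le> ?p" if d': "d' \<in> A" "d' < xi j" for d'
  proof -
    obtain i where i: "i < card A" "d' = xs ! i" using in_A_nth[OF d'(1)] by blast
    have "i < j - 1"
    proof (rule ccontr)
      assume "\<not> i < j - 1"
      then have "xs ! (j - 1) \<le> xs ! i" using i xs(2,3) by (intro sorted_nth_mono) auto
      then show False using d'(2) i p by simp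
    qed
    then show ?thesis using i j xs(2,3) by (auto intro!: sorted_nth_mono)
  qed
  show ?thesis
  proof
    assume g: "xi j - xi (j - 1) \<ge> \<delta>"
    show "isolated \<delta> (xi j)" unfolding isolated_def
    proof
      fix d' assume d': "d' \<in> A"
      have "d' - 1 < ?p" using A(3)[OF d'] A(3)[OF pA(1)] by linarith
      then show "\<not> ((xi j - \<delta> < d' \<and> d' < xi j) \<or> xi j - \<delta> < d' - 1)"
        using below[OF d'] g p by linarith
    qed
  next
    assume "isolated \<delta> (xi j)"
    then have "\<not> (xi j - \<delta> < ?p \<and> ?p < xi j)" using pA unfolding isolated_def by blast
    then show "xi j - xi (j - 1) \<ge> \<delta>" using pA p by linarith
  qed
qed

lemma card_gaps: "card {j \<in> {1..card A}. xi j - xi (j - 1) \<ge> \<delta>} = card {d \<in> A. isolated \<delta> d}"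
proof -
  have bij: "bij_betw xi {1..card A} A"
    unfolding bij_betw_def
  proof
    show "inj_on xi {1..card A}"
    proof (rule inj_onI)
      fix i j assume "i \<in> {1..card A}" "j \<in> {1..card A}" "xi i = xi j"
      then have "i - 1 = j - 1" using nth_eq_iff_index_eq[OF xs(4), of "i - 1" "j - 1"] xs(2) by (auto simp: xi_def)
      then show "i = j" using \<open>i \<in> _\<close> \<open>j \<in> _\<close> by auto
    qed
    show "xi ` {1..card A} = A"
    proof (intro set_eqI iffI)
      fix d assume "d \<in> A"
      then obtain i where i: "i < card A" "d = xs ! i" using in_A_nth by blast
      then show "d \<in> xi ` {1..card A}" by (intro image_eqI[of _ _ "Suc i"]) (auto simp: xi_def)
    qed (auto simp: xi_def intro!: xs_in)
  qed
  have "bij_betw xi {j \<in> {1..card A}. xi j - xi (j - 1) \<ge> \<delta>} {d \<in> A. isolated \<delta> d}"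
  proof (rule bij_betw_subset[OF bij])
    show "xi ` {j \<in> {1..card A}. xi j - xi (j - 1) \<ge> \<delta>} = {d \<in> A. isolated \<delta> d}"
    proof (intro set_eqI iffI)
      fix d assume "d \<in> xi ` {j \<in> {1..card A}. xi j - xi (j - 1) \<ge> \<delta>}"
      then obtain j where "j \<in> {1..card A}" "xi j - xi (j - 1) \<ge> \<delta>" "d = xi j" by blast
      then show "d \<in> {d \<in> A. isolated \<delta> d}"
        using gap_iff_isolated bij_betw_imp_surj_on[OF bij] by blast
    next
      fix d assume d: "d \<in> {d \<in> A. isolated \<delta> d}"
      then obtain j where "j \<in> {1..card A}" "d = xi j" using bij_betw_imp_surj_on[OF bij] by blast
      then show "d \<in> xi ` {j \<in> {1..card A}. xi j - xi (j - 1) \<ge> \<delta>}"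
        using d gap_iff_isolated by blast
    qed
  qed blast
  then show ?thesis by (rule bij_betw_same_card)
qed

text \<open>Markov's inequality: the gaps are nonnegative and sum to one turn.\<close>

lemma card_gaps_le: "real (card {j \<in> {1..card A}. xi j - xi (j - 1) \<ge> \<delta>}) * \<delta> \<le> 1"
proof -
  let ?S = "{j \<in> {1..card A}. xi j - xi (j - 1) \<ge> \<delta>}"
  have "real (card ?S) * \<delta> \<le> (\<Sum>j\<in>?S. xi j - xi (j - 1))"
    using sum_bounded_below[of ?S \<delta> "\<lambda>j. xi j - xi (j - 1)"] by auto
  also have "\<dots> \<le> (\<Sum>j\<in>{1..card A}. xi j - xi (j - 1))"
    using xi_gap_nonneg by (intro sum_mono2) auto
  finally show ?thesis by (simp only: xi_gap_sum)
qed

end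


section \<open>The directions of the shifted lattice\<close>

lemma tendsto_tan_over: "((\<lambda>x::real. tan x / x) \<longlongrightarrow> 1) (at 0)"
proof -
  have "DERIV tan (0::real) :> inverse ((cos 0)\<^sup>2)" by (rule DERIV_tan) simp
  then show ?thesis unfolding DERIV_def by simp
qed

lemma common_denom:
  assumes "fst \<alpha> \<in> \<rat>" "snd \<alpha> \<in> \<rat>"
  shows "0 < common_denom \<alpha>" "real (common_denom \<alpha>) * fst \<alpha> \<in> \<int>" "real (common_denom \<alpha>) * snd \<alpha> \<in> \<int>"
    "0 < r \<Longrightarrow> real r * fst \<alpha> \<in> \<int> \<Longrightarrow> real r * snd \<alpha> \<in> \<int> \<Longrightarrow> common_denom \<alpha> \<le> r"
proof -
  obtain i n j m where e: "n \<noteq> 0" "m \<noteq> 0" "fst \<alpha> = real_of_int i / real n" "snd \<alpha> = real_of_int j / real m"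
    using assms unfolding Rats_eq_int_div_nat by auto
  have "real (n * m) * fst \<alpha> = of_int (int m * i)" "real (n * m) * snd \<alpha> = of_int (int n * j)"
    using e by simp_all
  then have "0 < n * m \<and> real (n * m) * fst \<alpha> \<in> \<int> \<and> real (n * m) * snd \<alpha> \<in> \<int>"
    using e by (metis Ints_of_int mult_pos_pos neq0_conv)
  from LeastI[of "\<lambda>q. 0 < q \<and> real q * fst \<alpha> \<in> \<int> \<and> real q * snd \<alpha> \<in> \<int>", OF this]
  show "0 < common_denom \<alpha>" "real (common_denom \<alpha>) * fst \<alpha> \<in> \<int>" "real (common_denom \<alpha>) * snd \<alpha> \<in> \<int>"
    unfolding common_denom_def by blast+
  show "0 < r \<Longrightarrow> real r * fst \<alpha> \<in> \<int> \<Longrightarrow> real r * snd \<alpha> \<in> \<int> \<Longrightarrow> common_denom \<alpha> \<le> r"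
    unfolding common_denom_def by (rule Least_le) blast
qed

text \<open>A common factor h > 1 of p and q would make \<open>q / h\<close> a smaller common
  denominator.\<close>

lemma pointed_level_common_denom:
  assumes "fst \<alpha> \<in> \<rat>" "snd \<alpha> \<in> \<rat>"
    and p: "real (common_denom \<alpha>) * fst \<alpha> = of_int (fst p)" "real (common_denom \<alpha>) * snd \<alpha> = of_int (snd p)"
  shows "pointed_level (int (common_denom \<alpha>)) p"
proof
  note cd = common_denom[OF assms(1,2)]
  define Q where "Q = common_denom \<alpha>"
  show "0 < int (common_denom \<alpha>)" using cd(1) by simp
  have "is_unit g" if g: "g dvd vgcd p" "g dvd int Q" for g
  proof -
    define h where "h = nat \<bar>g\<bar>"
    have "g \<noteq> 0" using g(2) cd(1) by (auto simp: Q_def)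
    then have h: "h > 0" "\<bar>g\<bar> = int h" by (auto simp: h_def)
    have "int h dvd int Q" "int h dvd fst p" "int h dvd snd p"
      using g h(2) by (auto simp: vgcd_def simp flip: h(2))
    then obtain r a b where r: "int Q = int h * r" "fst p = int h * a" "snd p = int h * b" by (auto simp: dvd_def)
    then have "r > 0" using h cd(1) unfolding Q_def by (metis of_nat_0_less_iff zero_less_mult_pos)
    then obtain r' where r': "r = int r'" "r' > 0" by (metis of_nat_0_less_iff pos_int_cases)
    have Q: "Q = h * r'" using r(1) r'(1) by (metis of_nat_eq_iff of_nat_mult)
    have "real h * (real r' * fst \<alpha>) = real h * real_of_int a" "real h * (real r' * snd \<alpha>) = real h * real_of_int b"
      using p r(2,3) unfolding Q_def[symmetric] Q by (simp_all add: mult.assoc)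
    then have "real r' * fst \<alpha> = real_of_int a" "real r' * snd \<alpha> = real_of_int b" using h by simp_all
    then have "Q \<le> r'" unfolding Q_def using r' by (intro cd(4)) auto
    then have "h = 1" using Q r' h by (cases h) auto
    then show "is_unit g" using h(2) by simp
  qed
  then show "coprime (vgcd p) (int (common_denom \<alpha>))" unfolding Q_def by (intro coprimeI)
qed

context pointed_level begin

text \<open>For a visible x let k be the gcd of \<open>q x\<close> and write
  \<open>q x = k v\<close> with v primitive. Visibility becomes \<open>k <= q\<close>, and x lying
  in the shifted lattice becomes the congruence of \<open>k v\<close> with p.\<close>

lemma directions_eq:
  assumes q: "q = int (common_denom \<alpha>)"
    and p: "real_of_int q * fst \<alpha> = of_int (fst p)" "real_of_int q * snd \<alpha> = of_int (snd p)"
    and T: "T > 0"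
  shows "directions \<alpha> T = ang ` V ((real_of_int q * T)\<^sup>2)"
proof (intro set_eqI iffI)
  have qr: "real (common_denom \<alpha>) = real_of_int q" using q by simp
  have qp: "real_of_int q > 0" using q_pos by simp
  {
    fix d assume "d \<in> directions \<alpha> T"
    then obtain x1 x2 where d: "d = Arg (Complex x1 x2) / (2 * pi)" "(x1, x2) \<in> visible_points \<alpha>" "x1\<^sup>2 + x2\<^sup>2 < T\<^sup>2"
      unfolding directions_def by blast
    then obtain a b m n where ab: "(x1, x2) \<noteq> (0, 0)" "q * x1 = of_int a" "q * x2 = of_int b" "gcd a b \<le> q"
      and mn: "x1 = of_int m + fst \<alpha>" "x2 = of_int n + snd \<alpha>"
      unfolding visible_points_def shifted_lattice_def by (auto simp: q)
    have nz: "(a, b) \<noteq> (0, 0)" using ab qp by auto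
    define k where "k = vgcd (a, b)"
    have "0 < k" unfolding k_def by (rule vgcd_pos[OF nz])
    then have k: "1 \<le> k" by simp
    have "k \<le> q" using ab(4) by (simp add: k_def vgcd_def)
    note k = k this
    obtain v where v: "prim v" "(a, b) = scal k v" using vgcd_split[OF nz] unfolding k_def by blast
    have "real_of_int a = real_of_int (q * m + fst p)" "real_of_int b = real_of_int (q * n + snd p)"
      using ab mn p by (simp_all add: algebra_simps)
    then have "a = q * m + fst p" "b = q * n + snd p" by (simp_all only: of_int_eq_iff)
    then have "vcong q (scal k v) p" unfolding v(2)[symmetric] by (simp add: vcong_def)
    moreover have "real_of_int (k\<^sup>2 * nsq v) < (real_of_int q * T)\<^sup>2"
    proof -
      have "k\<^sup>2 * nsq v = nsq (a, b)" by (simp add: v(2) nsq_scal)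
      also have "rsq (a, b) = (q * x1)\<^sup>2 + (q * x2)\<^sup>2" using ab by (simp add: dotp_def power2_eq_square)
      also have "\<dots> = (real_of_int q)\<^sup>2 * (x1\<^sup>2 + x2\<^sup>2)" by (simp add: power_mult_distrib algebra_simps)
      also have "\<dots> < (real_of_int q)\<^sup>2 * T\<^sup>2" using d(3) qp by (intro mult_strict_left_mono) auto
      finally show ?thesis by (simp add: power_mult_distrib)
    qed
    ultimately have vV: "v \<in> V ((real_of_int q * T)\<^sup>2)" using v(1) k unfolding V_def by blast
    have "Complex x1 x2 = of_real (k / q) * cv v"
    proof -
      have "real_of_int a = k * fst v" "real_of_int b = k * snd v" using v(2) by (auto simp: scal_def)
      then show ?thesis using ab qp by (simp add: cv_def complex_eq_iff field_simps)
    qed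
    moreover have "real_of_int k / q > 0" using k qp by simp
    ultimately have "d = ang v" unfolding d(1) ang_def by (simp only: Arg_times_of_real)
    then show "d \<in> ang ` V ((real_of_int q * T)\<^sup>2)" using vV by blast
  }
  {
    fix d assume "d \<in> ang ` V ((real_of_int q * T)\<^sup>2)"
    then obtain v k where v: "d = ang v" "prim v" "1 \<le> k" "k \<le> q" "vcong q (scal k v) p" "real_of_int (k\<^sup>2 * nsq v) < (real_of_int q * T)\<^sup>2"
      unfolding V_def by blast
    define a b where "a = k * fst v" and "b = k * snd v"
    define x1 x2 where "x1 = real_of_int a / q" and "x2 = real_of_int b / q"
    have ab: "q * x1 = of_int a" "q * x2 = of_int b" using qp by (simp_all add: x1_def x2_def)
    obtain m n where "a - fst p = q * m" "b - snd p = q * n"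
      using v(5) by (auto simp: vcong_def scal_def a_def b_def dvd_def)
    then have "real_of_int a = q * (of_int m + fst \<alpha>)" "real_of_int b = q * (of_int n + snd \<alpha>)"
      using p by (simp_all add: algebra_simps flip: of_int_mult of_int_add)
    then have mn: "x1 = of_int m + fst \<alpha>" "x2 = of_int n + snd \<alpha>" using qp by (simp_all add: x1_def x2_def)
    have "(a, b) \<noteq> (0, 0)" using prim_nz[OF v(2)] v(3) by (cases v) (auto simp: a_def b_def)
    then have "(x1, x2) \<noteq> (0, 0)" using qp by (auto simp: x1_def x2_def)
    moreover have "gcd a b = k"
      using v(2,3) vgcd_scal[of k v] by (simp add: vgcd_def scal_def a_def b_def prim_vgcd)
    moreover have "(x1, x2) \<in> shifted_lattice \<alpha>" unfolding shifted_lattice_def using mn by blast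
    ultimately have vis: "(x1, x2) \<in> visible_points \<alpha>"
      unfolding visible_points_def mem_Collect_eq fst_conv snd_conv qr q[symmetric] using ab v(4) by blast
    have small: "x1\<^sup>2 + x2\<^sup>2 < T\<^sup>2"
    proof -
      have "(real_of_int q)\<^sup>2 * (x1\<^sup>2 + x2\<^sup>2) = (q * x1)\<^sup>2 + (q * x2)\<^sup>2" by (simp add: power_mult_distrib algebra_simps)
      also have "\<dots> = real_of_int (k\<^sup>2 * nsq v)" unfolding ab by (simp add: a_def b_def dotp_def power2_eq_square algebra_simps)
      also have "\<dots> < (real_of_int q)\<^sup>2 * T\<^sup>2" using v(6) by (simp add: power_mult_distrib)
      finally show ?thesis using qp by simp
    qed
    have "Complex x1 x2 = of_real (k / q) * cv v"
      using qp by (simp add: cv_def complex_eq_iff x1_def x2_def a_def b_def)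
    moreover have "real_of_int k / q > 0" using v(3) qp by simp
    ultimately have "Arg (Complex x1 x2) = Arg (cv v)" by (simp only: Arg_times_of_real)
    then have "d = Arg (Complex x1 x2) / (2 * pi)" using v(1) by (simp add: ang_def)
    then show "d \<in> directions \<alpha> T" unfolding directions_def using vis small by blast
  }
qed

lemma inj_on_ang_V: "inj_on ang (V Y)"
  by (rule inj_on_subset[OF ang_inj]) (auto simp: V_def)

lemma card_ang_V: "card (ang ` V Y) = card (V Y)"
  by (rule card_image[OF inj_on_ang_V])

lemma card_V_at_top: "filterlim (\<lambda>Y. real (card (V Y))) at_top at_top"
proof -
  have "filterlim (\<lambda>Y. real (card (V Y)) / Y * Y) at_top at_top"
    by (rule filterlim_tendsto_pos_mult_at_top[OF card_V_tendsto dens_pos filterlim_ident])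
  then show ?thesis
    by (rule filterlim_mono_eventually[OF _ order_refl order_refl])
      (rule eventually_mono[OF eventually_gt_at_top[of 0]], simp)
qed

text \<open>A scaled gap s is \<open>s / M\<close> turns with \<open>M = card (V Y)\<close>; the
  tangent of this angle is the threshold in \<open>close\<close>.\<close>

definition slope :: "real \<Rightarrow> real \<Rightarrow> real" where
  "slope s Y = tan (2 * pi * (s / real (card (V Y))))"

lemma eventually_card_V: "\<forall>\<^sub>F Y in at_top. x < real (card (V Y))"
  using card_V_at_top by (auto simp: filterlim_at_top_dense)

lemma slope_nonneg:
  assumes "0 \<le> s" shows "\<forall>\<^sub>F Y in at_top. 0 \<le> slope s Y"
  using eventually_card_V[of "4 * s"]
proof eventually_elim
  case (elim Y)
  have p: "real (card (V Y)) > 0" using elim assms by linarith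
  have "s / real (card (V Y)) < 1 / 4" using elim p by (simp add: divide_less_eq)
  then have "2 * pi * (s / real (card (V Y))) < pi / 2"
    using mult_strict_left_mono[of "s / real (card (V Y))" "1/4" "2 * pi"] by simp
  moreover have "0 \<le> 2 * pi * (s / real (card (V Y)))" using assms p by simp
  ultimately have "0 < 2 * pi * (s / real (card (V Y))) \<longrightarrow> 0 < tan (2 * pi * (s / real (card (V Y))))"
    "2 * pi * (s / real (card (V Y))) = 0 \<or> 0 < 2 * pi * (s / real (card (V Y)))"
    using tan_gt_zero by auto
  then show ?case unfolding slope_def by (metis less_eq_real_def order_refl tan_zero)
qed

text \<open>\<open>tan x\<close> is asymptotic to x, and \<open>card (V Y)\<close> to
  \<open>dens * Y\<close>. The case s = 0 is treated apart because \<open>tan x / x\<close> requires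
  a nonzero x.\<close>

lemma slope_tendsto:
  assumes "0 \<le> s" shows "((\<lambda>Y. slope s Y * Y) \<longlongrightarrow> 2 * pi * s / dens) at_top"
proof (cases "s = 0")
  case True
  then show ?thesis by (simp add: slope_def)
next
  case False
  then have s: "s > 0" using assms by simp
  define x where "x Y = 2 * pi * (s / real (card (V Y)))" for Y
  have "(x \<longlongrightarrow> 2 * pi * 0) at_top"
    unfolding x_def by (intro tendsto_intros real_tendsto_divide_at_top[OF tendsto_const card_V_at_top])
  moreover have "\<forall>\<^sub>F Y in at_top. x Y \<noteq> 0"
    using eventually_card_V[of 0] by eventually_elim (use s in \<open>simp add: x_def\<close>)
  ultimately have "filterlim x (at 0) at_top" by (simp add: filterlim_at)
  from filterlim_compose[OF tendsto_tan_over this]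
  have "((\<lambda>Y. tan (x Y) / x Y * (2 * pi * s / (real (card (V Y)) / Y))) \<longlongrightarrow> 1 * (2 * pi * s / dens)) at_top"
    using dens_pos by (intro tendsto_intros card_V_tendsto) auto
  moreover have "\<forall>\<^sub>F Y in at_top. tan (x Y) / x Y * (2 * pi * s / (real (card (V Y)) / Y)) = slope s Y * Y"
    using eventually_card_V[of 0] eventually_gt_at_top[of 0]
    by eventually_elim (use s in \<open>simp add: x_def slope_def field_simps\<close>)
  ultimately have "((\<lambda>Y. slope s Y * Y) \<longlongrightarrow> 1 * (2 * pi * s / dens)) at_top"
    by (rule Lim_transform_eventually)
  then show ?thesis by simp
qed

text \<open>The argument of \<open>farlim\<close> is the limit of \<open>slope s Y * Y\<close>.
  Dividing by \<open>dens\<close> turns a count per Y into a proportion of the directions.\<close>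

definition gap_tail :: "real \<Rightarrow> real" where
  "gap_tail s = farlim (2 * pi * s / dens) / dens"

lemma gap_ratio_tendsto:
  assumes "0 \<le> s"
  shows "((\<lambda>Y. real (card {v \<in> V Y. \<not> close Y (slope s Y) v}) / real (card (V Y))) \<longlongrightarrow> gap_tail s) at_top"
proof -
  have "0 \<le> 2 * pi * s / dens" using assms dens_pos by simp
  from far_count_tendsto[OF slope_tendsto[OF assms] slope_nonneg[OF assms] this]
  have "((\<lambda>Y. (real (card {v \<in> V Y. \<not> close Y (slope s Y) v}) / Y) / (real (card (V Y)) / Y)) \<longlongrightarrow> gap_tail s) at_top"
    unfolding gap_tail_def using dens_pos by (intro tendsto_divide card_V_tendsto) auto
  then show ?thesis
    by (rule Lim_transform_eventually) (rule eventually_mono[OF eventually_gt_at_top[of 0]], simp)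
qed

lemma circular_ang: "V Y \<noteq> {} \<Longrightarrow> circular (ang ` V Y)"
  by unfold_locales (use ang_bounds finite_V in auto)

text \<open>\<open>4 * s < M\<close> makes the threshold \<open>s / M\<close> less than a quarter
  turn, as \<open>ang_close_iff\<close> requires.\<close>

lemma card_gaps_V:
  assumes "0 \<le> s" "4 * s < real (card (V Y))"
  shows "card {j \<in> {1..card (V Y)}. s \<le> real (card (V Y)) * (circular.xi (ang ` V Y) j - circular.xi (ang ` V Y) (j - 1))}
    = card {v \<in> V Y. \<not> close Y (slope s Y) v}"
proof -
  have M: "real (card (V Y)) > 0" using assms by linarith
  then have "V Y \<noteq> {}" by auto
  interpret circular "ang ` V Y" by (rule circular_ang) fact
  define \<delta> where "\<delta> = s / real (card (V Y))"
  have \<delta>: "0 \<le> \<delta>" "\<delta> < 1/4" using assms M by (auto simp: \<delta>_def divide_less_eq)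
  have "s \<le> real (card (V Y)) * g \<longleftrightarrow> \<delta> \<le> g" for g
    using M by (simp add: \<delta>_def divide_le_eq mult.commute)
  then have "card {j \<in> {1..card (V Y)}. s \<le> real (card (V Y)) * (xi j - xi (j - 1))} = card {j \<in> {1..card (ang ` V Y)}. \<delta> \<le> xi j - xi (j - 1)}"
    by (simp only: card_ang_V)
  also have "\<dots> = card {d \<in> ang ` V Y. isolated \<delta> d}" by (rule card_gaps)
  also have "{d \<in> ang ` V Y. isolated \<delta> d} = ang ` {v \<in> V Y. \<not> close Y (slope s Y) v}"
  proof -
    have "isolated \<delta> (ang v) \<longleftrightarrow> \<not> close Y (slope s Y) v" if v: "v \<in> V Y" for v
    proof -
      have "u \<noteq> (0, 0)" if "u \<in> V Y" for u using that prim_nz by (auto simp: V_def)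
      then show ?thesis
        using ang_close_iff[OF _ _ \<delta>, of _ v] v unfolding isolated_def close_def slope_def \<delta>_def by blast
    qed
    then show ?thesis by auto
  qed
  also have "card \<dots> = card {v \<in> V Y. \<not> close Y (slope s Y) v}"
    by (intro card_image inj_on_subset[OF inj_on_ang_V]) auto
  finally show ?thesis .
qed

lemma gap_tail_nonneg: "0 \<le> s \<Longrightarrow> 0 \<le> gap_tail s"
  by (rule tendsto_lowerbound[OF gap_ratio_tendsto]) auto

text \<open>The bound \<open>card_gaps_le\<close> survives the limit, so the decay of the limit
  function follows without evaluating any area.\<close>

lemma gap_tail_le:
  assumes "s > 0" shows "gap_tail s \<le> 1 / s"
proof (rule tendsto_upperbound[OF gap_ratio_tendsto])
  show "\<forall>\<^sub>F Y in at_top. real (card {v \<in> V Y. \<not> close Y (slope s Y) v}) / real (card (V Y)) \<le> 1 / s"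
    using eventually_card_V[of "4 * s"]
  proof eventually_elim
    case (elim Y)
    have M: "real (card (V Y)) > 0" using assms elim by linarith
    then have "V Y \<noteq> {}" by auto
    interpret circular "ang ` V Y" by (rule circular_ang) fact
    have "s \<le> real (card (V Y)) * g \<longleftrightarrow> s / real (card (V Y)) \<le> g" for g
      using M by (simp add: divide_le_eq mult.commute)
    then have "real (card {v \<in> V Y. \<not> close Y (slope s Y) v}) * (s / real (card (V Y))) \<le> 1"
      using card_gaps_le[of "s / real (card (V Y))"] card_gaps_V[of s Y] assms elim by (simp only: card_ang_V)
    then show ?case using M assms by (simp add: field_simps)
  qed
qed (use assms in auto)

lemma gap_tail_distribution: "tail_distribution_function gap_tail"
  unfolding tail_distribution_function_def
proof (intro conjI)
  show "antimono_on {0..} gap_tail"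
    unfolding gap_tail_def using dens_pos
    by (intro monotone_onI divide_right_mono farlim_antimono) (auto simp: divide_right_mono)
  show "gap_tail 0 = 1" using dens_pos by (simp add: gap_tail_def farlim_0)
  show "(gap_tail \<longlongrightarrow> 0) at_top"
  proof (rule tendsto_sandwich[OF _ _ tendsto_const])
    show "((\<lambda>s::real. 1 / s) \<longlongrightarrow> 0) at_top"
      by (intro real_tendsto_divide_at_top[OF tendsto_const] filterlim_ident)
    show "\<forall>\<^sub>F s in at_top. 0 \<le> gap_tail s"
      using eventually_ge_at_top[of 0] by eventually_elim (rule gap_tail_nonneg)
    show "\<forall>\<^sub>F s in at_top. gap_tail s \<le> 1 / s"
      using eventually_gt_at_top[of 0] by eventually_elim (rule gap_tail_le)
  qed
qed

lemma gap_tail_continuous: "continuous_on {0..} gap_tail"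
  unfolding gap_tail_def[abs_def]
proof (intro continuous_on_divide continuous_on_const)
  show "continuous_on {0..} (\<lambda>s. farlim (2 * pi * s / dens))"
    using dens_pos by (intro continuous_on_compose2[OF farlim_continuous] continuous_intros) auto
qed (use dens_pos in auto)

end

theorem corollary2p7:
  fixes \<alpha> :: "real \<times> real"
  assumes "fst \<alpha> \<in> \<rat>" and "snd \<alpha> \<in> \<rat>"
  shows "\<exists>P :: real \<Rightarrow> real.
           tail_distribution_function P \<and> continuous_on {0..} P \<and>
           (\<forall>s\<ge>0.
              ((\<lambda>T. real (card {j \<in> {1..num_directions \<alpha> T}.
                         real (num_directions \<alpha> T) * (dir_xi \<alpha> T j - dir_xi \<alpha> T (j - 1)) \<ge> s})
                     / real (num_directions \<alpha> T)) \<longlongrightarrow> P s) at_top)"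
proof -
  define q where "q = int (common_denom \<alpha>)"
  obtain p1 p2 where p12: "real_of_int q * fst \<alpha> = of_int p1" "real_of_int q * snd \<alpha> = of_int p2"
    using common_denom(2,3)[OF assms] unfolding q_def Ints_def by auto
  interpret pointed_level q "(p1, p2)"
    unfolding q_def using p12 by (intro pointed_level_common_denom assms) (simp_all add: q_def)
  have dir: "directions \<alpha> T = ang ` V ((real_of_int q * T)\<^sup>2)" if "T > 0" for T
    using directions_eq[OF q_def _ _ that] p12 by simp
  have "((\<lambda>T. real (card {j \<in> {1..num_directions \<alpha> T}.
                         real (num_directions \<alpha> T) * (dir_xi \<alpha> T j - dir_xi \<alpha> T (j - 1)) \<ge> s})
                     / real (num_directions \<alpha> T)) \<longlongrightarrow> gap_tail s) at_top" if s: "s \<ge> 0" for s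
  proof -
    \<comment> \<open>The substitution \<open>Y = (q T)^2\<close> transfers the limit in Y to one in
      T.\<close>
    have Y: "filterlim (\<lambda>T. (real_of_int q * T)\<^sup>2) at_top at_top"
      using q_pos by (intro filterlim_pow_at_top filterlim_tendsto_pos_mult_at_top[OF tendsto_const _ filterlim_ident]) auto
    from filterlim_compose[OF gap_ratio_tendsto[OF s] Y]
    show ?thesis
    proof (rule Lim_transform_eventually)
      show "\<forall>\<^sub>F T in at_top.
          real (card {v \<in> V ((real_of_int q * T)\<^sup>2). \<not> close ((real_of_int q * T)\<^sup>2) (slope s ((real_of_int q * T)\<^sup>2)) v}) / real (card (V ((real_of_int q * T)\<^sup>2)))
          = real (card {j \<in> {1..num_directions \<alpha> T}.
                         real (num_directions \<alpha> T) * (dir_xi \<alpha> T j - dir_xi \<alpha> T (j - 1)) \<ge> s})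
                     / real (num_directions \<alpha> T)"
        using eventually_gt_at_top[of 0] eventually_compose_filterlim[OF eventually_card_V[of "4 * s"] Y]
      proof eventually_elim
        case (elim T)
        let ?Y = "(real_of_int q * T)\<^sup>2"
        \<comment> \<open>The eventual inequality \<open>4 * s < card (V ?Y)\<close> with
          \<open>s >= 0\<close> excludes an empty set of directions.\<close>
        have "V ?Y \<noteq> {}" using elim s by auto
        interpret circular "ang ` V ?Y" by (rule circular_ang) fact
        have n: "num_directions \<alpha> T = card (V ?Y)"
          unfolding num_directions_def dir[OF elim(1)] by (rule card_ang_V)
        have xi: "dir_xi \<alpha> T j = xi j" for j
          unfolding dir_xi_def xi_def xs_def n dir[OF elim(1)] card_ang_V ..
        show ?case unfolding n xi using card_gaps_V[OF s elim(2)] by simp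
      qed
    qed
  qed
  then show ?thesis using gap_tail_distribution gap_tail_continuous by blast
qed

end
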